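(* Let $G$ be a group acting $(\kappa_0,N_0)$-acylindrically on a quasi-tree $X$ with bottleneck constant $\Delta>0$, where $\kappa_0\geqslant\Delta$ and $N_0\geqslant 1$. Let $\alpha=\frac{\Delta^2}{10^{52}N_0^6\kappa_0^2}$ and $K=10^{14}\kappa_0$. Then for every finite $U\subset G$ at least one of the following holds: 1. $\langle U\rangle$ is virtually $\mathbb{Z}$; 2. $\lambda_0(U)<K$; 3. $|U^n|\geqslant(\alpha|U|)^{\lfloor\frac{n+1}{2}\rfloor}$ for every $n\in\mathbb{N}$.
   Context: A geodesic metric space $X$ is a quasi-tree with bottleneck constant $\Delta\geqslant0$ if for every geodesic $[x,y]$ and every $z\in[x,y]$, every path from $x$ to $y$ meets the closed ball $B(z,\Delta)$; such a space is $\Delta$-hyperbolic. An isometric action of $G$ on a $\delta$-hyperbolic geodesic space $X$ is $(\kappa_0,N_0)$-acylindrical (with $\kappa_0\geqslant\delta$, $N_0\geqslant1$) if for all $x,y\in X$ with $d(x,y)\geqslant\kappa_0$, $|\{g\in G: d(x,gx)\leqslant100\delta,\ d(y,gy)\leqslant100\delta\}|\leqslant N_0$; here $\delta=\Delta$. For finite $U\subset G$, the normalised $\ell^1$-energy is $E(U)=\inf_{x\in X}\frac{1}{|U|}\sum_{u\in U}d(x,ux)$; fix a base point $x_0\in X$ with $\frac{1}{|U|}\sum_{u\in U}d(x_0,ux_0)\leqslant E(U)+\Delta$, and define the displacement $\lambda_0(U)=\max_{u\in U}d(x_0,ux_0)$. $U^n=\{u_1\cdots u_n:u_i\in U\}$.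 *)

theory Defs
  imports "HOL-Analysis.Analysis" "HOL-Algebra.Group_Action" "HOL-Algebra.Elementary_Groups"
begin

definition geodesic_path :: "real \<Rightarrow> (real \<Rightarrow> 'a::metric_space) \<Rightarrow> bool" where
  "geodesic_path L \<gamma> \<longleftrightarrow> L \<ge> 0 \<and> (\<forall>s\<in>{0..L}. \<forall>t\<in>{0..L}. dist (\<gamma> s) (\<gamma> t) = \<bar>s - t\<bar>)"

definition geodesic_between :: "'a::metric_space \<Rightarrow> 'a \<Rightarrow> (real \<Rightarrow> 'a) \<Rightarrow> bool" where
  "geodesic_between x y \<gamma> \<longleftrightarrow> geodesic_path (dist x y) \<gamma> \<and> \<gamma> 0 = x \<and> \<gamma> (dist x y) = y"

definition geodesic_space :: "'a::metric_space itself \<Rightarrow> bool" where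
  "geodesic_space _ \<longleftrightarrow> (\<forall>x y::'a. \<exists>\<gamma>. geodesic_between x y \<gamma>)"

definition quasi_tree :: "'a::metric_space itself \<Rightarrow> real \<Rightarrow> bool" where
  "quasi_tree T \<Delta> \<longleftrightarrow> geodesic_space T \<and> \<Delta> \<ge> 0 \<and>
     (\<forall>x y::'a. \<forall>\<gamma>. geodesic_between x y \<gamma> \<longrightarrow>
        (\<forall>z \<in> \<gamma> ` {0..dist x y}. \<forall>p. path p \<and> pathstart p = x \<and> pathfinish p = y \<longrightarrow>
            path_image p \<inter> cball z \<Delta> \<noteq> {}))"

definition isometric_action :: "('g, 'm) monoid_scheme \<Rightarrow> ('g \<Rightarrow> 'a::metric_space \<Rightarrow> 'a) \<Rightarrow> bool" where
  "isometric_action G \<phi> \<longleftrightarrow> group G \<and> group_action G UNIV \<phi> \<and>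
     (\<forall>g\<in>carrier G. \<forall>x y. dist (\<phi> g x) (\<phi> g y) = dist x y)"

definition acylindrical :: "('g, 'm) monoid_scheme \<Rightarrow> ('g \<Rightarrow> 'a::metric_space \<Rightarrow> 'a) \<Rightarrow> real \<Rightarrow> real \<Rightarrow> nat \<Rightarrow> bool" where
  "acylindrical G \<phi> \<delta> \<kappa>\<^sub>0 N\<^sub>0 \<longleftrightarrow>
     (\<forall>x y. dist x y \<ge> \<kappa>\<^sub>0 \<longrightarrow>
        (let S = {g \<in> carrier G. dist x (\<phi> g x) \<le> 100 * \<delta> \<and> dist y (\<phi> g y) \<le> 100 * \<delta>}
         in finite S \<and> card S \<le> N\<^sub>0))"

definition avg_displacement :: "('g \<Rightarrow> 'a::metric_space \<Rightarrow> 'a) \<Rightarrow> 'g set \<Rightarrow> 'a \<Rightarrow> real" where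
  "avg_displacement \<phi> U x = (\<Sum>u\<in>U. dist x (\<phi> u x)) / real (card U)"

definition energy :: "('g \<Rightarrow> 'a::metric_space \<Rightarrow> 'a) \<Rightarrow> 'g set \<Rightarrow> real" where
  "energy \<phi> U = (INF x. avg_displacement \<phi> U x)"

definition displacement :: "('g \<Rightarrow> 'a::metric_space \<Rightarrow> 'a) \<Rightarrow> 'g set \<Rightarrow> 'a \<Rightarrow> real" where
  "displacement \<phi> U x\<^sub>0 = Max ((\<lambda>u. dist x\<^sub>0 (\<phi> u x\<^sub>0)) ` U)"

definition set_pow :: "('g, 'm) monoid_scheme \<Rightarrow> 'g set \<Rightarrow> nat \<Rightarrow> 'g set" where
  "set_pow G U n = {foldr (\<otimes>\<^bsub>G\<^esub>) us \<one>\<^bsub>G\<^esub> | us. length us = n \<and> set us \<subseteq> U}"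

definition virtually_Z :: "('g, 'm) monoid_scheme \<Rightarrow> 'g set \<Rightarrow> bool" where
  "virtually_Z G H \<longleftrightarrow> (\<exists>K. subgroup K G \<and> K \<subseteq> H \<and>
      finite (rcosets\<^bsub>G\<lparr>carrier := H\<rparr>\<^esub> K) \<and> G\<lparr>carrier := K\<rparr> \<cong> integer_group)"

end

(*
The bottleneck property makes X hyperbolic, and it makes "lying in the same path component of the
complement of a ball" the same as "having a large Gromov product at its centre", up to an additive
error: directions at a point form an honest partition. Elements of U whose displacement is small compared with
that of some v in U can be interleaved with v, and the resulting words are almost determined by their
values. Otherwise almost all elements of U are long; as x0 almost minimises the energy, they cannot
all start and end in the same direction, and a cut of the set of directions yields A, B in U of
proportional size such that the words a1 b1 a2 b2 ... follow quasi-geodesics.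

If for some b in B the map (a, w) -> a b w has small fibres on average, words grow at the required
rate. If every b in B is bad, a typical fibre contains many occurrences a, a' of b shifted by small
amounts, so [x0, b x0] runs along the axis of the loxodromic a^-1 a'. Comparing two letters of B on
a common word shows that these axes have the same ends, and acylindricity then puts B into a single coset of
the stabiliser E of these ends. Now either U lies in E, and its span is virtually Z, or some v0 in U
gives an element outside E, and a ping-pong argument between E and that element gives growth.
*)
theory Submission
  imports Defs
begin

subsection \<open>Gromov products in quasi-trees\<close>

text \<open>Only every second letter of a word is free: the letters in between are the same for all
  words at a given step and serve to separate directions, so 2k+1 letters yield k+1 factors, whence
  the exponent. The obstacle is the size of the fibres of (a, w) -> a b w. Acylindricity bounds the
  number of elements carrying a long segment to almost the same place, but the letters a in one
  fibre may sit anywhere along [x0, g x0], over a range not bounded in terms of \<kappa>. Hence the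
  detour through axes: a fibre too large for this count contains many shifted copies of [x0, b x0].
  Two axes are identified once they overlap for about N periods, and a period may be long; so the
  shift used is the shortest available, and the element used for ping-pong is almost shortest among
  the long elements of E, which makes the counts independent of the period. The quasi-tree is used
  beyond hyperbolicity only to divide directions into classes. The branches lose factors of order N
  \<kappa>/\<Delta>, N^2 \<kappa>/\<Delta> and N^3 \<kappa>/\<Delta>; the constant of the theorem
  exceeds them all by a wide margin.\<close>

definition gp :: "'a::metric_space \<Rightarrow> 'a \<Rightarrow> 'a \<Rightarrow> real" where
  "gp x y w = (dist x w + dist y w - dist x y) / 2"

lemma two_gp: "2 * gp x y w = dist x w + dist y w - dist x y"
  by (simp add: gp_def)

lemma gp_commute: "gp x y w = gp y x w"
  by (simp add: gp_def dist_commute)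

text \<open>\<open>gp x y w\<close> has its base point last: up to a multiple of \<Delta> it is the
  distance from \<open>w\<close> to a geodesic [x, y], or the length that [w, x] and [w, y] share.
  On the tripod with ends x, y, w two legs make up a side, so a small product at one vertex means a
  large one at another; most arguments below alternate between the two.\<close>

lemma gp_add: "gp x y w + gp w y x = dist x w"
  by (simp add: gp_def dist_commute field_simps)

lemma gp_add': "gp x y w + gp x w y = dist w y"
  by (simp add: gp_def dist_commute field_simps)

lemma gp_nonneg: "0 \<le> gp x y w"
  using dist_triangle[of x y w] by (simp add: gp_def dist_commute)

lemma gp_self [simp]: "gp x x w = dist x w" "gp x w w = 0" "gp w x w = 0"
  by (simp_all add: gp_def dist_commute)

lemma gp_le_dist: "gp x y w \<le> dist x w" "gp x y w \<le> dist y w"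
  using gp_add[of x y w] gp_add'[of x y w] gp_nonneg[of w y x] gp_nonneg[of x w y]
  by (simp_all add: dist_commute)

lemma gp_base_le: "gp x y w \<le> gp x y w' + dist w w'"
  using dist_triangle[of x w w'] dist_triangle[of y w w'] by (simp add: gp_def dist_commute field_simps)

lemma gp_fst_le: "gp x y w \<le> gp x' y w + dist x x'"
  using dist_triangle[of x w x'] dist_triangle[of x' y x] by (simp add: gp_def dist_commute field_simps)

lemma path_geodesic:
  assumes "geodesic_between x y \<gamma>"
  shows "path (\<lambda>t. \<gamma> (dist x y * t))" "pathstart (\<lambda>t. \<gamma> (dist x y * t)) = x"
    "pathfinish (\<lambda>t. \<gamma> (dist x y * t)) = y"
    "path_image (\<lambda>t. \<gamma> (dist x y * t)) = \<gamma> ` {0..dist x y}"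
proof -
  have iso: "dist (\<gamma> s) (\<gamma> t) = \<bar>s - t\<bar>" if "s \<in> {0..dist x y}" "t \<in> {0..dist x y}" for s t
    using assms that by (auto simp: geodesic_between_def geodesic_path_def)
  have cont: "continuous_on {0..dist x y} \<gamma>"
    unfolding continuous_on_iff by (metis dist_commute dist_real_def iso)
  have im: "(\<lambda>t. dist x y * t) ` {0..1} = {0..dist x y}"
    using image_mult_atLeastAtMost_if[of "dist x y" 0 1] by auto
  show "path (\<lambda>t. \<gamma> (dist x y * t))"
    unfolding path_def
    by (rule continuous_on_compose2[OF cont]) (use im in \<open>auto intro!: continuous_intros\<close>)
  show "pathstart (\<lambda>t. \<gamma> (dist x y * t)) = x" "pathfinish (\<lambda>t. \<gamma> (dist x y * t)) = y"
    using assms by (auto simp: pathstart_def pathfinish_def geodesic_between_def)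
  have "path_image (\<lambda>t. \<gamma> (dist x y * t)) = \<gamma> ` (\<lambda>t. dist x y * t) ` {0..1}"
    unfolding path_image_def by (simp add: image_image)
  then show "path_image (\<lambda>t. \<gamma> (dist x y * t)) = \<gamma> ` {0..dist x y}"
    by (simp only: im)
qed

lemma geodesic_endpoints:
  assumes "geodesic_between x y \<gamma>"
  shows "x \<in> \<gamma> ` {0..dist x y}" "y \<in> \<gamma> ` {0..dist x y}"
  using path_geodesic[OF assms] pathstart_in_path_image pathfinish_in_path_image by metis+

lemma geodesic_between_dist:
  assumes "geodesic_between x y \<gamma>" "z \<in> \<gamma> ` {0..dist x y}"
  shows "dist x z + dist z y = dist x y"
proof -
  obtain t where t: "0 \<le> t" "t \<le> dist x y" "z = \<gamma> t" using assms(2) by auto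
  have iso: "dist (\<gamma> s) (\<gamma> r) = \<bar>s - r\<bar>" if "s \<in> {0..dist x y}" "r \<in> {0..dist x y}" for s r
    using assms(1) that by (simp add: geodesic_between_def geodesic_path_def)
  have "dist (\<gamma> 0) (\<gamma> t) = t" "dist (\<gamma> t) (\<gamma> (dist x y)) = dist x y - t"
    using iso[of 0 t] iso[of t "dist x y"] t by simp_all
  moreover have "\<gamma> 0 = x" "\<gamma> (dist x y) = y" using assms(1) by (simp_all add: geodesic_between_def)
  ultimately show ?thesis using t by simp
qed

lemma compact_infdist_attained:
  assumes "compact A" "A \<noteq> {}" "infdist z A \<le> r"
  obtains p where "p \<in> A" "dist z p \<le> r"
proof -
  obtain p where p: "p \<in> A" "\<And>y. y \<in> A \<Longrightarrow> dist z p \<le> dist z y"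
    using continuous_attains_inf[OF assms(1,2) continuous_on_dist[OF continuous_on_const continuous_on_id]]
    by blast
  have "dist z p \<le> infdist z A"
    unfolding infdist_notempty[OF assms(2)] using p assms(2) by (intro cINF_greatest) auto
  then show ?thesis using that p assms(3) by auto
qed

locale quasi_tree_space =
  fixes T :: "'a::metric_space itself" and \<Delta> :: real
  assumes qt: "quasi_tree T \<Delta>"
begin

lemma Delta_nonneg: "0 \<le> \<Delta>"
  using qt by (simp add: quasi_tree_def)

lemma geodesic_exists: obtains \<gamma> where "geodesic_between (x::'a) y \<gamma>"
  using qt by (metis quasi_tree_def geodesic_space_def)

lemma bottleneck:
  assumes "geodesic_between (x::'a) y \<gamma>" "z \<in> \<gamma> ` {0..dist x y}"
    and "path p" "pathstart p = x" "pathfinish p = y"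
  obtains q where "q \<in> path_image p" "dist z q \<le> \<Delta>"
  using qt assms unfolding quasi_tree_def by fastforce

lemma geodesic_point:
  assumes "0 \<le> t" "t \<le> dist (x::'a) y"
  shows "\<exists>z. dist x z = t \<and> dist z y = dist x y - t"
proof -
  obtain \<gamma> where g: "geodesic_between x y \<gamma>" by (rule geodesic_exists)
  have "dist (\<gamma> 0) (\<gamma> t) = \<bar>0 - t\<bar>"
    using g assms unfolding geodesic_between_def geodesic_path_def by (metis atLeastAtMost_iff order_refl order_trans)
  moreover have "dist x (\<gamma> t) + dist (\<gamma> t) y = dist x y"
    using geodesic_between_dist[OF g, of "\<gamma> t"] assms by simp
  ultimately show ?thesis using g assms by (intro exI[of _ "\<gamma> t"]) (simp add: geodesic_between_def)
qed

text \<open>The other two sides, joined at \<open>w\<close>, form a path from \<open>x\<close> to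
  \<open>y\<close> to which the bottleneck property applies; so triangles are slim with the constant
  \<Delta> itself.\<close>

lemma slim_triangle:
  assumes xy: "geodesic_between (x::'a) y \<gamma>" "z \<in> \<gamma> ` {0..dist x y}"
    and xw: "geodesic_between x w \<alpha>" and wy: "geodesic_between w y \<beta>"
  obtains q where "q \<in> \<alpha> ` {0..dist x w} \<union> \<beta> ` {0..dist w y}" "dist z q \<le> \<Delta>"
proof -
  note a = path_geodesic[OF xw] and b = path_geodesic[OF wy]
  let ?p = "(\<lambda>t. \<alpha> (dist x w * t)) +++ (\<lambda>t. \<beta> (dist w y * t))"
  have "path ?p" "pathstart ?p = x" "pathfinish ?p = y" using a b by (auto simp: path_join)
  then obtain q where "q \<in> path_image ?p" "dist z q \<le> \<Delta>" by (rule bottleneck[OF xy])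
  moreover have "path_image ?p = \<alpha> ` {0..dist x w} \<union> \<beta> ` {0..dist w y}"
    using a b by (simp add: path_image_join)
  ultimately show ?thesis using that by auto
qed

text \<open>The geodesic is covered by the closed set of points near one side of the triangle and the
  closed set of points near the other; by connectedness some point is near both.\<close>
lemma tripod_point:
  assumes xy: "geodesic_between (x::'a) y \<gamma>"
  shows "\<exists>z\<in>\<gamma> ` {0..dist x y}. dist w z \<le> gp x y w + 2 * \<Delta>"
proof -
  obtain \<alpha> where xw: "geodesic_between x w \<alpha>" by (rule geodesic_exists)
  obtain \<beta> where wy: "geodesic_between w y \<beta>" by (rule geodesic_exists)
  let ?A = "\<alpha> ` {0..dist x w}" and ?B = "\<beta> ` {0..dist w y}" and ?I = "\<gamma> ` {0..dist x y}"
  have comp: "compact ?A" "compact ?B" "connected ?I"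
    using path_geodesic[OF xw] path_geodesic[OF wy] path_geodesic[OF xy]
      compact_path_image connected_path_image by metis+
  have ne: "?A \<noteq> {}" "?B \<noteq> {}" by auto
  let ?S = "{z. infdist z ?A \<le> \<Delta>}" and ?R = "{z. infdist z ?B \<le> \<Delta>}"
  have cl: "closed ?S" "closed ?R" by (intro closed_Collect_le continuous_intros)+
  have sub: "?I \<subseteq> ?S \<union> ?R"
  proof
    fix z assume "z \<in> ?I"
    then obtain q where "q \<in> ?A \<union> ?B" "dist z q \<le> \<Delta>" by (rule slim_triangle[OF xy _ xw wy])
    then show "z \<in> ?S \<union> ?R"
      using infdist_le[of q ?A z] infdist_le[of q ?B z] by (metis (mono_tags) Un_iff mem_Collect_eq order_trans)
  qed
  have "x \<in> ?I" "y \<in> ?I" "x \<in> ?A" "y \<in> ?B"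
    using geodesic_endpoints[OF xy] geodesic_endpoints[OF xw] geodesic_endpoints[OF wy] by blast+
  moreover have "x \<in> ?S" "y \<in> ?R"
    using infdist_zero[OF \<open>x \<in> ?A\<close>] infdist_zero[OF \<open>y \<in> ?B\<close>] Delta_nonneg by (simp_all del: image_iff)
  ultimately have "?S \<inter> ?I \<noteq> {}" "?R \<inter> ?I \<noteq> {}" by blast+
  then have "?S \<inter> ?R \<inter> ?I \<noteq> {}"
    using connected_closedD[OF comp(3) _ sub cl] by blast
  then obtain z where z: "z \<in> ?I" "infdist z ?A \<le> \<Delta>" "infdist z ?B \<le> \<Delta>" by auto
  obtain p where p: "p \<in> ?A" "dist z p \<le> \<Delta>"
    using compact_infdist_attained[OF comp(1) ne(1) z(2)] .
  obtain q where q: "q \<in> ?B" "dist z q \<le> \<Delta>"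
    using compact_infdist_attained[OF comp(2) ne(2) z(3)] .
  have "dist x p + dist p w = dist x w" "dist w q + dist q y = dist w y" "dist x z + dist z y = dist x y"
    using geodesic_between_dist[OF xw p(1)] geodesic_between_dist[OF wy q(1)]
      geodesic_between_dist[OF xy z(1)] by auto
  moreover have "dist x z \<le> dist x p + dist z p" "dist w z \<le> dist p w + dist z p"
    "dist y z \<le> dist q y + dist z q" "dist w z \<le> dist w q + dist z q"
    by (metis dist_commute dist_triangle)+
  \<comment> \<open>Going through \<open>p\<close> gives dist w z <= dist x w - dist x z + 2
    \<Delta>; going through \<open>q\<close> gives the same with \<open>y\<close> for
    \<open>x\<close>. Half the sum is the claim.\<close>
  ultimately have "dist w z \<le> gp x y w + 2 * \<Delta>"
    using p(2) q(2) dist_commute[of z y] dist_commute[of w y] two_gp[of x y w] by linarith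
  then show ?thesis using z by auto
qed

lemma gp_le_dist_geodesic:
  assumes "geodesic_between (x::'a) y \<gamma>" "z \<in> \<gamma> ` {0..dist x y}"
  shows "gp x y w \<le> dist w z"
  using geodesic_between_dist[OF assms] dist_triangle[of x w z] dist_triangle[of y w z]
  by (simp add: gp_def dist_commute)

text \<open>Some point of [x, y] is within \<open>gp x y w + 2 * \<Delta>\<close> of
  \<open>w\<close>, and slimness leads from it in a further \<Delta> to [x, z] or [z, y]; a product
  never exceeds the distance to a geodesic. The disjunction replaces the usual minimum.\<close>

lemma gromov_hyperbolic:
  "gp x z w \<le> gp x y (w::'a) + 3 * \<Delta> \<or> gp z y w \<le> gp x y w + 3 * \<Delta>"
proof -
  obtain \<gamma> where xy: "geodesic_between x y \<gamma>" by (rule geodesic_exists)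
  obtain \<alpha> where xz: "geodesic_between x z \<alpha>" by (rule geodesic_exists)
  obtain \<beta> where zy: "geodesic_between z y \<beta>" by (rule geodesic_exists)
  obtain t where t: "t \<in> \<gamma> ` {0..dist x y}" "dist w t \<le> gp x y w + 2 * \<Delta>"
    using tripod_point[OF xy, of w] by auto
  obtain q where q: "q \<in> \<alpha> ` {0..dist x z} \<union> \<beta> ` {0..dist z y}" "dist t q \<le> \<Delta>"
    by (rule slim_triangle[OF xy t(1) xz zy])
  have "dist w q \<le> gp x y w + 3 * \<Delta>" using t q dist_triangle[of w q t] by simp
  then show ?thesis
    using q(1) gp_le_dist_geodesic[OF xz, of q w] gp_le_dist_geodesic[OF zy, of q w] by auto
qed

text \<open>The path comes within \<Delta> of the point of [x, y] that \<open>tripod_point\<close>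
  finds close to \<open>w\<close>, so that point cannot be much closer than \<open>R\<close>.
  Together with the next lemma: components outside a ball partition the directions at
  \<open>w\<close> exactly, whereas a lower bound on products is not a transitive relation.\<close>

lemma gp_same_component:
  assumes "path_component (- cball w R) x (y::'a)"
  shows "R - 3 * \<Delta> \<le> gp x y w"
proof -
  obtain p where p: "path p" "path_image p \<subseteq> - cball w R" "pathstart p = x" "pathfinish p = y"
    using assms by (auto simp: path_component_def)
  obtain \<gamma> where xy: "geodesic_between x y \<gamma>" by (rule geodesic_exists)
  obtain t where t: "t \<in> \<gamma> ` {0..dist x y}" "dist w t \<le> gp x y w + 2 * \<Delta>"
    using tripod_point[OF xy, of w] by auto
  obtain q where "q \<in> path_image p" "dist t q \<le> \<Delta>"
    using bottleneck[OF xy t(1) p(1,3,4)] .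
  then show ?thesis using t p(2) dist_triangle[of w q t] by (force simp: subset_iff)
qed

text \<open>A geodesic is itself a path, so it has to enter the ball.\<close>

lemma gp_different_component:
  assumes "\<not> path_component (- cball w R) x (y::'a)"
  shows "gp x y w \<le> R"
proof -
  obtain \<gamma> where xy: "geodesic_between x y \<gamma>" by (rule geodesic_exists)
  have "\<not> \<gamma> ` {0..dist x y} \<subseteq> - cball w R"
    using assms path_geodesic[OF xy] unfolding path_component_def by metis
  then obtain t where "t \<in> \<gamma> ` {0..dist x y}" "dist w t \<le> R"
    by (metis ComplI mem_cball subsetI)
  then show ?thesis using gp_le_dist_geodesic[OF xy, of t w] by linarith
qed

end

section \<open>Acylindrical isometric actions on hyperbolic spaces\<close>

locale hyp_action = group G for G (structure) +
  fixes \<phi> :: "'a \<Rightarrow> 'x::metric_space \<Rightarrow> 'x" and \<Delta> \<kappa> :: real and N :: nat and x0 :: 'x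
  assumes act_mult: "g \<in> carrier G \<Longrightarrow> h \<in> carrier G \<Longrightarrow> \<phi> (g \<otimes> h) x = \<phi> g (\<phi> h x)"
    and act_one [simp]: "\<phi> \<one> x = x"
    and act_dist [simp]: "g \<in> carrier G \<Longrightarrow> dist (\<phi> g x) (\<phi> g y) = dist x y"
    and hyp: "gp x z w \<le> gp x y w + 3 * \<Delta> \<or> gp z y w \<le> gp x y w + 3 * \<Delta>"
    and geod: "0 \<le> t \<Longrightarrow> t \<le> dist x y \<Longrightarrow> \<exists>z. dist x z = t \<and> dist z y = dist x y - t"
    and Delta_pos: "\<Delta> > 0" and kappa: "\<kappa> \<ge> \<Delta>" and N1: "N \<ge> 1"
    and acyl: "dist x y \<ge> \<kappa> \<Longrightarrow>
      finite {g \<in> carrier G. dist x (\<phi> g x) \<le> 100 * \<Delta> \<and> dist y (\<phi> g y) \<le> 100 * \<Delta>} \<and>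
      card {g \<in> carrier G. dist x (\<phi> g x) \<le> 100 * \<Delta> \<and> dist y (\<phi> g y) \<le> 100 * \<Delta>} \<le> N"
begin

abbreviation pt :: "'a \<Rightarrow> 'x" where "pt g \<equiv> \<phi> g x0"

abbreviation ell :: "'a \<Rightarrow> real" where "ell g \<equiv> dist x0 (pt g)"

lemma act_inv [simp]:
  "g \<in> carrier G \<Longrightarrow> \<phi> (inv g) (\<phi> g x) = (x::'x)" "g \<in> carrier G \<Longrightarrow> \<phi> g (\<phi> (inv g) x) = (x::'x)"
  using act_mult[of "inv g" g x] act_mult[of g "inv g" x] by simp_all

lemma act_gp [simp]: "g \<in> carrier G \<Longrightarrow> gp (\<phi> g x) (\<phi> g y) (\<phi> g z) = gp (x::'x) y z"
  by (simp add: gp_def)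

lemma act_gp_base: "g \<in> carrier G \<Longrightarrow> gp (x::'x) y (\<phi> g z) = gp (\<phi> (inv g) x) (\<phi> (inv g) y) z"
  using act_gp[of "inv g" x y "\<phi> g z"] by simp

lemma act_dist_move: "g \<in> carrier G \<Longrightarrow> dist (x::'x) (\<phi> g y) = dist (\<phi> (inv g) x) y"
  using act_dist[of "inv g" x "\<phi> g y"] by simp

lemma ell_inv: "g \<in> carrier G \<Longrightarrow> ell (inv g) = ell g"
  using act_dist_move[of "inv g" x0 x0] by (simp add: dist_commute)

lemma pt_mult: "g \<in> carrier G \<Longrightarrow> h \<in> carrier G \<Longrightarrow> pt (g \<otimes> h) = \<phi> g (pt h)"
  by (rule act_mult)

lemma dist_pt: "g \<in> carrier G \<Longrightarrow> h \<in> carrier G \<Longrightarrow> dist (pt g) (pt h) = ell (inv g \<otimes> h)"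
  using act_dist[of "inv g" "pt g" "pt h"] by (simp add: act_mult)

text \<open>The working form of hyperbolicity: if \<open>z\<close> follows \<open>x\<close> beyond
  the place where \<open>x\<close> leaves \<open>y\<close>, then \<open>z\<close> leaves
  \<open>y\<close> there as well. The strict gap of 3 \<Delta> excludes the other alternative of
  \<open>hyp\<close>.\<close>

lemma hyp_cut:
  assumes "gp (x::'x) y w \<le> c" "c + 3 * \<Delta> < gp x z w"
  shows "gp z y w \<le> c + 3 * \<Delta>"
  using hyp[of x z w y] assms by linarith

lemma hyp_ge:
  assumes "r \<le> gp (x::'x) z w" "r \<le> gp z y w"
  shows "r - 3 * \<Delta> \<le> gp x y w"
  using hyp[of x z w y] assms by linarith

text \<open>Seen from \<open>P\<close>, both points follow [P, Q] for almost their whole length,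
  hence follow each other for almost the shorter of the two lengths.\<close>

lemma near_dist:
  assumes "gp P Q (x::'x) \<le> c" "gp P Q y \<le> c"
  shows "dist x y \<le> \<bar>dist P x - dist P y\<bar> + 2 * c + 6 * \<Delta>"
proof -
  have "gp x Q P = dist P x - gp P Q x" "gp Q y P = dist P y - gp P Q y"
    using gp_add[of x Q P] gp_add[of y Q P] by (simp_all add: gp_commute dist_commute)
  then show ?thesis
    using hyp[of x Q P y] assms two_gp[of x y P] dist_commute[of x P] dist_commute[of y P]
    by linarith
qed

text \<open>Points near a line are pinned down by their distance to its origin, so elements moving a long
  segment along the line by nearly the same amount differ by an element almost fixing that segment.\<close>
lemma shift_count:
  assumes S: "S \<subseteq> carrier G" and xy: "\<kappa> \<le> dist x1 y1" and H: "0 \<le> H"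
    and near: "\<And>g. g \<in> S \<Longrightarrow> gp P Q (\<phi> g x1) \<le> 12 * \<Delta>" "\<And>g. g \<in> S \<Longrightarrow> gp P Q (\<phi> g y1) \<le> 12 * \<Delta>"
    and ord: "\<And>g. g \<in> S \<Longrightarrow> dist P (\<phi> g x1) \<le> dist P (\<phi> g y1)"
    and pos: "\<And>g. g \<in> S \<Longrightarrow> a \<le> dist P (\<phi> g x1) \<and> dist P (\<phi> g x1) \<le> a + H"
  shows "finite S \<and> real (card S) \<le> real N * (H / (40 * \<Delta>) + 1)"
proof -
  \<comment> \<open>Windows of width 40 \<Delta>: within one window the images of \<open>x1\<close>
    are at most 70 \<Delta> apart and those of \<open>y1\<close> at most 100 \<Delta>, which is
    exactly the allowance in acylindricity.\<close>
  define f where "f g = nat \<lfloor>(dist P (\<phi> g x1) - a) / (40 * \<Delta>)\<rfloor>" for g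
  define M where "M = nat \<lfloor>H / (40 * \<Delta>)\<rfloor>"
  let ?F = "{g \<in> carrier G. dist x1 (\<phi> g x1) \<le> 100 * \<Delta> \<and> dist y1 (\<phi> g y1) \<le> 100 * \<Delta>}"
  have F: "finite ?F" "card ?F \<le> N" using acyl[OF xy] by auto
  have fM: "f ` S \<subseteq> {..M}"
  proof
    fix i assume "i \<in> f ` S"
    then obtain g where g: "g \<in> S" "i = f g" by auto
    have "(dist P (\<phi> g x1) - a) / (40 * \<Delta>) \<le> H / (40 * \<Delta>)"
      using pos[OF g(1)] Delta_pos by (intro divide_right_mono) auto
    then show "i \<in> {..M}" unfolding g(2) f_def M_def by (auto intro!: nat_mono floor_mono)
  qed
  have fib: "finite {g \<in> S. f g = i} \<and> card {g \<in> S. f g = i} \<le> N" for i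
  proof (cases "{g \<in> S. f g = i} = {}")
    case True
    show ?thesis unfolding True by simp
  next
    case False
    then obtain g where g: "g \<in> S" "f g = i" by auto
    have gc: "g \<in> carrier G" using g S by auto
    have "(\<lambda>h. inv g \<otimes> h) ` {h \<in> S. f h = i} \<subseteq> ?F"
    proof
      fix k assume "k \<in> (\<lambda>h. inv g \<otimes> h) ` {h \<in> S. f h = i}"
      then obtain h where h: "h \<in> S" "f h = i" "k = inv g \<otimes> h" by auto
      have hc: "h \<in> carrier G" using h S by auto
      have nn: "0 \<le> (dist P (\<phi> l x1) - a) / (40 * \<Delta>)" if "l \<in> S" for l
        using pos[OF that] Delta_pos by simp
      have "\<lfloor>(dist P (\<phi> g x1) - a) / (40 * \<Delta>)\<rfloor> = \<lfloor>(dist P (\<phi> h x1) - a) / (40 * \<Delta>)\<rfloor>"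
        using g(2) h(2) nn[OF g(1)] nn[OF h(1)] unfolding f_def by (metis int_nat_eq zero_le_floor)
      then have "\<bar>(dist P (\<phi> g x1) - a) / (40 * \<Delta>) - (dist P (\<phi> h x1) - a) / (40 * \<Delta>)\<bar> < 1"
        by linarith
      then have "\<bar>(dist P (\<phi> g x1) - dist P (\<phi> h x1)) / (40 * \<Delta>)\<bar> < 1"
        by (simp add: diff_divide_distrib)
      then have e: "\<bar>dist P (\<phi> g x1) - dist P (\<phi> h x1)\<bar> < 40 * \<Delta>"
        using Delta_pos by (simp add: abs_divide)
      have d1: "dist (\<phi> g x1) (\<phi> h x1) \<le> 70 * \<Delta>"
        using near_dist[OF near(1)[OF g(1)] near(1)[OF h(1)]] e by simp
      have yy: "dist P (\<phi> l y1) - dist P (\<phi> l x1) \<le> dist x1 y1 \<and>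
          dist x1 y1 - 30 * \<Delta> \<le> dist P (\<phi> l y1) - dist P (\<phi> l x1)" if l: "l \<in> S" for l
        using near_dist[OF near(1)[OF l] near(2)[OF l]] ord[OF l] S l
          dist_triangle[of P "\<phi> l y1" "\<phi> l x1"] act_dist[of l x1 y1] by force
      have d2: "dist (\<phi> g y1) (\<phi> h y1) \<le> 100 * \<Delta>"
        using near_dist[OF near(2)[OF g(1)] near(2)[OF h(1)]] e yy[OF g(1)] yy[OF h(1)] by linarith
      show "k \<in> ?F"
        using d1 d2 h(3) gc hc Delta_pos by (simp add: act_mult act_dist_move[of "inv g"])
    qed
    moreover have "inj_on (\<lambda>h. inv g \<otimes> h) {h \<in> S. f h = i}"
      using S gc by (intro inj_onI) (metis (no_types, lifting) inv_closed Units_eq Units_l_cancel mem_Collect_eq subsetD)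
    ultimately show ?thesis using F by (meson card_inj_on_le finite_imageD finite_subset order_trans)
  qed
  have U: "S = (\<Union>i\<in>{..M}. {g \<in> S. f g = i})" using fM by auto
  have fin: "finite S" by (subst U) (use fib in auto)
  have "card S \<le> (\<Sum>i\<in>{..M}. card {g \<in> S. f g = i})"
    by (subst U) (intro card_UN_le, simp)
  also have "\<dots> \<le> (\<Sum>i\<in>{..M}. N)" using fib by (intro sum_mono) auto
  also have "\<dots> = (M + 1) * N" by simp
  finally have "real (card S) \<le> real ((M + 1) * N)" by (simp only: of_nat_le_iff)
  also have "\<dots> = real N * (real M + 1)" by (simp add: algebra_simps)
  also have "\<dots> \<le> real N * (H / (40 * \<Delta>) + 1)"
    using H Delta_pos unfolding M_def by (intro mult_left_mono add_right_mono) auto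
  finally show ?thesis using fin by simp
qed

subsection \<open>Broken geodesics\<close>

text \<open>Induction into the past: the past of \<open>p j\<close> goes out through
  \<open>p (j - 1)\<close> and follows that edge for most of its length, so by
  \<open>hyp_cut\<close> it inherits the turn at \<open>j\<close>. Each induction step restarts from
  the local bound \<open>c\<close>, so the loss stays at 3 \<Delta>. Integer indices avoid end cases
  and allow reversal.\<close>

lemma broken_aux:
  fixes p :: "int \<Rightarrow> 'x"
  assumes turn: "\<And>i. gp (p (i - 1)) (p (i + 1)) (p i) \<le> c"
    and len: "\<And>i. 2 * c + 20 * \<Delta> \<le> dist (p i) (p (i + 1))"
  shows "gp (p (j - int n - 1)) (p (j + 1)) (p j) \<le> c + 3 * \<Delta>"
proof (induction n arbitrary: j)
  case 0
  then show ?case using turn[of j] Delta_pos by simp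
next
  case (Suc n)
  have c0: "0 \<le> c" using turn[of 0] gp_nonneg[of "p (0 - 1)" "p (0 + 1)" "p 0"] by linarith
  have "gp (p (j - int (Suc n) - 1)) (p j) (p (j - 1)) \<le> c + 3 * \<Delta>"
    using Suc[of "j - 1"] by (simp add: algebra_simps)
  then have "c + 3 * \<Delta> < gp (p (j - 1)) (p (j - int (Suc n) - 1)) (p j)"
    using gp_add[of "p (j - 1)" "p (j - int (Suc n) - 1)" "p j"] len[of "j - 1"] c0 Delta_pos
      gp_commute[of "p j" "p (j - int (Suc n) - 1)"] by simp
  from hyp_cut[OF turn[of j] this] show ?case .
qed

text \<open>\<open>broken_aux\<close> treats a whole past against one future vertex, and by symmetry
  the reverse; one more cut through the neighbour \<open>p (j + 1)\<close> combines them, at a cost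
  of another 3 \<Delta>.\<close>

lemma broken_geodesic:
  fixes p :: "int \<Rightarrow> 'x"
  assumes turn: "\<And>i. gp (p (i - 1)) (p (i + 1)) (p i) \<le> c"
    and len: "\<And>i. 2 * c + 20 * \<Delta> \<le> dist (p i) (p (i + 1))"
  shows "i \<le> j \<Longrightarrow> j \<le> k \<Longrightarrow> gp (p i) (p k) (p j) \<le> c + 6 * \<Delta>"
    and "i \<le> k \<Longrightarrow> 14 * \<Delta> * real_of_int (k - i) \<le> dist (p i) (p k)"
proof -
  have c0: "0 \<le> c" using turn[of 0] gp_nonneg[of "p (0 - 1)" "p (0 + 1)" "p 0"] by linarith
  have fw: "gp (p i) (p (j + 1)) (p j) \<le> c + 3 * \<Delta>" if "i < j" for i j
    using broken_aux[of p c j "nat (j - i - 1)"] turn len that by simp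
  have bw: "gp (p (j - 1)) (p k) (p j) \<le> c + 3 * \<Delta>" if "j < k" for j k
  proof -
    \<comment> \<open>Reversing the sequence turns the statement about the past into one about the
      future.\<close>
    have "gp (p (- (- j - int (nat (k - j - 1)) - 1))) (p (- (- j + 1))) (p (- (- j))) \<le> c + 3 * \<Delta>"
    proof (rule broken_aux[of "\<lambda>i. p (- i)"])
      show "gp (p (- (i - 1))) (p (- (i + 1))) (p (- i)) \<le> c" for i
        using turn[of "- i"] by (simp add: gp_commute)
      show "2 * c + 20 * \<Delta> \<le> dist (p (- i)) (p (- (i + 1)))" for i
        using len[of "- i - 1"] by (simp add: dist_commute)
    qed
    then show ?thesis using that by (simp add: gp_commute)
  qed
  show "gp (p i) (p k) (p j) \<le> c + 6 * \<Delta>" if le: "i \<le> j" "j \<le> k" for i j k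
  proof -
    consider "i = j" | "j = k" | "i < j" "j < k"
      using le by linarith
    then show ?thesis
    proof cases
      case 3
      have "gp (p j) (p k) (p (j + 1)) \<le> c + 3 * \<Delta>"
        using bw[of "j + 1" k] 3 c0 Delta_pos by (cases "j + 1 = k") auto
      then have "c + 3 * \<Delta> + 3 * \<Delta> < gp (p (j + 1)) (p k) (p j)"
        using gp_add[of "p (j + 1)" "p k" "p j"] len[of j] c0 Delta_pos
        by (simp add: dist_commute gp_commute)
      then show ?thesis
        using hyp_cut[of "p (j + 1)" "p i" "p j" "c + 3 * \<Delta>" "p k"] fw[OF 3(1)]
        by (simp add: gp_commute)
    qed (use c0 Delta_pos in auto)
  qed
  \<comment> \<open>One more edge adds its length minus twice the product at the joint, at least 2c
    + 20 \<Delta> - 2 (c + 3 \<Delta>) = 14 \<Delta>.\<close>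
  have len': "14 * \<Delta> * real n \<le> dist (p i) (p (i + int n))" for i n
  proof (induction n)
    case (Suc n)
    have "gp (p i) (p (i + int n + 1)) (p (i + int n)) \<le> c + 3 * \<Delta>"
      using fw[of i "i + int n"] c0 Delta_pos by (cases "n = 0") auto
    then have "dist (p i) (p (i + int n)) + 14 * \<Delta> \<le> dist (p i) (p (i + int n + 1))"
      using len[of "i + int n"] two_gp[of "p i" "p (i + int n + 1)" "p (i + int n)"] c0 Delta_pos
      by (simp add: dist_commute)
    then show ?case using Suc by (simp add: algebra_simps)
  qed simp
  show "14 * \<Delta> * real_of_int (k - i) \<le> dist (p i) (p k)" if "i \<le> k" for i k
    using len'[where i = i and n = "nat (k - i)"] that by simp
qed

subsection \<open>Loxodromic elements and their ends\<close>

text \<open>A condition on one step of the orbit of the base point, which can be checked directly;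
  by local-to-global it makes the orbit under powers of \<open>h\<close> a quasi-geodesic. The
  number \<open>c\<close> also controls how far the base point is from the axis.\<close>

definition lox :: "real \<Rightarrow> 'a \<Rightarrow> bool" where
  "lox c h \<longleftrightarrow> h \<in> carrier G \<and> gp (pt (inv h)) (pt h) x0 \<le> c \<and> 2 * c + 20 * \<Delta> \<le> ell h"

text \<open>Stands for the attracting (\<open>True\<close>) or repelling (\<open>False\<close>) end
  of \<open>h\<close>: no boundary is constructed, an end is a sequence of orbit points. The Boolean
  allows both ends to be treated, or exchanged, by one statement.\<close>

definition en :: "'a \<Rightarrow> bool \<Rightarrow> nat \<Rightarrow> 'x" where
  "en h \<sigma> k = pt (h [^] (if \<sigma> then int k else - int k))"

text \<open>Convergence to the same boundary point, tested for equal indices only, which suffices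
  for orbits of powers and their images. It is not reflexive: \<open>asy a a\<close> says that
  \<open>a\<close> leaves every ball.\<close>

definition asy :: "(nat \<Rightarrow> 'x) \<Rightarrow> (nat \<Rightarrow> 'x) \<Rightarrow> bool" where
  "asy a b \<longleftrightarrow> (\<forall>r. \<forall>\<^sub>F k in sequentially. r \<le> gp (a k) (b k) x0)"

text \<open>The elements fixing (for \<open>True\<close>) or exchanging (for \<open>False\<close>) the two ends of the axis of \<open>h\<close>.\<close>
definition stab :: "'a \<Rightarrow> bool \<Rightarrow> 'a set" where
  "stab h \<tau> = {g \<in> carrier G. \<forall>\<sigma>. asy (\<lambda>k. \<phi> g (en h \<sigma> k)) (en h (\<sigma> = \<tau>))}"

lemma lox_carrier: "lox c h \<Longrightarrow> h \<in> carrier G"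
  by (simp add: lox_def)

lemma lox_nonneg: "lox c h \<Longrightarrow> 0 \<le> c"
  using gp_nonneg[of "pt (inv h)" "pt h" x0] by (simp add: lox_def)

lemma lox_axis:
  assumes "lox c h"
  shows "i \<le> j \<Longrightarrow> j \<le> k \<Longrightarrow> gp (pt (h [^] i)) (pt (h [^] k)) (pt (h [^] j)) \<le> c + 6 * \<Delta>"
    and "i \<le> k \<Longrightarrow> 14 * \<Delta> * real_of_int (k - i) \<le> dist (pt (h [^] i)) (pt (h [^] k))"
    and "dist (pt (h [^] i)) (pt (h [^] (i + 1))) = ell h"
proof -
  have h: "h \<in> carrier G" using assms by (simp add: lox_def)
  have m: "h [^] (i - 1) = h [^] i \<otimes> inv h" "h [^] (i + 1) = h [^] i \<otimes> h" for i :: int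
    using h int_pow_mult[of h i "-1"] int_pow_mult[of h i 1] by (simp_all add: int_pow_neg)
  have t: "gp (pt (h [^] (i - 1))) (pt (h [^] (i + 1))) (pt (h [^] i)) \<le> c" for i :: int
    using assms h by (simp add: m pt_mult lox_def)
  have l: "dist (pt (h [^] i)) (pt (h [^] (i + 1))) = ell h" for i :: int
    using h by (simp add: m pt_mult)
  then have l': "2 * c + 20 * \<Delta> \<le> dist (pt (h [^] i)) (pt (h [^] (i + 1)))" for i :: int
    using assms by (simp add: lox_def)
  show "i \<le> j \<Longrightarrow> j \<le> k \<Longrightarrow> gp (pt (h [^] i)) (pt (h [^] k)) (pt (h [^] j)) \<le> c + 6 * \<Delta>"
    using broken_geodesic(1)[of "\<lambda>i. pt (h [^] i)", OF t l'] .
  show "i \<le> k \<Longrightarrow> 14 * \<Delta> * real_of_int (k - i) \<le> dist (pt (h [^] i)) (pt (h [^] k))"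
    using broken_geodesic(2)[of "\<lambda>i. pt (h [^] i)", OF t l'] .
  show "dist (pt (h [^] i)) (pt (h [^] (i + 1))) = ell h" by (rule l)
qed

lemma ell_pow_ge: "lox c h \<Longrightarrow> 14 * \<Delta> * real k \<le> ell (h [^] (int k))"
  using lox_axis(2)[of c h 0 "int k"] by simp

lemma dist_en:
  assumes "lox c h" shows "14 * \<Delta> * real k \<le> dist x0 (en h \<sigma> k)"
  using lox_axis(2)[OF assms, of 0 "int k"] lox_axis(2)[OF assms, of "- int k" 0]
  by (auto simp: en_def dist_commute)

lemma en_opposite:
  assumes "lox c h" shows "gp (en h (\<not> \<sigma>) j) (en h \<sigma> k) x0 \<le> c + 6 * \<Delta>"
  using lox_axis(1)[OF assms, of "- int j" 0 "int k"] lox_axis(1)[OF assms, of "- int k" 0 "int j"]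
  by (auto simp: en_def gp_commute)

lemma en_same_aux:
  assumes "lox c h" "j \<le> k"
  shows "dist x0 (en h \<sigma> j) - (c + 6 * \<Delta>) \<le> gp (en h \<sigma> j) (en h \<sigma> k) x0"
proof -
  have "gp x0 (en h \<sigma> k) (en h \<sigma> j) \<le> c + 6 * \<Delta>"
    using lox_axis(1)[OF assms(1), of "- int k" "- int j" 0] lox_axis(1)[OF assms(1), of 0 "int j" "int k"] assms
    by (auto simp: en_def gp_commute)
  then show ?thesis using gp_add[of "en h \<sigma> j" "en h \<sigma> k" x0] by (simp add: dist_commute)
qed

lemma en_same:
  assumes "lox c h"
  shows "14 * \<Delta> * real (min j k) - (c + 6 * \<Delta>) \<le> gp (en h \<sigma> j) (en h \<sigma> k) x0"
  using en_same_aux[OF assms, of j k \<sigma>] en_same_aux[OF assms, of k j \<sigma>]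
    dist_en[OF assms, of j \<sigma>] dist_en[OF assms, of k \<sigma>]
  by (cases "j \<le> k") (auto simp: gp_commute min_def)

lemma asyI:
  assumes "\<And>k. f k - C \<le> gp (a k) (b k) x0" "filterlim f at_top sequentially"
  shows "asy a b"
  unfolding asy_def
proof
  fix r
  have "\<forall>\<^sub>F k in sequentially. r + C \<le> f k" using assms(2) by (simp add: filterlim_at_top)
  then show "\<forall>\<^sub>F k in sequentially. r \<le> gp (a k) (b k) x0"
    by eventually_elim (use assms(1) in \<open>smt (verit)\<close>)
qed

lemma asy_sym: "asy a b \<Longrightarrow> asy b a"
  by (simp add: asy_def gp_commute)

lemma asy_trans:
  assumes "asy a b" "asy b c" shows "asy a c"
  unfolding asy_def
proof
  fix r
  have "\<forall>\<^sub>F k in sequentially. r + 3 * \<Delta> \<le> gp (a k) (b k) x0" "\<forall>\<^sub>F k in sequentially. r + 3 * \<Delta> \<le> gp (b k) (c k) x0"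
    using assms by (simp_all add: asy_def)
  then show "\<forall>\<^sub>F k in sequentially. r \<le> gp (a k) (c k) x0"
  proof eventually_elim
    case (elim k)
    from hyp_ge[OF this] show ?case by simp
  qed
qed

lemma asy_base:
  assumes "asy a b" shows "\<forall>\<^sub>F k in sequentially. r \<le> gp (a k) (b k) y"
proof -
  have "\<forall>\<^sub>F k in sequentially. r + dist x0 y \<le> gp (a k) (b k) x0" using assms by (simp add: asy_def)
  then show ?thesis
  proof eventually_elim
    case (elim k)
    then show ?case using gp_base_le[of "a k" "b k" x0 y] by simp
  qed
qed

lemma asy_act:
  assumes "asy a b" "g \<in> carrier G" shows "asy (\<lambda>k. \<phi> g (a k)) (\<lambda>k. \<phi> g (b k))"
  unfolding asy_def
proof
  fix r
  have "gp (\<phi> g (a k)) (\<phi> g (b k)) x0 = gp (a k) (b k) (\<phi> (inv g) x0)" for k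
    using act_gp[OF assms(2), of "a k" "b k" "\<phi> (inv g) x0"] assms(2) by simp
  then show "\<forall>\<^sub>F k in sequentially. r \<le> gp (\<phi> g (a k)) (\<phi> g (b k)) x0"
    using asy_base[OF assms(1)] by simp
qed

lemma asy_near:
  assumes "asy a b" "\<And>k. dist (a k) (a' k) \<le> C" shows "asy a' b"
  unfolding asy_def
proof
  fix r
  have "\<forall>\<^sub>F k in sequentially. r + C \<le> gp (a k) (b k) x0" using assms by (simp add: asy_def)
  then show "\<forall>\<^sub>F k in sequentially. r \<le> gp (a' k) (b k) x0"
  proof eventually_elim
    case (elim k)
    then show ?case using gp_fst_le[of "a k" "b k" x0 "a' k"] assms(2)[of k] by simp
  qed
qed

lemma filterlim_mult_real: "0 < c \<Longrightarrow> filterlim (\<lambda>k. c * real k) at_top sequentially"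
  by (intro filterlim_tendsto_pos_mult_at_top[OF tendsto_const] filterlim_real_sequentially) auto

lemma asy_en_mult:
  assumes "lox c h" "1 \<le> n" shows "asy (\<lambda>k. en h \<sigma> (n * k)) (en h \<sigma>)"
proof (rule asyI)
  show "14 * \<Delta> * real k - (c + 6 * \<Delta>) \<le> gp (en h \<sigma> (n * k)) (en h \<sigma> k) x0" for k
    using en_same[OF assms(1), of "n * k" k \<sigma>] assms(2) by (simp add: min_absorb2)
  show "filterlim (\<lambda>k. 14 * \<Delta> * real k) at_top sequentially"
    using Delta_pos by (intro filterlim_mult_real) simp
qed

lemma asy_en_refl: "lox c h \<Longrightarrow> asy (en h \<sigma>) (en h \<sigma>)"
  using asy_en_mult[of c h 1 \<sigma>] by simp

lemma stab_carrier: "g \<in> stab h \<tau> \<Longrightarrow> g \<in> carrier G"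
  by (simp add: stab_def)

lemma stab_asy: "g \<in> stab h \<tau> \<Longrightarrow> asy (\<lambda>k. \<phi> g (en h \<sigma> k)) (en h (\<sigma> = \<tau>))"
  by (simp add: stab_def)

text \<open>Equality of Booleans is multiplication of signs, with \<open>True\<close> as +1; so the
  type of a product is the product of the types.\<close>

lemma stab_mult:
  assumes "g \<in> stab h \<tau>" "g' \<in> stab h \<tau>'" shows "g \<otimes> g' \<in> stab h (\<tau> = \<tau>')"
proof -
  note c = stab_carrier[OF assms(1)] stab_carrier[OF assms(2)]
  have "asy (\<lambda>k. \<phi> (g \<otimes> g') (en h \<sigma> k)) (en h (\<sigma> = (\<tau> = \<tau>')))" for \<sigma>
  proof -
    have 1: "asy (\<lambda>k. \<phi> (g \<otimes> g') (en h \<sigma> k)) (\<lambda>k. \<phi> g (en h (\<sigma> = \<tau>') k))"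
      using asy_act[OF stab_asy[OF assms(2)] c(1)] c by (simp add: act_mult)
    have 2: "asy (\<lambda>k. \<phi> g (en h (\<sigma> = \<tau>') k)) (en h ((\<sigma> = \<tau>') = \<tau>))" by (rule stab_asy[OF assms(1)])
    have e: "((\<sigma> = \<tau>') = \<tau>) = (\<sigma> = (\<tau> = \<tau>'))" by (cases \<sigma>; cases \<tau>; cases \<tau>') simp_all
    show ?thesis using asy_trans[OF 1 2] unfolding e .
  qed
  then show ?thesis using c by (simp add: stab_def)
qed

lemma stab_inv:
  assumes "g \<in> stab h \<tau>" shows "inv g \<in> stab h \<tau>"
proof -
  note c = stab_carrier[OF assms(1)]
  have "asy (\<lambda>k. \<phi> (inv g) (en h \<sigma> k)) (en h (\<sigma> = \<tau>))" for \<sigma>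
  proof -
    have 1: "asy (\<lambda>k. \<phi> g (en h (\<sigma> = \<tau>) k)) (en h ((\<sigma> = \<tau>) = \<tau>))" by (rule stab_asy[OF assms])
    have e: "((\<sigma> = \<tau>) = \<tau>) = \<sigma>" by (cases \<sigma>; cases \<tau>) simp_all
    have 2: "asy (\<lambda>k. \<phi> g (en h (\<sigma> = \<tau>) k)) (en h \<sigma>)"
      using 1 by (simp only: e)
    have 3: "(\<lambda>k. \<phi> (inv g) (\<phi> g (en h (\<sigma> = \<tau>) k))) = en h (\<sigma> = \<tau>)"
      by (rule ext) (rule act_inv(1)[OF c])
    show ?thesis using asy_sym[OF asy_act[OF 2 inv_closed[OF c]]] by (simp only: 3)
  qed
  then show ?thesis using c by (simp add: stab_def)
qed

text \<open>Powers of \<open>h\<close> commute, so h^i moves every orbit point h^k x0 by the same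
  distance \<open>ell (h [^] i)\<close>, and bounded moves do not change an end.\<close>

lemma stab_pow:
  assumes "lox c h" shows "h [^] (i::int) \<in> stab h True"
proof -
  have h: "h \<in> carrier G" using assms by (rule lox_carrier)
  have "asy (\<lambda>k. \<phi> (h [^] i) (en h \<sigma> k)) (en h \<sigma>)" for \<sigma>
  proof (rule asy_near[OF asy_en_refl[OF assms]])
    fix k
    let ?e = "if \<sigma> then int k else - int k"
    have "\<phi> (h [^] i) (en h \<sigma> k) = pt (h [^] (?e + i))"
      using h by (simp add: en_def act_mult[symmetric] int_pow_mult[symmetric] add.commute)
    also have "\<dots> = \<phi> (h [^] ?e) (pt (h [^] i))"
      using h by (subst int_pow_mult) (simp_all add: act_mult)
    finally show "dist (en h \<sigma> k) (\<phi> (h [^] i) (en h \<sigma> k)) \<le> ell (h [^] i)"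
      using h by (simp add: en_def)
  qed
  then show ?thesis using h by (simp add: stab_def)
qed

text \<open>Far out, a sequence may be replaced by one with the same end at a cost of 3 \<Delta>,
  here twice. The bound \<open>C\<close> is fixed first because how far out \<open>k\<close> has to
  be depends on the size of the product.\<close>

lemma end_change:
  assumes "asy a a'" "asy b b'"
  shows "\<forall>\<^sub>F k in sequentially. gp (a k) (b k) y \<le> C \<longrightarrow> gp (a' k) (b' k) y \<le> gp (a k) (b k) y + 6 * \<Delta>"
proof -
  have "\<forall>\<^sub>F k in sequentially. C + 4 * \<Delta> \<le> gp (a k) (a' k) y" "\<forall>\<^sub>F k in sequentially. C + 7 * \<Delta> \<le> gp (b k) (b' k) y"
    using assms asy_base by auto
  then show ?thesis
  proof eventually_elim
    case (elim k)
    show ?case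
    proof
      assume C: "gp (a k) (b k) y \<le> C"
      have 1: "gp (a' k) (b k) y \<le> gp (a k) (b k) y + 3 * \<Delta>"
        using hyp_cut[of "a k" "b k" y "gp (a k) (b k) y" "a' k"] C elim Delta_pos by linarith
      have "gp (b' k) (a' k) y \<le> (gp (a k) (b k) y + 3 * \<Delta>) + 3 * \<Delta>"
        using hyp_cut[of "b k" "a' k" y "gp (a k) (b k) y + 3 * \<Delta>" "b' k"] 1 C elim Delta_pos
        by (simp add: gp_commute)
      then show "gp (a' k) (b' k) y \<le> gp (a k) (b k) y + 6 * \<Delta>" by (simp add: gp_commute)
    qed
  qed
qed

lemma end_change1:
  assumes "asy a a'"
  shows "\<forall>\<^sub>F k in sequentially. gp (a k) z y \<le> C \<longrightarrow> gp (a' k) z y \<le> gp (a k) z y + 3 * \<Delta>"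
proof -
  have "\<forall>\<^sub>F k in sequentially. C + 4 * \<Delta> \<le> gp (a k) (a' k) y" using assms asy_base by auto
  then show ?thesis
  proof eventually_elim
    case (elim k)
    show ?case
      using hyp_cut[of "a k" z y "gp (a k) z y" "a' k"] elim Delta_pos by linarith
  qed
qed

lemma four_point:
  "dist x y + dist z w \<le> dist x z + dist y w + 6 * \<Delta> \<or> dist x y + dist z w \<le> dist x w + dist y (z::'x) + 6 * \<Delta>"
  using hyp[of x z w y] two_gp[of x z w] two_gp[of x y w] two_gp[of z y w] dist_commute[of z y] by linarith

text \<open>Of the three sums of opposite distances among four points, the two largest differ by at
  most 6 \<Delta>. The assumptions say that the first sum is clearly below the other two, so those
  two must agree.\<close>

lemma busemann4:
  assumes "dist A B + dist z z' + 6 * \<Delta> < dist A z + dist B (z'::'x)"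
    "dist A B + dist z z' + 6 * \<Delta> < dist A z' + dist B z"
  shows "\<bar>(dist A z - dist B z) - (dist A z' - dist B z')\<bar> \<le> 6 * \<Delta>"
  using four_point[of A z B z'] four_point[of A z' B z] assms dist_commute[of z B] dist_commute[of z' B]
    dist_commute[of z z'] by linarith

text \<open>Distances to two sequences tending to the same end differ by an almost constant function
  (a Busemann function is well defined up to a bounded error).\<close>
lemma busemann:
  assumes "asy a a'"
  shows "\<forall>\<^sub>F k in sequentially.
    \<bar>(dist (a k) z - dist (a' k) z) - (dist (a k) z' - dist (a' k) z')\<bar> \<le> 6 * \<Delta>"
proof -
  have "\<forall>\<^sub>F k in sequentially. dist z z' + 4 * \<Delta> \<le> gp (a k) (a' k) z" using assms asy_base by auto
  then show ?thesis
  proof eventually_elim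
    case (elim k)
    have "\<bar>dist (a k) z - dist (a k) z'\<bar> \<le> dist z z'" "\<bar>dist (a' k) z - dist (a' k) z'\<bar> \<le> dist z z'"
      using abs_dist_diff_le[of z "a k" z'] abs_dist_diff_le[of z "a' k" z'] by (simp_all add: dist_commute)
    then show ?case
      using two_gp[of "a k" "a' k" z] elim Delta_pos by (intro busemann4) linarith+
  qed
qed

end

context hyp_action
begin

subsection \<open>Overlapping axes\<close>

definition pw :: "'a \<Rightarrow> bool \<Rightarrow> nat \<Rightarrow> 'a" where
  "pw h \<sigma> i = h [^] (if \<sigma> then int i else - int i)"

lemma en_pw: "en h \<sigma> k = pt (pw h \<sigma> k)"
  by (simp add: en_def pw_def)

lemma pw_closed [simp]: "h \<in> carrier G \<Longrightarrow> pw h \<sigma> i \<in> carrier G"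
  by (simp add: pw_def)

lemma pw_add: "h \<in> carrier G \<Longrightarrow> pw h \<sigma> (i + j) = pw h \<sigma> i \<otimes> pw h \<sigma> j"
  by (auto simp: pw_def int_pow_mult[symmetric])

lemma pw_opposite: "h \<in> carrier G \<Longrightarrow> pw h (\<not> \<sigma>) i = inv (pw h \<sigma> i)"
  by (auto simp: pw_def int_pow_neg)

lemma pw_stab: "lox c h \<Longrightarrow> pw h \<sigma> i \<in> stab h True"
  unfolding pw_def by (rule stab_pow)

lemma ell_pw_le: "h \<in> carrier G \<Longrightarrow> ell (pw h \<sigma> i) \<le> real i * ell h"
proof (induction i)
  case 0
  then show ?case by (simp add: pw_def)
next
  case (Suc i)
  have e: "ell (pw h \<sigma> 1) = ell h" using Suc.prems by (simp add: pw_def int_pow_neg ell_inv)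
  have "ell (pw h \<sigma> (i + 1)) \<le> ell (pw h \<sigma> i) + ell (pw h \<sigma> 1)"
    using Suc.prems dist_triangle[of x0 "pt (pw h \<sigma> (i + 1))" "pt (pw h \<sigma> i)"] unfolding pw_add[OF Suc.prems]
    by (simp add: pt_mult)
  then show ?case using Suc e by (simp add: algebra_simps)
qed

text \<open>\<open>ord h \<sigma> C k p q\<close> says that \<open>p\<close>, \<open>q\<close> lie in this order, up to an error \<open>C\<close>, on a geodesic joining the
  points \<open>h\<^sup>-\<^sup>k x0\<close> and \<open>h\<^sup>k x0\<close> (run backwards if \<open>\<sigma>\<close> is false).\<close>
definition ord :: "'a \<Rightarrow> bool \<Rightarrow> real \<Rightarrow> nat \<Rightarrow> 'x \<Rightarrow> 'x \<Rightarrow> bool" where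
  "ord h \<sigma> C k p q \<longleftrightarrow> gp (en h (\<not> \<sigma>) k) q p \<le> C \<and> gp p (en h \<sigma> k) q \<le> C"

lemma ord_mono: "ord h \<sigma> C k p q \<Longrightarrow> C \<le> C' \<Longrightarrow> ord h \<sigma> C' k p q"
  by (auto simp: ord_def)

lemma ord_flip: "ord h (\<not> \<sigma>) C k p q \<longleftrightarrow> ord h \<sigma> C k q p"
  by (auto simp: ord_def gp_commute)

text \<open>\<open>P\<close> and \<open>Q\<close> play the ends of an axis. A point of [p, q] far
  from both endpoints sees \<open>P\<close> behind \<open>p\<close> and \<open>Q\<close> behind
  \<open>q\<close>, so its distance to the line from \<open>P\<close> to \<open>Q\<close> is bounded
  by a multiple of \<Delta> alone, however large \<open>C\<close> is.\<close>

lemma segment_near: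
  assumes Pqp: "gp P q p \<le> C" and pQq: "gp p Q q \<le> C" and z: "dist p z + dist z q = dist p (q::'x)"
    and pz: "C + 7 * \<Delta> < dist p z" and zq: "C + 10 * \<Delta> < dist z q"
  shows "gp P Q z \<le> 6 * \<Delta>" "gp P z p \<le> C + 3 * \<Delta>" "gp z Q q \<le> C + 3 * \<Delta>" "gp P Q p \<le> C + 3 * \<Delta>"
proof -
  have a: "gp q z p = dist p z" "gp p z q = dist z q" "gp p q z = 0"
    using z by (simp_all add: gp_def dist_commute)
  have b: "gp z P p \<le> C + 3 * \<Delta>"
    using hyp_cut[of q P p C z] Pqp a pz Delta_pos by (simp add: gp_commute)
  then show "gp P z p \<le> C + 3 * \<Delta>" by (simp add: gp_commute)
  have c: "gp z Q q \<le> C + 3 * \<Delta>"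
    using hyp_cut[of p Q q C z] pQq a zq Delta_pos by simp
  then show "gp z Q q \<le> C + 3 * \<Delta>" .
  have "3 * \<Delta> < gp p P z" using gp_add[of p P z] b pz Delta_pos by linarith
  then have d: "gp P q z \<le> 3 * \<Delta>" using hyp_cut[of p q z 0 P] a by simp
  have "6 * \<Delta> < gp q Q z" using gp_add[of q Q z] c zq Delta_pos by (simp add: gp_commute dist_commute)
  then have "gp Q P z \<le> 3 * \<Delta> + 3 * \<Delta>" using d by (intro hyp_cut[of q P z "3 * \<Delta>" Q]) (simp_all add: gp_commute)
  then show "gp P Q z \<le> 6 * \<Delta>" by (simp add: gp_commute)
  have "0 \<le> C" using Pqp gp_nonneg[of P q p] by linarith
  then have "C + 3 * \<Delta> < gp q Q p"
    using gp_add[of q Q p] pQq z pz zq Delta_pos by (simp add: gp_commute dist_commute)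
  then have "gp Q P p \<le> C + 3 * \<Delta>" using Pqp by (intro hyp_cut[of q P p C Q]) (simp_all add: gp_commute)
  then show "gp P Q p \<le> C + 3 * \<Delta>" by (simp add: gp_commute)
qed

text \<open>Converts positions along an axis, measured from the remote point \<open>P\<close>, into
  positions measured from \<open>p\<close>. The remote points belong to the axis, but a segment is
  to be compared with its image under \<open>g\<close>, and only \<open>p\<close> has a meaningful
  image there.\<close>

lemma shift_along:
  assumes Pqp: "gp P q p \<le> C" and pQq: "gp p Q q \<le> C" and z: "dist p z + dist z q = dist p (q::'x)"
    and pz: "5 * C + 200 * \<Delta> \<le> dist p z" and zq: "T + C + 100 * \<Delta> \<le> dist z q"
    and y: "gp P Q y \<le> 12 * \<Delta>" and sh: "\<bar>dist P y - dist P z - \<tau>\<bar> \<le> 6 * \<Delta>"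
    and \<tau>: "- 2 * C - 12 * \<Delta> \<le> \<tau>" "\<tau> \<le> T" "0 \<le> T"
  shows "gp p q y \<le> 18 * \<Delta>" "\<bar>dist p y - dist p z - \<tau>\<bar> \<le> 12 * \<Delta>"
proof -
  have C0: "0 \<le> C" using Pqp gp_nonneg[of P q p] by linarith
  have near: "gp P Q z \<le> 6 * \<Delta>" "gp P z p \<le> C + 3 * \<Delta>" "gp z Q q \<le> C + 3 * \<Delta>" "gp P Q p \<le> C + 3 * \<Delta>"
    using segment_near[OF Pqp pQq z] pz zq C0 Delta_pos \<tau> by linarith+
  have Pz: "dist P p + dist p z - 2 * C - 6 * \<Delta> \<le> dist P z"
    using two_gp[of P z p] near(2) dist_commute[of z p] by linarith
  have "gp p Q P = dist P p - gp P Q p" "gp Q y P = dist P y - gp P Q y"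
    using gp_add[of p Q P] gp_add[of y Q P] by (simp_all add: gp_commute dist_commute)
  then have "dist P p - C - 3 * \<Delta> \<le> gp p Q P" "dist P p - C - 3 * \<Delta> \<le> gp Q y P"
    using near(4) y Pz sh \<tau> pz C0 Delta_pos by linarith+
  then have "dist P p - C - 3 * \<Delta> - 3 * \<Delta> \<le> gp p y P" by (rule hyp_ge)
  then have Pyp: "gp P y p \<le> C + 6 * \<Delta>"
    using gp_add[of P y p] gp_commute[of p y P] by linarith
  have "dist z y \<le> \<bar>dist P z - dist P y\<bar> + 2 * (12 * \<Delta>) + 6 * \<Delta>"
    using near(1) y Delta_pos by (intro near_dist[of P Q]) linarith+
  moreover have "dist P y \<le> dist P p + dist p y" by (rule dist_triangle)
  moreover have "2 * gp z y p = dist p z + dist p y - dist z y" by (simp add: two_gp dist_commute)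
  ultimately have zyp: "C + 9 * \<Delta> < gp z y p"
    using Pz sh \<tau> pz C0 Delta_pos dist_triangle[of P z p] by linarith
  have "2 * gp P z p = dist P p + dist p z - dist P z" "2 * gp P y p = dist P p + dist p y - dist P y"
    by (simp_all add: two_gp dist_commute)
  then have "\<bar>(dist P z - dist p z) - (dist P y - dist p y)\<bar> \<le> 6 * \<Delta>"
    using zyp near(2) Pyp Delta_pos \<open>2 * gp z y p = dist p z + dist p y - dist z y\<close>
    by (intro busemann4) linarith+
  then show pos: "\<bar>dist p y - dist p z - \<tau>\<bar> \<le> 12 * \<Delta>" using sh by linarith
  have "15 * \<Delta> < gp P p y"
    using gp_add'[of P p y] gp_add[of p P y] Pyp pos \<tau> pz C0 Delta_pos
    by (simp add: gp_commute dist_commute)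
  then have pQy: "gp p Q y \<le> 12 * \<Delta> + 3 * \<Delta>" using y by (intro hyp_cut[of P Q y]) simp_all
  have "dist p q - dist p y \<le> dist y q" using dist_triangle[of p q y] by simp
  moreover have "2 * gp p y q = dist p q + dist y q - dist p y" by (simp add: two_gp dist_commute)
  ultimately have "C + 3 * \<Delta> < gp p y q" using pos z zq \<tau> C0 Delta_pos by linarith
  then have "gp y Q q \<le> C + 3 * \<Delta>" using pQq by (intro hyp_cut[of p Q q]) simp_all
  then have "18 * \<Delta> < gp q Q y"
    using gp_add[of q Q y] \<open>dist p q - dist p y \<le> dist y q\<close> pos z zq \<tau> C0 Delta_pos
    by (simp add: gp_commute dist_commute)
  then have "gp q p y \<le> 15 * \<Delta> + 3 * \<Delta>" using pQy by (intro hyp_cut[of Q p y]) (simp_all add: gp_commute)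
  then show "gp p q y \<le> 18 * \<Delta>" by (simp add: gp_commute)
qed

text \<open>A Busemann difference: the progress of h^i (or h^-i) along the axis, measured at the
  base point from the end left behind.\<close>

definition shift :: "'a \<Rightarrow> bool \<Rightarrow> nat \<Rightarrow> nat \<Rightarrow> real" where
  "shift h \<sigma> i k = dist (en h (\<not> \<sigma>) k) (en h \<sigma> i) - dist (en h (\<not> \<sigma>) k) x0"

lemma shift_bounds:
  assumes "lox c h"
  shows "- 2 * c - 12 * \<Delta> \<le> shift h \<sigma> i k" "shift h \<sigma> i k \<le> real i * ell h"
proof -
  show "shift h \<sigma> i k \<le> real i * ell h"
    using ell_pw_le[OF lox_carrier[OF assms], of \<sigma> i] dist_triangle[of "en h (\<not> \<sigma>) k" "en h \<sigma> i" x0]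
    by (simp add: shift_def en_pw)
  show "- 2 * c - 12 * \<Delta> \<le> shift h \<sigma> i k"
    using en_opposite[OF assms, of \<sigma> k i] two_gp[of "en h (\<not> \<sigma>) k" "en h \<sigma> i" x0] zero_le_dist[of "en h \<sigma> i" x0]
    unfolding shift_def by linarith
qed

text \<open>By \<open>busemann\<close>, h^i moves every point equally far along the axis up to 6
  \<Delta>; what is measured at the base point in \<open>shift\<close> therefore holds for
  \<open>z\<close>.\<close>

lemma shift_on_segment:
  assumes h: "lox c h" and cC: "c \<le> C" and z: "dist p z + dist z q = dist p q"
    and pz: "5 * C + 200 * \<Delta> \<le> dist p z" and zq: "real i * ell h + C + 100 * \<Delta> \<le> dist z q"
  shows "\<forall>\<^sub>F k in sequentially. ord h \<sigma> C k p q \<longrightarrow> gp p q (\<phi> (pw h \<sigma> i) z) \<le> 18 * \<Delta> \<and>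
    \<bar>dist p (\<phi> (pw h \<sigma> i) z) - dist p z - shift h \<sigma> i k\<bar> \<le> 12 * \<Delta>"
proof -
  let ?A = "pw h \<sigma> i"
  have hc: "h \<in> carrier G" using h by (rule lox_carrier)
  have A: "?A \<in> carrier G" using hc by simp
  have C0: "0 \<le> C" using lox_nonneg[OF h] cC by simp
  have s: "asy (\<lambda>k. \<phi> (inv ?A) (en h \<rho> k)) (en h \<rho>)" for \<rho>
    using stab_asy[OF stab_inv[OF pw_stab[OF h]], of \<sigma> i \<rho>] by simp
  have "\<forall>\<^sub>F k in sequentially. \<bar>(dist (\<phi> (inv ?A) (en h (\<not> \<sigma>) k)) z - dist (en h (\<not> \<sigma>) k) z)
      - (dist (\<phi> (inv ?A) (en h (\<not> \<sigma>) k)) x0 - dist (en h (\<not> \<sigma>) k) x0)\<bar> \<le> 6 * \<Delta>"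
    by (rule busemann[OF s])
  moreover have "\<forall>\<^sub>F k in sequentially. gp (en h (\<not> \<sigma>) k) (en h \<sigma> k) z \<le> 6 * \<Delta> \<longrightarrow>
      gp (\<phi> (inv ?A) (en h (\<not> \<sigma>) k)) (\<phi> (inv ?A) (en h \<sigma> k)) z \<le> gp (en h (\<not> \<sigma>) k) (en h \<sigma> k) z + 6 * \<Delta>"
    by (rule end_change[OF asy_sym[OF s] asy_sym[OF s]])
  ultimately show ?thesis
  proof eventually_elim
    case (elim k)
    show ?case
    proof
      assume o: "ord h \<sigma> C k p q"
      then have o1: "gp (en h (\<not> \<sigma>) k) q p \<le> C" and o2: "gp p (en h \<sigma> k) q \<le> C" by (simp_all add: ord_def)
      have "gp (en h (\<not> \<sigma>) k) (en h \<sigma> k) z \<le> 6 * \<Delta>"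
        using segment_near(1)[OF o1 o2 z] pz zq C0 Delta_pos zero_le_dist[of x0 "pt h"]
        by (smt (verit) mult_nonneg_nonneg of_nat_0_le_iff)
      then have y: "gp (en h (\<not> \<sigma>) k) (en h \<sigma> k) (\<phi> ?A z) \<le> 12 * \<Delta>"
        using elim(2) A by (simp add: act_gp_base)
      have m: "dist (en h (\<not> \<sigma>) k) (\<phi> ?A w) = dist (\<phi> (inv ?A) (en h (\<not> \<sigma>) k)) w" for w
        using A by (rule act_dist_move)
      have sh: "\<bar>dist (en h (\<not> \<sigma>) k) (\<phi> ?A z) - dist (en h (\<not> \<sigma>) k) z - shift h \<sigma> i k\<bar> \<le> 6 * \<Delta>"
        using elim(1) unfolding shift_def en_pw[of h \<sigma> i] m by linarith
      have "- 2 * C - 12 * \<Delta> \<le> shift h \<sigma> i k" "shift h \<sigma> i k \<le> real i * ell h" "0 \<le> real i * ell h"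
        using shift_bounds[OF h, of \<sigma> i k] cC by auto
      from shift_along[OF o1 o2 z pz zq y sh this]
      show "gp p q (\<phi> ?A z) \<le> 18 * \<Delta> \<and> \<bar>dist p (\<phi> ?A z) - dist p z - shift h \<sigma> i k\<bar> \<le> 12 * \<Delta>"
        by simp
    qed
  qed
qed

text \<open>h^i and h^-i advance equally far towards their respective ends. This is what admits
  elements \<open>g\<close> that reverse the axis.\<close>

lemma shift_opposite_aux:
  assumes h: "lox c h"
  shows "\<forall>\<^sub>F k in sequentially. \<bar>shift h \<sigma> i k - shift h (\<not> \<sigma>) i k\<bar> \<le> 18 * \<Delta>"
proof -
  let ?A = "pw h \<sigma> i"
  have hc: "h \<in> carrier G" using h by (rule lox_carrier)
  have A: "?A \<in> carrier G" using hc by simp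
  have s: "asy (\<lambda>k. \<phi> (inv ?A) (en h \<rho> k)) (en h \<rho>)" "asy (\<lambda>k. \<phi> ?A (en h \<rho> k)) (en h \<rho>)" for \<rho>
    using stab_asy[OF stab_inv[OF pw_stab[OF h]], of \<sigma> i \<rho>] stab_asy[OF pw_stab[OF h], of \<sigma> i \<rho>] by simp_all
  have "\<forall>\<^sub>F k in sequentially. \<bar>(dist (\<phi> ?A (en h \<sigma> k)) x0 - dist (en h \<sigma> k) x0)
      - (dist (\<phi> ?A (en h \<sigma> k)) (pt ?A) - dist (en h \<sigma> k) (pt ?A))\<bar> \<le> 6 * \<Delta>"
    by (rule busemann[OF s(2)])
  moreover have "\<forall>\<^sub>F k in sequentially. gp (en h (\<not> \<sigma>) k) (en h \<sigma> k) x0 \<le> c + 6 * \<Delta> \<longrightarrow>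
      gp (\<phi> (inv ?A) (en h (\<not> \<sigma>) k)) (\<phi> (inv ?A) (en h \<sigma> k)) x0 \<le> gp (en h (\<not> \<sigma>) k) (en h \<sigma> k) x0 + 6 * \<Delta>"
    by (rule end_change[OF asy_sym[OF s(1)] asy_sym[OF s(1)]])
  moreover have "\<forall>\<^sub>F k in sequentially. gp (\<phi> (inv ?A) (en h (\<not> \<sigma>) k)) (\<phi> (inv ?A) (en h \<sigma> k)) x0 \<le> c + 12 * \<Delta> \<longrightarrow>
      gp (en h (\<not> \<sigma>) k) (en h \<sigma> k) x0 \<le> gp (\<phi> (inv ?A) (en h (\<not> \<sigma>) k)) (\<phi> (inv ?A) (en h \<sigma> k)) x0 + 6 * \<Delta>"
    by (rule end_change[OF s(1) s(1)])
  ultimately show ?thesis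
  proof eventually_elim
    case (elim k)
    let ?P = "en h (\<not> \<sigma>) k" and ?Q = "en h \<sigma> k"
    have e: "en h (\<not> \<sigma>) i = pt (inv ?A)" "en h \<sigma> i = pt ?A" using hc by (simp_all add: en_pw pw_opposite)
    have m: "dist ?Q (pt (inv ?A)) = dist (\<phi> ?A ?Q) x0" using act_dist_move[of "inv ?A" ?Q x0] A by simp
    have g: "gp (\<phi> (inv ?A) ?P) (\<phi> (inv ?A) ?Q) x0 = gp ?P ?Q (pt ?A)"
      using A by (simp add: act_gp_base)
    have "\<bar>gp ?P ?Q (pt ?A) - gp ?P ?Q x0\<bar> \<le> 6 * \<Delta>"
      using elim(2,3) en_opposite[OF h, of \<sigma> k k] unfolding g by linarith
    moreover have "\<bar>dist (\<phi> ?A ?Q) x0 - dist ?Q x0 - (dist ?Q x0 - dist ?Q (pt ?A))\<bar> \<le> 6 * \<Delta>"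
      using elim(1) A by simp
    moreover have "2 * gp ?P ?Q (pt ?A) = dist ?P (pt ?A) + dist ?Q (pt ?A) - dist ?P ?Q"
      "2 * gp ?P ?Q x0 = dist ?P x0 + dist ?Q x0 - dist ?P ?Q" by (simp_all add: two_gp)
    ultimately show ?case unfolding shift_def not_not e m by linarith
  qed
qed

lemma shift_compare:
  assumes h: "lox c h"
  shows "\<forall>\<^sub>F k in sequentially. \<bar>shift h \<sigma> i k - shift h \<tau> i k\<bar> \<le> 18 * \<Delta>"
  using shift_opposite_aux[OF h, of \<sigma> i] Delta_pos by (cases "\<tau> = \<sigma>") auto

text \<open>Evaluates the coincidence of two of the elements in \<open>overlap_stab\<close>:
  \<open>n\<close> and \<open>m\<close> are the powers by which the two colliding indices
  differ.\<close>

lemma conj_cancel: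
  assumes "p \<in> carrier G" "n \<in> carrier G" "m \<in> carrier G" "q \<in> carrier G" "g \<in> carrier G"
    and e: "inv p \<otimes> (inv g \<otimes> (q \<otimes> g)) = inv (n \<otimes> p) \<otimes> (inv g \<otimes> ((m \<otimes> q) \<otimes> g))"
  shows "g \<otimes> n = m \<otimes> g"
proof -
  have "inv p \<otimes> (inv g \<otimes> (q \<otimes> g)) = inv p \<otimes> (inv n \<otimes> (inv g \<otimes> (m \<otimes> (q \<otimes> g))))"
    using e assms(1-5) by (simp add: inv_mult_group m_assoc)
  then have "inv g \<otimes> (q \<otimes> g) = inv n \<otimes> (inv g \<otimes> (m \<otimes> (q \<otimes> g)))"
    using assms(1-5) by (subst (asm) Units_l_cancel) simp_all
  then have "inv g \<otimes> (q \<otimes> g) = (inv n \<otimes> inv g \<otimes> m) \<otimes> (q \<otimes> g)" using assms(1-5) by (simp add: m_assoc)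
  then have "inv g = inv n \<otimes> inv g \<otimes> m" using assms(1-5) by (subst (asm) right_cancel) simp_all
  then have "g = inv m \<otimes> (g \<otimes> n)"
    using assms(1-5) by (metis inv_closed inv_inv inv_mult_group m_closed m_assoc)
  then show ?thesis using assms(1-5) by (metis inv_solve_left m_closed)
qed

lemma conj_int_pow:
  assumes "g \<in> carrier G" "a \<in> carrier G" "b \<in> carrier G" "g \<otimes> a = b \<otimes> g"
  shows "g \<otimes> a [^] (k::int) = b [^] k \<otimes> g"
proof -
  have nat: "g \<otimes> a' [^] (n::nat) = b' [^] n \<otimes> g"
    if "a' \<in> carrier G" "b' \<in> carrier G" "g \<otimes> a' = b' \<otimes> g" for a' b' n
  proof (induction n)
    case (Suc n)
    then show ?case using that assms(1)
      by simp (metis m_assoc nat_pow_closed)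
  qed (use assms in simp)
  have "inv b \<otimes> g = g \<otimes> inv a"
    using assms by (metis inv_closed inv_solve_left inv_solve_right m_assoc m_closed)
  then show ?thesis
    using nat[of a b] nat[of "inv a" "inv b"] assms
    by (cases k rule: int_cases2) (simp_all add: int_pow_int int_pow_neg_int nat_pow_inv)
qed

text \<open>If \<open>g\<close> maps a long segment of the axis of \<open>h\<close> into the axis, the elements
  \<open>h\<^sup>-\<^sup>i g\<^sup>-\<^sup>1 h\<^sup>\<plusminus>\<^sup>i g\<close> with \<open>i \<le> N\<close> almost fix two distant points, so two of them coincide and \<open>g\<close>
  normalises a power of \<open>h\<close>.\<close>
lemma overlap_stab:
  assumes h: "lox c h" and c: "c \<le> 500 * \<Delta>" and C: "C \<le> 1600 * \<Delta>" and g: "g \<in> carrier G"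
    and fr: "\<exists>\<^sub>F k in sequentially. ord h \<sigma> C k p q \<and> ord h \<tau> C k (\<phi> g p) (\<phi> g q)"
    and len: "real N * ell h + \<kappa> + 10000 * \<Delta> \<le> dist p q"
  shows "g \<in> stab h (\<sigma> = \<tau>)"
proof -
  have hc: "h \<in> carrier G" using h by (rule lox_carrier)
  define D where "D = 1600 * \<Delta>"
  have Nl: "0 \<le> real N * ell h" by simp
  have "8200 * \<Delta> + \<kappa> \<le> dist p q" "0 \<le> 8200 * \<Delta>" "0 \<le> 8200 * \<Delta> + \<kappa>" "8200 * \<Delta> \<le> dist p q"
    using len Nl kappa Delta_pos by linarith+
  \<comment> \<open>8200 \<Delta> = 5 D + 200 \<Delta> is the distance from \<open>p\<close> that
    \<open>shift_on_segment\<close> requires; the assumed length leaves room for \<open>N\<close>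
    periods between \<open>z2\<close> and \<open>q\<close>.\<close>
  then obtain z1 z2 where z1: "dist p z1 = 8200 * \<Delta>" "dist z1 q = dist p q - 8200 * \<Delta>"
    and z2: "dist p z2 = 8200 * \<Delta> + \<kappa>" "dist z2 q = dist p q - (8200 * \<Delta> + \<kappa>)"
    using geod[of "8200 * \<Delta>" p q] geod[of "8200 * \<Delta> + \<kappa>" p q] by blast
  have z12: "\<kappa> \<le> dist z1 z2" using z1 z2 dist_triangle[of p z2 z1] by linarith
  have big: "dist p z + dist z q = dist p q" "5 * D + 200 * \<Delta> \<le> dist p z" "real i * ell h + D + 100 * \<Delta> \<le> dist z q"
    if "z \<in> {z1, z2}" "i \<le> N" for z i
  proof -
    have "real i * ell h \<le> real N * ell h" using that(2) by (intro mult_right_mono) auto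
    then show "dist p z + dist z q = dist p q" "5 * D + 200 * \<Delta> \<le> dist p z" "real i * ell h + D + 100 * \<Delta> \<le> dist z q"
      using that(1) z1 z2 len kappa Delta_pos unfolding D_def by auto
  qed
  have cD: "c \<le> D" using c Delta_pos by (simp add: D_def)
  have ev: "\<forall>\<^sub>F k in sequentially. \<forall>z\<in>{z1, z2}. \<forall>i\<in>{..N}.
     (ord h \<sigma> D k p q \<longrightarrow> gp p q (\<phi> (pw h \<sigma> i) z) \<le> 18 * \<Delta> \<and>
        \<bar>dist p (\<phi> (pw h \<sigma> i) z) - dist p z - shift h \<sigma> i k\<bar> \<le> 12 * \<Delta>) \<and>
     (ord h \<tau> D k (\<phi> g p) (\<phi> g q) \<longrightarrow> gp (\<phi> g p) (\<phi> g q) (\<phi> (pw h \<tau> i) (\<phi> g z)) \<le> 18 * \<Delta> \<and>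
        \<bar>dist (\<phi> g p) (\<phi> (pw h \<tau> i) (\<phi> g z)) - dist (\<phi> g p) (\<phi> g z) - shift h \<tau> i k\<bar> \<le> 12 * \<Delta>) \<and>
     \<bar>shift h \<sigma> i k - shift h \<tau> i k\<bar> \<le> 18 * \<Delta>"
    by (intro eventually_ball_finite finite.intros finite_atMost ballI eventually_conj
        shift_on_segment[OF h cD] shift_compare[OF h]) (use big g in auto)
  have "\<exists>\<^sub>F k in sequentially. ord h \<sigma> D k p q \<and> ord h \<tau> D k (\<phi> g p) (\<phi> g q)"
    using fr by (rule frequently_elim1) (use C ord_mono D_def in blast)
  from frequently_ex[OF frequently_eventually_frequently[OF this ev]]
  obtain k where o: "ord h \<sigma> D k p q" "ord h \<tau> D k (\<phi> g p) (\<phi> g q)" and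
    k: "\<And>z i. z \<in> {z1, z2} \<Longrightarrow> i \<in> {..N} \<Longrightarrow>
     (ord h \<sigma> D k p q \<longrightarrow> gp p q (\<phi> (pw h \<sigma> i) z) \<le> 18 * \<Delta> \<and>
        \<bar>dist p (\<phi> (pw h \<sigma> i) z) - dist p z - shift h \<sigma> i k\<bar> \<le> 12 * \<Delta>) \<and>
     (ord h \<tau> D k (\<phi> g p) (\<phi> g q) \<longrightarrow> gp (\<phi> g p) (\<phi> g q) (\<phi> (pw h \<tau> i) (\<phi> g z)) \<le> 18 * \<Delta> \<and>
        \<bar>dist (\<phi> g p) (\<phi> (pw h \<tau> i) (\<phi> g z)) - dist (\<phi> g p) (\<phi> g z) - shift h \<tau> i k\<bar> \<le> 12 * \<Delta>) \<and>
     \<bar>shift h \<sigma> i k - shift h \<tau> i k\<bar> \<le> 18 * \<Delta>"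
    by blast
  define w where "w i = inv (pw h \<sigma> i) \<otimes> (inv g \<otimes> (pw h \<tau> i \<otimes> g))" for i
  have wc: "w i \<in> carrier G" for i using hc g by (simp add: w_def)
  have move: "dist z (\<phi> (w i) z) \<le> 100 * \<Delta>" if z: "z \<in> {z1, z2}" and i: "i \<in> {..N}" for z i
  proof -
    let ?y = "\<phi> g (\<phi> (pw h \<sigma> i) z)" and ?y' = "\<phi> (pw h \<tau> i) (\<phi> g z)"
    have 1: "gp (\<phi> g p) (\<phi> g q) ?y \<le> 18 * \<Delta>" "\<bar>dist (\<phi> g p) ?y - dist p z - shift h \<sigma> i k\<bar> \<le> 12 * \<Delta>"
      using k[OF z i] o g by simp_all
    have 2: "gp (\<phi> g p) (\<phi> g q) ?y' \<le> 18 * \<Delta>" "\<bar>dist (\<phi> g p) ?y' - dist p z - shift h \<tau> i k\<bar> \<le> 12 * \<Delta>"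
      using k[OF z i] o g by simp_all
    have 3: "\<bar>shift h \<sigma> i k - shift h \<tau> i k\<bar> \<le> 18 * \<Delta>" using k[OF z i] by simp
    have "dist ?y ?y' \<le> \<bar>dist (\<phi> g p) ?y - dist (\<phi> g p) ?y'\<bar> + 2 * (18 * \<Delta>) + 6 * \<Delta>"
      by (rule near_dist[OF 1(1) 2(1)])
    then have "dist ?y ?y' \<le> 100 * \<Delta>" using 1 2 3 Delta_pos by linarith
    moreover have "dist z (\<phi> (w i) z) = dist ?y ?y'"
      using hc g by (simp add: w_def act_mult act_dist_move)
    ultimately show ?thesis by simp
  qed
  let ?F = "{g \<in> carrier G. dist z1 (\<phi> g z1) \<le> 100 * \<Delta> \<and> dist z2 (\<phi> g z2) \<le> 100 * \<Delta>}"
  have F: "finite ?F" "card ?F \<le> N" using acyl[OF z12] by auto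
  have "w ` {..N} \<subseteq> ?F" using wc move by auto
  then have "card (w ` {..N}) < card {..N}" using F card_mono[of ?F "w ` {..N}"] by simp
  then have "\<not> inj_on w {..N}" by (rule pigeonhole)
  then obtain i' j' where "i' \<noteq> j'" "w i' = w j'" by (auto simp: inj_on_def)
  then obtain i j where ij: "i < j" "w i = w j" by (metis nat_neq_iff)
  define n where "n = j - i"
  have n: "j = n + i" "1 \<le> n" using ij by (auto simp: n_def)
  have "g \<otimes> pw h \<sigma> n = pw h \<tau> n \<otimes> g"
    using ij(2) hc g unfolding w_def n(1) pw_add[OF hc]
    by (intro conj_cancel[of "pw h \<sigma> i" _ _ "pw h \<tau> i"]) simp_all
  then have pow: "g \<otimes> pw h \<sigma> n [^] l = pw h \<tau> n [^] l \<otimes> g" for l :: int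
    using hc g by (intro conj_int_pow) simp_all
  \<comment> \<open>What \<open>g\<close> does to the n-th power decides what it does to the ends,
    since h^(n k) and h^k tend to the same end.\<close>
  have "asy (\<lambda>k. \<phi> g (en h \<rho> k)) (en h (\<rho> = (\<sigma> = \<tau>)))" for \<rho>
  proof -
    have e: "pw h \<sigma>' n [^] (if \<rho> = \<sigma> then int m else - int m) = pw h (\<sigma>' = (\<rho> = \<sigma>)) (n * m)" for \<sigma>' m
      using hc by (auto simp: pw_def int_pow_pow)
    have e1: "(\<sigma> = (\<rho> = \<sigma>)) = \<rho>" "(\<tau> = (\<rho> = \<sigma>)) = (\<rho> = (\<sigma> = \<tau>))" by (cases \<rho>; cases \<sigma>; cases \<tau>; simp)+
    have "\<phi> g (en h \<rho> (n * m)) = \<phi> (pw h (\<rho> = (\<sigma> = \<tau>)) (n * m)) (pt g)" for m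
      using pow[of "if \<rho> = \<sigma> then int m else - int m"] g hc unfolding e e1 en_pw by (metis pt_mult pw_closed)
    then have "dist (en h (\<rho> = (\<sigma> = \<tau>)) (n * m)) (\<phi> g (en h \<rho> (n * m))) \<le> ell g" for m
      using hc by (simp add: en_pw)
    then have "asy (\<lambda>m. \<phi> g (en h \<rho> (n * m))) (en h (\<rho> = (\<sigma> = \<tau>)))"
      using asy_en_mult[OF h n(2)] by (rule asy_near[rotated])
    moreover have "asy (\<lambda>m. \<phi> g (en h \<rho> m)) (\<lambda>m. \<phi> g (en h \<rho> (n * m)))"
      by (rule asy_act[OF asy_sym[OF asy_en_mult[OF h n(2)]] g])
    ultimately show ?thesis using asy_trans by blast
  qed
  then show ?thesis using g by (simp add: stab_def)
qed

subsection \<open>Points and elements near an axis\<close>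

text \<open>\<open>g\<close> permutes the two ends, so their product seen from g x0 is the product
  of the permuted ends seen from the base point, up to the 6 \<Delta> of
  \<open>end_change\<close>.\<close>

lemma orbit_near:
  assumes h: "lox c h" and g: "g \<in> stab h \<tau>"
  shows "\<forall>\<^sub>F k in sequentially. gp (en h (\<not> \<sigma>) k) (en h \<sigma> k) (pt g) \<le> c + 12 * \<Delta>"
proof -
  note gc = stab_carrier[OF g]
  have s: "asy (en h (\<rho> = \<tau>)) (\<lambda>k. \<phi> (inv g) (en h \<rho> k))" for \<rho>
    by (rule asy_sym[OF stab_asy[OF stab_inv[OF g]]])
  have "\<forall>\<^sub>F k in sequentially. gp (en h ((\<not> \<sigma>) = \<tau>) k) (en h (\<sigma> = \<tau>) k) x0 \<le> c + 6 * \<Delta> \<longrightarrow>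
     gp (\<phi> (inv g) (en h (\<not> \<sigma>) k)) (\<phi> (inv g) (en h \<sigma> k)) x0
     \<le> gp (en h ((\<not> \<sigma>) = \<tau>) k) (en h (\<sigma> = \<tau>) k) x0 + 6 * \<Delta>"
    by (rule end_change[OF s s])
  then show ?thesis
  proof eventually_elim
    case (elim k)
    have e: "((\<not> \<sigma>) = \<tau>) = (\<not> (\<sigma> = \<tau>))" by (cases \<sigma>; cases \<tau>) simp_all
    show ?case using elim en_opposite[OF h, of "\<sigma> = \<tau>" k k] gc unfolding e by (simp add: act_gp_base)
  qed
qed

lemma ord_stab:
  assumes g: "g \<in> stab h \<tau>"
  shows "\<forall>\<^sub>F k in sequentially. ord h \<sigma> C k p q \<longrightarrow> ord h (\<sigma> = \<tau>) (C + 3 * \<Delta>) k (\<phi> g p) (\<phi> g q)"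
proof -
  note gc = stab_carrier[OF g]
  have s: "asy (en h (\<rho> = \<tau>)) (\<lambda>k. \<phi> (inv g) (en h \<rho> k))" for \<rho>
    by (rule asy_sym[OF stab_asy[OF stab_inv[OF g]]])
  have e: "((\<sigma> = \<tau>) = \<tau>) = \<sigma>" "((\<not> (\<sigma> = \<tau>)) = \<tau>) = (\<not> \<sigma>)" by (cases \<sigma>; cases \<tau>; simp)+
  have "\<forall>\<^sub>F k in sequentially. gp (en h (\<not> \<sigma>) k) q p \<le> C \<longrightarrow>
     gp (\<phi> (inv g) (en h (\<not> (\<sigma> = \<tau>)) k)) q p \<le> gp (en h (\<not> \<sigma>) k) q p + 3 * \<Delta>"
    using end_change1[OF s[of "\<not> (\<sigma> = \<tau>)"], of q p C] unfolding e .
  moreover have "\<forall>\<^sub>F k in sequentially. gp (en h \<sigma> k) p q \<le> C \<longrightarrow>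
     gp (\<phi> (inv g) (en h (\<sigma> = \<tau>) k)) p q \<le> gp (en h \<sigma> k) p q + 3 * \<Delta>"
    using end_change1[OF s[of "\<sigma> = \<tau>"], of p q C] unfolding e .
  ultimately show ?thesis
  proof eventually_elim
    case (elim k)
    have "gp z (\<phi> g w) (\<phi> g u) = gp (\<phi> (inv g) z) w u" for z w u
      using gc by (simp add: act_gp_base)
    then have m: "gp (en h (\<not> (\<sigma> = \<tau>)) k) (\<phi> g q) (\<phi> g p) = gp (\<phi> (inv g) (en h (\<not> (\<sigma> = \<tau>)) k)) q p"
      "gp (\<phi> g p) (en h (\<sigma> = \<tau>) k) (\<phi> g q) = gp (\<phi> (inv g) (en h (\<sigma> = \<tau>) k)) p q"
      "gp p (en h \<sigma> k) q = gp (en h \<sigma> k) p q"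
      by (simp_all only: gp_commute[of "\<phi> g p"] gp_commute[of p])
    show ?case unfolding ord_def m using elim by linarith
  qed
qed

lemma ord_between:
  assumes o: "ord h \<sigma> C k u v" and y: "gp u v y1 \<le> c" "gp u v y2 \<le> c" "dist u y1 \<le> dist u y2"
  shows "ord h \<sigma> (C + 3 * c + 3 * \<Delta>) k y1 y2"
proof -
  let ?P = "en h (\<not> \<sigma>) k" and ?Q = "en h \<sigma> k"
  have c0: "0 \<le> c" using y(1) gp_nonneg[of u v y1] by linarith
  have d: "dist y1 y2 \<le> dist u y2 - dist u y1 + 2 * c + 6 * \<Delta>"
    using near_dist[OF y(1,2)] y(3) by simp
  have e: "dist ?P u + dist u v - dist ?P v \<le> 2 * C" "dist u v + dist v ?Q - dist u ?Q \<le> 2 * C"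
    using o two_gp[of ?P v u] two_gp[of u ?Q v] by (simp_all add: ord_def dist_commute)
  have f: "dist u y1 + dist y1 v - dist u v \<le> 2 * c" "dist u y2 + dist y2 v - dist u v \<le> 2 * c"
    using y two_gp[of u v y1] two_gp[of u v y2] by (simp_all add: dist_commute)
  have t: "dist ?P y1 \<le> dist ?P u + dist u y1" "dist ?P v \<le> dist ?P y2 + dist y2 v"
    "dist y2 ?Q \<le> dist y2 v + dist v ?Q" "dist u ?Q \<le> dist u y1 + dist y1 ?Q"
    by (rule dist_triangle)+
  have "gp ?P y2 y1 \<le> C + 3 * c + 3 * \<Delta>"
    using d e f t c0 two_gp[of ?P y2 y1] dist_commute[of y2 y1] by linarith
  moreover have "gp y1 ?Q y2 \<le> C + 3 * c + 3 * \<Delta>"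
    using d e f t c0 two_gp[of y1 ?Q y2] dist_commute[of ?Q y2] by linarith
  ultimately show ?thesis by (simp add: ord_def)
qed

text \<open>Which of the two orders holds may vary with \<open>k\<close>; later uses therefore pass
  through \<open>overlap_stab_unordered\<close>.\<close>

lemma ord_orbit:
  assumes h: "lox c h" and g: "g \<in> stab h True"
  shows "\<forall>\<^sub>F k in sequentially. ord h True (2 * c + 27 * \<Delta>) k x0 (pt g) \<or> ord h False (2 * c + 27 * \<Delta>) k x0 (pt g)"
  using orbit_near[OF h g, of True]
proof eventually_elim
  case (elim k)
  let ?P = "en h False k" and ?Q = "en h True k"
  have c0: "0 \<le> c" using lox_nonneg[OF h] .
  have 1: "gp ?P ?Q x0 \<le> c + 12 * \<Delta>" "gp ?P ?Q (pt g) \<le> c + 12 * \<Delta>"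
    using en_opposite[OF h, of True k k] elim Delta_pos by simp_all
  have d: "dist x0 (pt g) \<le> \<bar>dist ?P x0 - dist ?P (pt g)\<bar> + 2 * c + 30 * \<Delta>"
    using near_dist[OF 1] by (simp add: algebra_simps)
  have 2: "0 \<le> gp ?P ?Q x0" "0 \<le> gp ?P ?Q (pt g)" by (rule gp_nonneg)+
  have 3: "2 * gp ?P ?Q x0 = dist ?P x0 + dist ?Q x0 - dist ?P ?Q"
    "2 * gp ?P ?Q (pt g) = dist ?P (pt g) + dist ?Q (pt g) - dist ?P ?Q" by (rule two_gp)+
  have 4: "2 * gp ?P (pt g) x0 = dist ?P x0 + dist x0 (pt g) - dist ?P (pt g)"
    "2 * gp x0 ?Q (pt g) = dist x0 (pt g) + dist ?Q (pt g) - dist ?Q x0"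
    "2 * gp ?Q (pt g) x0 = dist ?Q x0 + dist x0 (pt g) - dist ?Q (pt g)"
    "2 * gp x0 ?P (pt g) = dist x0 (pt g) + dist ?P (pt g) - dist ?P x0"
    by (simp_all add: two_gp dist_commute)
  show ?case
  proof (cases "dist ?P x0 \<le> dist ?P (pt g)")
    case True
    then have "ord h True (2 * c + 27 * \<Delta>) k x0 (pt g)"
      unfolding ord_def not_True_eq_False using d 1 2 3 4 c0 Delta_pos by (intro conjI; linarith)
    then show ?thesis ..
  next
    case False
    then have "ord h False (2 * c + 27 * \<Delta>) k x0 (pt g)"
      unfolding ord_def not_False_eq_True using d 1 2 3 4 c0 Delta_pos by (intro conjI; linarith)
    then show ?thesis ..
  qed
qed

text \<open>The power wanted is the last one whose orbit point does not come after \<open>y\<close>,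
  measured from the repelling side: the next one overshoots, so \<open>y\<close> is at most one
  period further on.\<close>

lemma axis_cobounded:
  assumes h: "lox c h" and y: "gp (en h False k) (en h True k) y \<le> c'" and cc: "c + 6 * \<Delta> \<le> c'"
  shows "\<exists>j::int. dist y (pt (h [^] j)) \<le> ell h + 4 * c' + 6 * \<Delta>"
proof -
  let ?P = "en h False k" and ?Q = "en h True k"
  have hc: "h \<in> carrier G" by (rule lox_carrier[OF h])
  have PQ: "?P = pt (h [^] (- int k))" "?Q = pt (h [^] int k)" by (simp_all add: en_def)
  define J where "J = {j. - int k \<le> j \<and> j \<le> int k \<and> dist ?P (pt (h [^] j)) \<le> dist ?P y}"
  have fin: "finite J" unfolding J_def by (rule finite_subset[of _ "{- int k..int k}"]) auto
  have "- int k \<in> J" by (simp add: J_def PQ)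
  then have j: "Max J \<in> J" and jm: "\<And>i. i \<in> J \<Longrightarrow> i \<le> Max J" using fin Max_in Max_ge by auto
  let ?j = "Max J"
  have c0: "0 \<le> c'" using lox_nonneg[OF h] cc Delta_pos by linarith
  have near: "gp ?P ?Q (pt (h [^] ?j)) \<le> c'"
    using lox_axis(1)[OF h, of "- int k" ?j "int k"] j cc by (simp add: J_def PQ)
  have "dist ?P y \<le> dist ?P (pt (h [^] ?j)) + ell h + 2 * c'"
  proof (cases "?j = int k")
    case True
    then have "pt (h [^] ?j) = ?Q" by (simp add: PQ)
    then show ?thesis
      using two_gp[of ?P ?Q y] y zero_le_dist[of ?Q y] zero_le_dist[of x0 "pt h"] by (simp only:; linarith)
  next
    case False
    then have "?j + 1 \<notin> J" "?j + 1 \<le> int k" "- int k \<le> ?j + 1" using jm[of "?j + 1"] j by (auto simp: J_def)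
    then have "dist ?P y < dist ?P (pt (h [^] (?j + 1)))" by (simp add: J_def)
    also have "\<dots> \<le> dist ?P (pt (h [^] ?j)) + ell h"
      using dist_triangle[of ?P "pt (h [^] (?j + 1))" "pt (h [^] ?j)"] lox_axis(3)[OF h, of ?j] by simp
    finally show ?thesis using c0 by simp
  qed
  moreover have "dist ?P (pt (h [^] ?j)) \<le> dist ?P y" using j by (simp add: J_def)
  ultimately show ?thesis using near_dist[OF y near] by (intro exI[of _ ?j]) simp
qed

text \<open>An element fixing both ends shifts the axis by an amount that Busemann functions read
  off at the base point, here at most \<open>D\<close>. So it carries two distant points of the axis
  along it by at most D + 6 \<Delta>, and \<open>shift_count\<close> applies with a range of 2 D +
  12 \<Delta>.\<close>

lemma stab_ball_card:
  assumes h: "lox c h" and c: "c \<le> 500 * \<Delta>" and D: "0 \<le> D"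
  shows "finite {e \<in> stab h True. ell e \<le> D} \<and>
    real (card {e \<in> stab h True. ell e \<le> D}) \<le> real N * ((2 * D + 12 * \<Delta>) / (40 * \<Delta>) + 1)"
proof -
  have c0: "0 \<le> c" by (rule lox_nonneg[OF h])
  \<comment> \<open>Finite subsets come first, because one \<open>k\<close> has to serve all their
    elements; the uniform bound then yields finiteness of the whole set.\<close>
  have fin: "real (card S) \<le> real N * ((2 * D + 12 * \<Delta>) / (40 * \<Delta>) + 1)"
    if S: "S \<subseteq> {e \<in> stab h True. ell e \<le> D}" "finite S" for S
  proof -
    define j where "j = nat \<lceil>(\<kappa> + 10000 * \<Delta>) / (14 * \<Delta>)\<rceil>"
    have "(\<kappa> + 10000 * \<Delta>) / (14 * \<Delta>) \<le> real j" unfolding j_def by linarith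
    then have "\<kappa> + 10000 * \<Delta> \<le> 14 * \<Delta> * real j"
      using Delta_pos by (simp add: divide_le_eq mult.commute)
    then have len: "\<kappa> + 10000 * \<Delta> \<le> dist x0 (en h True j)"
      using dist_en[OF h, of j True] by linarith
    let ?q = "en h True j"
    have "0 \<le> 1000 * \<Delta>" "1000 * \<Delta> \<le> dist x0 ?q" "0 \<le> 3000 * \<Delta> + \<kappa>" "3000 * \<Delta> + \<kappa> \<le> dist x0 ?q"
      using len kappa Delta_pos by linarith+
    then obtain z1 z2 where z1: "dist x0 z1 = 1000 * \<Delta>" "dist z1 ?q = dist x0 ?q - 1000 * \<Delta>"
      and z2: "dist x0 z2 = 3000 * \<Delta> + \<kappa>" "dist z2 ?q = dist x0 ?q - (3000 * \<Delta> + \<kappa>)"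
      using geod[of "1000 * \<Delta>" x0 ?q] geod[of "3000 * \<Delta> + \<kappa>" x0 ?q] by blast
    have Sc: "S \<subseteq> carrier G" using S stab_carrier by auto
    have s: "asy (\<lambda>k. \<phi> (inv e) (en h \<rho> k)) (en h \<rho>)" if "e \<in> S" for e \<rho>
      using stab_asy[OF stab_inv, of e h True \<rho>] S that by auto
    have ev1: "\<forall>\<^sub>F k in sequentially.
      \<bar>(dist (\<phi> (inv e) (en h False k)) z - dist (en h False k) z)
      - (dist (\<phi> (inv e) (en h False k)) x0 - dist (en h False k) x0)\<bar> \<le> 6 * \<Delta> \<and>
      (gp (en h False k) (en h True k) z \<le> 6 * \<Delta> \<longrightarrow>
        gp (\<phi> (inv e) (en h False k)) (\<phi> (inv e) (en h True k)) z \<le> gp (en h False k) (en h True k) z + 6 * \<Delta>)"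
      if "e \<in> S" for e z
      by (rule eventually_conj[OF busemann[OF s[OF that]] end_change[OF asy_sym[OF s[OF that]] asy_sym[OF s[OF that]]]])
    have ev: "\<forall>\<^sub>F k in sequentially. \<forall>e\<in>S. \<forall>z\<in>{z1, z2}.
      \<bar>(dist (\<phi> (inv e) (en h False k)) z - dist (en h False k) z)
      - (dist (\<phi> (inv e) (en h False k)) x0 - dist (en h False k) x0)\<bar> \<le> 6 * \<Delta> \<and>
      (gp (en h False k) (en h True k) z \<le> 6 * \<Delta> \<longrightarrow>
        gp (\<phi> (inv e) (en h False k)) (\<phi> (inv e) (en h True k)) z \<le> gp (en h False k) (en h True k) z + 6 * \<Delta>)"
      by (rule eventually_ball_finite[OF that(2)], rule ballI, rule eventually_ball_finite, simp, rule ballI, rule ev1)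
    obtain k where kj: "j \<le> k" and k: "\<And>e z. e \<in> S \<Longrightarrow> z \<in> {z1, z2} \<Longrightarrow>
      \<bar>(dist (\<phi> (inv e) (en h False k)) z - dist (en h False k) z)
      - (dist (\<phi> (inv e) (en h False k)) x0 - dist (en h False k) x0)\<bar> \<le> 6 * \<Delta> \<and>
      (gp (en h False k) (en h True k) z \<le> 6 * \<Delta> \<longrightarrow>
        gp (\<phi> (inv e) (en h False k)) (\<phi> (inv e) (en h True k)) z \<le> gp (en h False k) (en h True k) z + 6 * \<Delta>)"
      using eventually_happens'[OF sequentially_bot, OF eventually_conj[OF ev eventually_ge_at_top[of j]]] by auto
    let ?P = "en h False k" and ?Q = "en h True k"
    have o1: "gp ?P ?q x0 \<le> c + 6 * \<Delta>" using en_opposite[OF h, of True k j] by simp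
    have o2: "gp x0 ?Q ?q \<le> c + 6 * \<Delta>"
      using lox_axis(1)[OF h, of 0 "int j" "int k"] kj by (simp add: en_def)
    have n1: "gp ?P ?Q z \<le> 6 * \<Delta>" "gp ?P z x0 \<le> c + 9 * \<Delta>" if "z \<in> {z1, z2}" for z
      using segment_near(1,2)[OF o1 o2, of z] that z1 z2 c len kappa Delta_pos by auto
    have Pz: "dist ?P z2 - dist ?P z1 \<ge> 900 * \<Delta>"
      using n1(2)[of z1] gp_nonneg[of ?P z2 x0] gp_nonneg[of ?P z1 x0] n1(2)[of z2] two_gp[of ?P z1 x0] two_gp[of ?P z2 x0]
        z1 z2 c Delta_pos kappa dist_commute[of z1 x0] dist_commute[of z2 x0] by simp
    have m: "dist ?P (\<phi> e w) = dist (\<phi> (inv e) ?P) w" if "e \<in> S" for e w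
      using that Sc by (auto simp: act_dist_move)
    have sh: "\<bar>dist ?P (\<phi> e z) - dist ?P z - (dist ?P (pt e) - dist ?P x0)\<bar> \<le> 6 * \<Delta>"
      if "e \<in> S" "z \<in> {z1, z2}" for e z
      using k[OF that] unfolding m[OF that(1)] by simp
    have shD: "\<bar>dist ?P (pt e) - dist ?P x0\<bar> \<le> D" if "e \<in> S" for e
      using S(1) that abs_dist_diff_le[of "pt e" ?P x0] by (auto simp: dist_commute)
    have "finite S \<and> real (card S) \<le> real N * ((2 * D + 12 * \<Delta>) / (40 * \<Delta>) + 1)"
    proof (rule shift_count[of S z1 z2 _ ?P ?Q "dist ?P z1 - D - 6 * \<Delta>"])
      show "S \<subseteq> carrier G" by (rule Sc)
      show "\<kappa> \<le> dist z1 z2" using z1 z2 dist_triangle[of x0 z2 z1] Delta_pos by linarith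
      show "0 \<le> 2 * D + 12 * \<Delta>" using D Delta_pos by simp
      fix e assume e: "e \<in> S"
      then have ec: "e \<in> carrier G" using Sc by auto
      show "gp ?P ?Q (\<phi> e z1) \<le> 12 * \<Delta>" "gp ?P ?Q (\<phi> e z2) \<le> 12 * \<Delta>"
        using k[OF e, of z1] k[OF e, of z2] n1(1)[of z1] n1(1)[of z2] ec by (simp_all add: act_gp_base)
      show "dist ?P (\<phi> e z1) \<le> dist ?P (\<phi> e z2)"
        using sh[OF e, of z1] sh[OF e, of z2] Pz Delta_pos by simp
      show "dist ?P z1 - D - 6 * \<Delta> \<le> dist ?P (\<phi> e z1) \<and>
          dist ?P (\<phi> e z1) \<le> dist ?P z1 - D - 6 * \<Delta> + (2 * D + 12 * \<Delta>)"
        using sh[OF e, of z1] shD[OF e] by auto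
    qed
    then show ?thesis ..
  qed
  let ?B = "real N * ((2 * D + 12 * \<Delta>) / (40 * \<Delta>) + 1)"
  have "finite {e \<in> stab h True. ell e \<le> D} \<and> card {e \<in> stab h True. ell e \<le> D} \<le> nat \<lfloor>?B\<rfloor>"
    by (rule finite_if_finite_subsets_card_bdd) (use fin in \<open>auto simp: le_nat_floor\<close>)
  then show ?thesis using fin[OF order_refl] by blast
qed

lemma gp_ends_sum:
  assumes "gp P Q (y::'x) \<le> c" shows "dist x0 y - c \<le> gp y P x0 + gp y Q x0"
  using assms two_gp[of P Q y] two_gp[of y P x0] two_gp[of y Q x0] dist_triangle[of P Q x0]
    dist_commute[of y P] dist_commute[of y Q] dist_commute[of y x0] dist_commute[of x0 Q] by linarith

text \<open>All powers of \<open>y\<close> stabilise the ends of \<open>h\<close>, so their orbit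
  points stay near its axis and must follow one of its ends. The point y x0 determines \<tau>;
  positive powers follow it, negative powers leave it at once and so follow the opposite
  end.\<close>

lemma same_ends:
  assumes h: "lox c h" "c \<le> 500 * \<Delta>" and y: "lox c' y" "c' \<le> 500 * \<Delta>" "10000 * \<Delta> \<le> ell y"
    and ys: "y \<in> stab h True"
  shows "\<exists>\<tau>. \<forall>\<sigma>. asy (en y \<sigma>) (en h (\<sigma> = \<tau>))"
proof -
  have yc: "y \<in> carrier G" by (rule lox_carrier[OF y(1)])
  have "en y True 1 = pt y" using yc by (simp add: en_def)
  have "\<forall>\<^sub>F k in sequentially. (4000 * \<Delta> \<le> gp (pt y) (en h True k) x0) \<or> (4000 * \<Delta> \<le> gp (pt y) (en h False k) x0)"
    using orbit_near[OF h(1) ys, of True]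
  proof eventually_elim
    case (elim k)
    then show ?case using gp_ends_sum[of "en h False k" "en h True k" "pt y"] y h Delta_pos by force
  qed
  then have "\<exists>\<^sub>F k in sequentially. (4000 * \<Delta> \<le> gp (pt y) (en h True k) x0) \<or> (4000 * \<Delta> \<le> gp (pt y) (en h False k) x0)"
    by (rule eventually_frequently[rotated]) simp
  then obtain \<tau> where \<tau>: "\<exists>\<^sub>F k in sequentially. 4000 * \<Delta> \<le> gp (pt y) (en h \<tau> k) x0"
    unfolding frequently_disj_iff by blast
  have pos: "\<forall>\<^sub>F k in sequentially. gp (en h (\<not> \<tau>) k) (en h \<tau> k) (en y \<sigma> j) \<le> c + 12 * \<Delta>" for \<sigma> j
  proof -
    have "pw y \<sigma> j \<in> stab h True"
    proof -
      have p: "y [^] n \<in> stab h True" for n :: nat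
      proof (induction n)
        case 0
        then show ?case using stab_pow[OF h(1), of 0] by simp
      next
        case (Suc n)
        then show ?case using stab_mult[OF Suc ys] by simp
      qed
      then show ?thesis using yc stab_inv[OF p[of j]] by (auto simp: pw_def int_pow_int int_pow_neg_int)
    qed
    then show ?thesis unfolding en_pw[of y] by (rule orbit_near[OF h(1)])
  qed
  have key: "14 * \<Delta> * real j - 2000 * \<Delta> \<le> gp (en y \<sigma> j) (en h (\<sigma> = \<tau>) j) x0" for \<sigma> j
  proof (cases "j = 0")
    case True
    then show ?thesis using gp_nonneg[of "en y \<sigma> j" "en h (\<sigma> = \<tau>) j" x0] Delta_pos by simp
  next
    case False
    have "\<exists>\<^sub>F k in sequentially. (4000 * \<Delta> \<le> gp (pt y) (en h \<tau> k) x0) \<and> (gp (en h (\<not> \<tau>) k) (en h \<tau> k) (en y \<sigma> j) \<le> c + 12 * \<Delta> \<and> j \<le> k)"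
      by (rule frequently_eventually_frequently[OF \<tau> eventually_conj[OF pos eventually_ge_at_top]])
    then obtain k where k: "4000 * \<Delta> \<le> gp (pt y) (en h \<tau> k) x0"
      "gp (en h (\<not> \<tau>) k) (en h \<tau> k) (en y \<sigma> j) \<le> c + 12 * \<Delta>" "j \<le> k"
      using frequently_ex by blast
    let ?a = "en y \<sigma> j"
    have sum: "dist x0 ?a - (c + 12 * \<Delta>) \<le> gp ?a (en h (\<not> \<tau>) k) x0 + gp ?a (en h \<tau> k) x0"
      by (rule gp_ends_sum[OF k(2)])
    have da: "14 * \<Delta> * real j \<le> dist x0 ?a" by (rule dist_en[OF y(1)])
    have opp: "gp (en h \<tau> k) (en h (\<not> \<tau>) k) x0 \<le> c + 6 * \<Delta>"
      using en_opposite[OF h(1), of \<tau> k k] by (simp add: gp_commute)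
    have main: "14 * \<Delta> * real j - 1100 * \<Delta> \<le> gp ?a (en h (\<sigma> = \<tau>) k) x0"
    proof (cases \<sigma>)
      case True
      have "dist x0 (en y True 1) - (c' + 6 * \<Delta>) \<le> gp (en y True 1) ?a x0"
        using en_same_aux[OF y(1), of 1 j True] False True by simp
      then have "3990 * \<Delta> \<le> gp (pt y) ?a x0" using \<open>en y True 1 = pt y\<close> y Delta_pos by simp
      then have "3990 * \<Delta> - 3 * \<Delta> \<le> gp ?a (en h \<tau> k) x0"
        using k(1) Delta_pos by (intro hyp_ge[of _ _ "pt y"]) (simp_all add: gp_commute)
      then have "gp ?a (en h (\<not> \<tau>) k) x0 \<le> c + 6 * \<Delta> + 3 * \<Delta>"
        using opp h(2) Delta_pos by (intro hyp_cut[of "en h \<tau> k"]) (simp_all add: gp_commute)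
      then show ?thesis using sum da h(2) Delta_pos True by simp
    next
      case F: False
      have "gp (en y False j) (en y True 1) x0 \<le> c' + 6 * \<Delta>" using en_opposite[OF y(1), of True j 1] by simp
      then have "gp (pt y) ?a x0 \<le> c' + 6 * \<Delta>" using \<open>en y True 1 = pt y\<close> F by (simp add: gp_commute)
      then have "gp (en h \<tau> k) ?a x0 \<le> c' + 6 * \<Delta> + 3 * \<Delta>"
        using k(1) y(2) Delta_pos by (intro hyp_cut[of "pt y"]) simp_all
      then show ?thesis using sum da h(2) y(2) Delta_pos F by (simp add: gp_commute)
    qed
    have "14 * \<Delta> * real j - 1100 * \<Delta> \<le> gp (en h (\<sigma> = \<tau>) k) (en h (\<sigma> = \<tau>) j) x0"
      using en_same[OF h(1), of k j "\<sigma> = \<tau>"] k(3) h(2) Delta_pos by (simp add: min_absorb2)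
    from hyp_ge[OF main this] show ?thesis using Delta_pos by simp
  qed
  have "asy (en y \<sigma>) (en h (\<sigma> = \<tau>))" for \<sigma>
    by (rule asyI[OF key]) (use Delta_pos in \<open>intro filterlim_mult_real, simp\<close>)
  then show ?thesis by blast
qed

lemma stab_eq_of_ends:
  assumes "\<forall>\<sigma>. asy (en y \<sigma>) (en h (\<sigma> = \<tau>))"
  shows "stab y \<rho> = stab h \<rho>"
proof -
  have e: "((\<sigma> = \<tau>) = \<rho>) = ((\<sigma> = \<rho>) = \<tau>)" "((\<sigma> = \<tau>) = \<tau>) = \<sigma>" for \<sigma>
    by (cases \<sigma>; cases \<tau>; cases \<rho>; simp)+
  have 1: "asy (en y \<sigma>) (en h (\<sigma> = \<tau>))" "asy (en h \<sigma>) (en y (\<sigma> = \<tau>))" for \<sigma>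
    using assms asy_sym[OF assms[rule_format, of "\<sigma> = \<tau>"]] unfolding e by auto
  have sub: "stab h' \<rho> \<subseteq> stab y' \<rho>"
    if a: "\<And>\<sigma>. asy (en y' \<sigma>) (en h' (\<sigma> = \<tau>))" "\<And>\<sigma>. asy (en h' \<sigma>) (en y' (\<sigma> = \<tau>))" for h' y'
  proof
    fix g assume g: "g \<in> stab h' \<rho>"
    have gc: "g \<in> carrier G" by (rule stab_carrier[OF g])
    have "asy (\<lambda>k. \<phi> g (en y' \<sigma> k)) (en y' (\<sigma> = \<rho>))" for \<sigma>
    proof -
      have 2: "asy (\<lambda>k. \<phi> g (en y' \<sigma> k)) (\<lambda>k. \<phi> g (en h' (\<sigma> = \<tau>) k))" by (rule asy_act[OF a(1) gc])
      have 3: "asy (\<lambda>k. \<phi> g (en h' (\<sigma> = \<tau>) k)) (en h' ((\<sigma> = \<rho>) = \<tau>))"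
        using stab_asy[OF g, of "\<sigma> = \<tau>"] unfolding e(1) .
      show ?thesis by (rule asy_trans[OF asy_trans[OF 2 3] asy_sym[OF a(1)]])
    qed
    then show "g \<in> stab y' \<rho>" using gc by (simp add: stab_def)
  qed
  show ?thesis using sub[of y h] sub[of h y] 1 by blast
qed

text \<open>An isometry that fixes both ends and moves the base point far is a translation. If y^-1
  x0 lay towards the same end as y x0, it would lie between the base point and that end; applying
  \<open>y\<close>, which fixes the end, would put y x0 on the other side.\<close>

lemma stab_lox:
  assumes h: "lox c h" "c \<le> 400 * \<Delta>" and y: "y \<in> stab h True" "10000 * \<Delta> \<le> ell y"
  shows "lox (c + 18 * \<Delta>) y"
proof -
  note yc = stab_carrier[OF y(1)]
  have yi: "inv y \<in> stab h True" by (rule stab_inv[OF y(1)])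
  have ev: "\<forall>\<^sub>F k in sequentially. gp (\<phi> y (en h \<sigma> k)) (pt y) x0 \<le> 2 * c + 21 * \<Delta> \<longrightarrow>
      gp (en h \<sigma> k) (pt y) x0 \<le> gp (\<phi> y (en h \<sigma> k)) (pt y) x0 + 3 * \<Delta>" for \<sigma>
    using end_change1[OF stab_asy[OF y(1), of \<sigma>], of "pt y" x0 "2 * c + 21 * \<Delta>"] by simp
  obtain k where kT: "gp (\<phi> y (en h True k)) (pt y) x0 \<le> 2 * c + 21 * \<Delta> \<longrightarrow>
      gp (en h True k) (pt y) x0 \<le> gp (\<phi> y (en h True k)) (pt y) x0 + 3 * \<Delta>"
    and kF: "gp (\<phi> y (en h False k)) (pt y) x0 \<le> 2 * c + 21 * \<Delta> \<longrightarrow>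
      gp (en h False k) (pt y) x0 \<le> gp (\<phi> y (en h False k)) (pt y) x0 + 3 * \<Delta>"
    and n1: "gp (en h False k) (en h True k) (pt y) \<le> c + 12 * \<Delta>"
    and n2: "gp (en h False k) (en h True k) (pt (inv y)) \<le> c + 12 * \<Delta>"
    using eventually_happens'[OF sequentially_bot eventually_conj[OF eventually_conj[OF ev[of True] ev[of False]]
      eventually_conj[OF orbit_near[OF h(1) y(1), of True] orbit_near[OF h(1) yi, of True]]]]
    unfolding not_True_eq_False by blast
  have k: "gp (en h \<sigma> k) (pt y) x0 \<le> gp (\<phi> y (en h \<sigma> k)) (pt y) x0 + 3 * \<Delta>"
    if "gp (\<phi> y (en h \<sigma> k)) (pt y) x0 \<le> 2 * c + 21 * \<Delta>" for \<sigma>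
    using that kT kF by (cases \<sigma>) simp_all
  have s1: "ell y - (c + 12 * \<Delta>) \<le> gp (pt y) (en h (\<not> \<sigma>) k) x0 + gp (pt y) (en h \<sigma> k) x0"
    and s2: "ell y - (c + 12 * \<Delta>) \<le> gp (pt (inv y)) (en h (\<not> \<sigma>) k) x0 + gp (pt (inv y)) (en h \<sigma> k) x0" for \<sigma>
    using gp_ends_sum[OF n1] gp_ends_sum[OF n2] yc by (cases \<sigma>; simp add: ell_inv)+
  have opp: "gp (en h (\<not> \<sigma>) k) (en h \<sigma> k) x0 \<le> c + 6 * \<Delta>" for \<sigma> by (rule en_opposite[OF h(1)])
  obtain \<sigma> where \<sigma>: "4000 * \<Delta> \<le> gp (pt y) (en h \<sigma> k) x0"
  proof (cases "4000 * \<Delta> \<le> gp (pt y) (en h True k) x0")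
    case False
    then show ?thesis using s1[of True] that[of False] h y Delta_pos by simp
  qed
  have "gp (pt (inv y)) (pt y) x0 \<le> c + 18 * \<Delta>"
  proof (cases "4000 * \<Delta> \<le> gp (pt (inv y)) (en h (\<not> \<sigma>) k) x0")
    case True
    then have "gp (pt (inv y)) (en h \<sigma> k) x0 \<le> c + 6 * \<Delta> + 3 * \<Delta>"
      using opp[of \<sigma>] h Delta_pos by (intro hyp_cut[of "en h (\<not> \<sigma>) k"]) (simp_all add: gp_commute)
    then have "gp (pt y) (pt (inv y)) x0 \<le> c + 9 * \<Delta> + 3 * \<Delta>"
      using \<sigma> h Delta_pos by (intro hyp_cut[of "en h \<sigma> k"]) (simp_all add: gp_commute)
    then show ?thesis using Delta_pos by (simp add: gp_commute)
  next
    case False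
    then have "c + 9 * \<Delta> < gp (pt (inv y)) (en h \<sigma> k) x0" using s2[of \<sigma>] y h Delta_pos by simp
    then have "gp (pt (inv y)) (en h (\<not> \<sigma>) k) x0 \<le> c + 6 * \<Delta> + 3 * \<Delta>"
      using opp[of \<sigma>] by (intro hyp_cut[of "en h \<sigma> k"]) (simp_all add: gp_commute)
    then have "gp x0 (en h \<sigma> k) (pt (inv y)) \<le> 2 * c + 21 * \<Delta>"
      using s2[of \<sigma>] gp_add[of "pt (inv y)" "en h \<sigma> k" x0] ell_inv[OF yc] by (simp add: dist_commute)
    moreover have "gp (\<phi> y (en h \<sigma> k)) (pt y) x0 = gp x0 (en h \<sigma> k) (pt (inv y))"
      using act_gp[OF yc, of "en h \<sigma> k" x0 "pt (inv y)"] yc by (simp add: gp_commute)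
    ultimately have "gp (en h \<sigma> k) (pt y) x0 \<le> 2 * c + 24 * \<Delta>" using k[of \<sigma>] by simp
    then show ?thesis using \<sigma> h Delta_pos by (simp add: gp_commute)
  qed
  then show ?thesis using yc y h Delta_pos unfolding lox_def by auto
qed

text \<open>By \<open>axis_cobounded\<close>, dividing by a power of \<open>h\<close> brings an
  end-fixing element into a ball, which is finite by \<open>stab_ball_card\<close>. End-exchanging
  elements are reduced to this by one of their number.\<close>

lemma stab_finite_index:
  assumes h: "lox c h" "c \<le> 500 * \<Delta>"
  shows "\<exists>\<Phi>. finite \<Phi> \<and> \<Phi> \<subseteq> carrier G \<and>
    (\<forall>g \<tau>. g \<in> stab h \<tau> \<longrightarrow> (\<exists>(i::int) e. e \<in> \<Phi> \<and> g = h [^] i \<otimes> e))"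
proof -
  have hc: "h \<in> carrier G" by (rule lox_carrier[OF h(1)])
  define D where "D = ell h + 4 * (c + 12 * \<Delta>) + 6 * \<Delta>"
  have D0: "0 \<le> D" using lox_nonneg[OF h(1)] Delta_pos by (simp add: D_def)
  define \<Phi>0 where "\<Phi>0 = {e \<in> stab h True. ell e \<le> D}"
  have f0: "finite \<Phi>0" "\<Phi>0 \<subseteq> carrier G"
    using stab_ball_card[OF h D0] stab_carrier by (auto simp: \<Phi>0_def)
  have cov: "\<exists>(i::int) e. e \<in> \<Phi>0 \<and> g = h [^] i \<otimes> e" if g: "g \<in> stab h True" for g
  proof -
    note gc = stab_carrier[OF g]
    obtain k where "gp (en h False k) (en h True k) (pt g) \<le> c + 12 * \<Delta>"
      using eventually_happens'[OF sequentially_bot, OF orbit_near[OF h(1) g, of True]] by auto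
    then obtain j :: int where j: "dist (pt g) (pt (h [^] j)) \<le> D"
      using axis_cobounded[OF h(1)] Delta_pos unfolding D_def by fastforce
    let ?e = "inv (h [^] j) \<otimes> g"
    have "?e \<in> stab h (True = True)" by (rule stab_mult[OF stab_inv[OF stab_pow[OF h(1)]] g])
    moreover have "ell ?e \<le> D" using j gc hc by (simp add: dist_pt[symmetric] dist_commute)
    moreover have "g = h [^] j \<otimes> ?e" using gc hc by (simp add: m_assoc[symmetric])
    ultimately show ?thesis unfolding \<Phi>0_def by (intro exI[of _ j] exI[of _ ?e]) simp
  qed
  show ?thesis
  proof (cases "stab h False = {}")
    case True
    then show ?thesis using f0 cov by (intro exI[of _ \<Phi>0]) (metis (full_types) empty_iff)
  next
    case False
    then obtain g1 where g1: "g1 \<in> stab h False" by auto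
    note g1c = stab_carrier[OF g1]
    have "\<exists>(i::int) e. e \<in> \<Phi>0 \<union> (\<lambda>e. e \<otimes> g1) ` \<Phi>0 \<and> g = h [^] i \<otimes> e" if g: "g \<in> stab h \<tau>" for g \<tau>
    proof (cases \<tau>)
      case True
      then have "g \<in> stab h True" using g by simp
      from cov[OF this] obtain i :: int and e where "e \<in> \<Phi>0" "g = h [^] i \<otimes> e" by auto
      then show ?thesis by (intro exI[of _ i] exI[of _ e]) simp
    next
      case False
      note gc = stab_carrier[OF g]
      have "g \<otimes> inv g1 \<in> stab h (\<tau> = False)" by (rule stab_mult[OF g stab_inv[OF g1]])
      then have "g \<otimes> inv g1 \<in> stab h True" using False by simp
      from cov[OF this] obtain i :: int and e where e: "e \<in> \<Phi>0" "g \<otimes> inv g1 = h [^] i \<otimes> e" by auto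
      have "g = g \<otimes> inv g1 \<otimes> g1" using gc g1c by (simp add: m_assoc)
      also have "\<dots> = h [^] i \<otimes> (e \<otimes> g1)" using e f0 hc g1c by (auto simp: m_assoc)
      finally show ?thesis using e(1) by (intro exI[of _ i] exI[of _ "e \<otimes> g1"]) simp
    qed
    moreover have "finite (\<Phi>0 \<union> (\<lambda>e. e \<otimes> g1) ` \<Phi>0)" "\<Phi>0 \<union> (\<lambda>e. e \<otimes> g1) ` \<Phi>0 \<subseteq> carrier G"
      using f0 g1c by auto
    ultimately show ?thesis by (intro exI[of _ "\<Phi>0 \<union> (\<lambda>e. e \<otimes> g1) ` \<Phi>0"]) simp
  qed
qed

text \<open>The witness is the subgroup of powers of \<open>h\<close>: these are distinct because
  they move the base point at a linear rate, and the index is finite by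
  \<open>stab_finite_index\<close>.\<close>

lemma virtually_Z_of_stab:
  assumes h: "lox c h" "c \<le> 500 * \<Delta>" and U: "U \<subseteq> stab h True \<union> stab h False" and hU: "h \<in> generate G U"
  shows "virtually_Z G (generate G U)"
proof -
  have hc: "h \<in> carrier G" by (rule lox_carrier[OF h(1)])
  have Uc: "U \<subseteq> carrier G" using U stab_carrier by blast
  let ?H = "generate G U"
  have sH: "subgroup ?H G" by (rule generate_is_subgroup[OF Uc])
  have H: "?H \<subseteq> stab h True \<union> stab h False"
  proof
    fix g assume "g \<in> ?H"
    then have "\<exists>\<tau>. g \<in> stab h \<tau>"
    proof induction
      case one
      then show ?case using stab_pow[OF h(1), of 0] by auto
    next
      case (incl g)
      then show ?case using U by blast
    next
      case (inv g)
      then show ?case using U stab_inv by blast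
    next
      case (eng g g')
      then show ?case using stab_mult by blast
    qed
    then obtain \<tau> where "g \<in> stab h \<tau>" by auto
    then show "g \<in> stab h True \<union> stab h False" by (cases \<tau>) auto
  qed
  define K where "K = range (\<lambda>i::int. h [^] i)"
  have Kgen: "K = generate G {h}" unfolding K_def using generate_pow[OF hc] by auto
  have sK: "subgroup K G" unfolding Kgen using hc by (intro generate_is_subgroup) simp
  have KH: "K \<subseteq> ?H"
    unfolding Kgen using generate_subgroup_incl[OF _ sH, of "{h}"] hU by simp
  have fin: "finite (rcosets\<^bsub>G\<lparr>carrier := ?H\<rparr>\<^esub> K)"
  proof -
    obtain \<Phi> where \<Phi>: "finite \<Phi>" "\<Phi> \<subseteq> carrier G"
      "\<And>g \<tau>. g \<in> stab h \<tau> \<Longrightarrow> \<exists>(i::int) e. e \<in> \<Phi> \<and> g = h [^] i \<otimes> e"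
      using stab_finite_index[OF h] by blast
    have "rcosets\<^bsub>G\<lparr>carrier := ?H\<rparr>\<^esub> K \<subseteq> (\<lambda>e. K #> e) ` \<Phi>"
    proof
      fix X assume "X \<in> rcosets\<^bsub>G\<lparr>carrier := ?H\<rparr>\<^esub> K"
      then obtain g where g: "g \<in> ?H" "X = K #> g" by (auto simp: RCOSETS_def r_coset_def)
      then obtain i :: int and e where e: "e \<in> \<Phi>" "g = h [^] i \<otimes> e" using \<Phi>(3) H by blast
      have "K #> g = K #> (h [^] i) #> e"
        using e \<Phi>(2) hc subgroup.subset[OF sK] by (subst e(2), subst coset_mult_assoc) auto
      also have "K #> (h [^] i) = K"
        using hc sK by (intro coset_join2) (auto simp: K_def)
      finally show "X \<in> (\<lambda>e. K #> e) ` \<Phi>" using e g by auto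
    qed
    then show ?thesis using \<Phi>(1) finite_subset by blast
  qed
  have inj: "i = j" if e: "h [^] i = h [^] j" for i j :: int
  proof -
    have "i' = j'" if "i' \<le> j'" "h [^] i' = h [^] j'" for i' j' :: int
    proof -
      have "14 * \<Delta> * real_of_int (j' - i') \<le> 0" using lox_axis(2)[OF h(1) that(1)] that(2) by simp
      then have "real_of_int (j' - i') \<le> 0" using Delta_pos by (simp add: mult_le_0_iff)
      then show ?thesis using that(1) by simp
    qed
    then show ?thesis using e by (metis linear)
  qed
  have "(\<lambda>i. h [^] i) \<in> iso integer_group (G\<lparr>carrier := K\<rparr>)"
    using hc inj by (auto simp: iso_def hom_def bij_betw_def inj_on_def K_def integer_group_def int_pow_mult)
  then have "integer_group \<cong> G\<lparr>carrier := K\<rparr>" by (auto simp: is_iso_def)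
  then have "G\<lparr>carrier := K\<rparr> \<cong> integer_group"
    using group.iso_sym group_integer_group by blast
  then show ?thesis unfolding virtually_Z_def using sK KH fin by blast
qed

end

section \<open>Counting by fibres and windows; product sets\<close>

lemma card_le_fibers:
  assumes A: "finite A" and M: "\<And>y. y \<in> f ` A \<Longrightarrow> real (card {x \<in> A. f x = y}) \<le> M"
  shows "real (card A) \<le> M * real (card (f ` A))"
proof -
  have "real (card A) = (\<Sum>y\<in>f ` A. \<Sum>x\<in>{x \<in> A. f x = y}. 1)"
    using sum.image_gen[OF A, of "\<lambda>_. 1::real" f] by simp
  also have "\<dots> \<le> (\<Sum>y\<in>f ` A. M)" using M by (intro sum_mono) simp
  finally show ?thesis by (simp add: mult.commute)
qed

lemma card_le_windows:
  fixes f :: "'b \<Rightarrow> real"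
  assumes S: "finite S" and pos: "\<And>g. g \<in> S \<Longrightarrow> a \<le> f g \<and> f g \<le> a + H" and w: "0 < w" and H: "0 \<le> H"
    and M: "\<And>g. g \<in> S \<Longrightarrow> real (card {h \<in> S. \<bar>f h - f g\<bar> \<le> w}) \<le> M" and M0: "0 \<le> M"
  shows "real (card S) \<le> M * (H / w + 1)"
proof -
  define n where "n g = nat \<lfloor>(f g - a) / w\<rfloor>" for g
  define L where "L = nat \<lfloor>H / w\<rfloor>"
  have nL: "n g \<in> {..L}" if "g \<in> S" for g
  proof -
    have "(f g - a) / w \<le> H / w" using pos[OF that] w by (intro divide_right_mono) auto
    then show ?thesis unfolding n_def L_def by (auto intro!: nat_mono floor_mono)
  qed
  have fib: "real (card {g \<in> S. n g = i}) \<le> M" for i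
  proof (cases "{g \<in> S. n g = i} = {}")
    case True
    then show ?thesis unfolding True using M0 by simp
  next
    case False
    then obtain g where g: "g \<in> S" "n g = i" by auto
    have "{h \<in> S. n h = i} \<subseteq> {h \<in> S. \<bar>f h - f g\<bar> \<le> w}"
    proof
      fix h assume "h \<in> {h \<in> S. n h = i}"
      then have h: "h \<in> S" "n h = i" by auto
      have nn: "0 \<le> (f l - a) / w" if "l \<in> S" for l using pos[OF that] w by simp
      have "\<lfloor>(f g - a) / w\<rfloor> = \<lfloor>(f h - a) / w\<rfloor>"
        using g(2) h(2) nn[OF g(1)] nn[OF h(1)] unfolding n_def by (metis int_nat_eq zero_le_floor)
      then have "\<bar>(f h - a) / w - (f g - a) / w\<bar> < 1" by linarith
      then have "\<bar>(f h - f g) / w\<bar> < 1" by (simp add: diff_divide_distrib)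
      then show "h \<in> {h \<in> S. \<bar>f h - f g\<bar> \<le> w}" using w h by (simp add: abs_divide)
    qed
    then have "card {h \<in> S. n h = i} \<le> card {h \<in> S. \<bar>f h - f g\<bar> \<le> w}" using S by (intro card_mono) auto
    then show ?thesis using M[OF g(1)] by linarith
  qed
  have "S = (\<Union>i\<in>{..L}. {g \<in> S. n g = i})" using nL by auto
  then have "card S \<le> (\<Sum>i\<in>{..L}. card {g \<in> S. n g = i})" by (metis card_UN_le finite_atMost)
  then have "real (card S) \<le> (\<Sum>i\<in>{..L}. real (card {g \<in> S. n g = i}))" by (simp only: of_nat_le_iff flip: of_nat_sum)
  also have "\<dots> \<le> (\<Sum>i\<in>{..L}. M)" using fib by (intro sum_mono)
  also have "\<dots> = M * (real L + 1)" by (simp add: algebra_simps)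
  also have "\<dots> \<le> M * (H / w + 1)" using M0 H w unfolding L_def by (intro mult_left_mono add_right_mono) auto
  finally show ?thesis .
qed

context group
begin

lemma set_pow_mult: "u \<in> U \<Longrightarrow> w \<in> set_pow G U n \<Longrightarrow> u \<otimes> w \<in> set_pow G U (Suc n)"
proof -
  assume u: "u \<in> U" and "w \<in> set_pow G U n"
  then obtain us where "w = foldr (\<otimes>) us \<one>" "length us = n" "set us \<subseteq> U" by (auto simp: set_pow_def)
  then show "u \<otimes> w \<in> set_pow G U (Suc n)"
    using u unfolding set_pow_def by (intro CollectI exI[of _ "u # us"]) auto
qed

lemma set_pow_mult2:
  "u \<in> U \<Longrightarrow> v \<in> U \<Longrightarrow> w \<in> set_pow G U n \<Longrightarrow> u \<otimes> (v \<otimes> w) \<in> set_pow G U (Suc (Suc n))"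
  by (intro set_pow_mult)

lemma set_pow_one: "U \<subseteq> carrier G \<Longrightarrow> U \<subseteq> set_pow G U (Suc 0)"
proof
  fix u assume "U \<subseteq> carrier G" "u \<in> U"
  moreover have "\<one> \<in> set_pow G U 0" by (auto simp: set_pow_def)
  ultimately show "u \<in> set_pow G U (Suc 0)" using set_pow_mult[of u U \<one> 0] by auto
qed

lemma set_pow_finite: "finite U \<Longrightarrow> finite (set_pow G U n)"
proof -
  assume "finite U"
  then have "finite {us. set us \<subseteq> U \<and> length us = n}" by (rule finite_lists_length_eq)
  moreover have "set_pow G U n \<subseteq> (\<lambda>us. foldr (\<otimes>) us \<one>) ` {us. set us \<subseteq> U \<and> length us = n}"
    by (auto simp: set_pow_def)
  ultimately show ?thesis using finite_surj by blast
qed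

lemma set_pow_carrier: "U \<subseteq> carrier G \<Longrightarrow> set_pow G U n \<subseteq> carrier G"
proof
  fix w assume U: "U \<subseteq> carrier G" and "w \<in> set_pow G U n"
  then obtain us where us: "w = foldr (\<otimes>) us \<one>" "set us \<subseteq> U" by (auto simp: set_pow_def)
  have "set us \<subseteq> U \<Longrightarrow> foldr (\<otimes>) us \<one> \<in> carrier G" using U by (induction us) auto
  then show "w \<in> carrier G" using us by simp
qed

text \<open>For fixed \<open>v\<close>, a product \<open>f v w\<close> and its first factor \<open>f\<close> determine \<open>w\<close>.\<close>
lemma card_product_ge:
  assumes fin: "finite F" "finite X" and c: "F \<subseteq> carrier G" "X \<subseteq> carrier G" "v \<in> carrier G"
    and M: "\<And>f0 w0. f0 \<in> F \<Longrightarrow> w0 \<in> X \<Longrightarrow>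
      real (card {f \<in> F. \<exists>w\<in>X. f \<otimes> (v \<otimes> w) = f0 \<otimes> (v \<otimes> w0)}) \<le> M"
  shows "real (card F) * real (card X) \<le> M * real (card ((\<lambda>(f, w). f \<otimes> (v \<otimes> w)) ` (F \<times> X)))"
proof -
  let ?m = "\<lambda>(f, w). f \<otimes> (v \<otimes> w)"
  let ?Y = "?m ` (F \<times> X)"
  have fib: "real (card {p \<in> F \<times> X. ?m p = g}) \<le> M" if g: "g \<in> ?Y" for g
  proof -
    obtain f0 w0 where 0: "f0 \<in> F" "w0 \<in> X" "g = f0 \<otimes> (v \<otimes> w0)" using g by auto
    have "inj_on fst {p \<in> F \<times> X. ?m p = g}"
    proof (rule inj_onI)
      fix p q assume p: "p \<in> {p \<in> F \<times> X. ?m p = g}" and q: "q \<in> {p \<in> F \<times> X. ?m p = g}" and e: "fst p = fst q"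
      obtain f w w' where pq: "p = (f, w)" "q = (f, w')" using e by (metis prod.collapse)
      have "f \<otimes> (v \<otimes> w) = f \<otimes> (v \<otimes> w')" "f \<in> carrier G" "w \<in> carrier G" "w' \<in> carrier G"
        using p q pq c by auto
      then show "p = q" using pq c(3) by (metis Units_eq Units_l_cancel m_closed)
    qed
    then have "card {p \<in> F \<times> X. ?m p = g} = card (fst ` {p \<in> F \<times> X. ?m p = g})" by (simp add: card_image)
    also have "fst ` {p \<in> F \<times> X. ?m p = g} = {f \<in> F. \<exists>w\<in>X. f \<otimes> (v \<otimes> w) = f0 \<otimes> (v \<otimes> w0)}"
      unfolding 0(3) by force
    finally show ?thesis using M[OF 0(1,2)] by simp
  qed
  have "real (card (F \<times> X)) \<le> M * real (card ?Y)"
    by (rule card_le_fibers[OF finite_cartesian_product[OF fin]]) (rule fib)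
  then show ?thesis by (simp add: card_cartesian_product)
qed

end

context hyp_action
begin

subsection \<open>Growth of a large subset of a coset of the stabiliser of an axis\<close>

text \<open>There are four combinations of signs, and a disjunction that holds infinitely often has
  a disjunct that does.\<close>

lemma overlap_stab_unordered:
  assumes h: "lox c h" "c \<le> 500 * \<Delta>" and C: "C \<le> 1600 * \<Delta>" and g: "g \<in> carrier G"
    and ev: "\<forall>\<^sub>F k in sequentially. (\<exists>\<sigma>. ord h \<sigma> C k p q) \<and> (\<exists>\<tau>. ord h \<tau> C k (\<phi> g p) (\<phi> g q))"
    and len: "real N * ell h + \<kappa> + 10000 * \<Delta> \<le> dist p q"
  shows "g \<in> stab h True \<union> stab h False"
proof -
  have "\<exists>\<^sub>F k in sequentially. (\<exists>\<sigma>. ord h \<sigma> C k p q) \<and> (\<exists>\<tau>. ord h \<tau> C k (\<phi> g p) (\<phi> g q))"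
    by (rule eventually_frequently[OF sequentially_bot ev])
  then have "\<exists>\<^sub>F k in sequentially.
     (ord h True C k p q \<and> ord h True C k (\<phi> g p) (\<phi> g q) \<or> ord h True C k p q \<and> ord h False C k (\<phi> g p) (\<phi> g q)) \<or>
     (ord h False C k p q \<and> ord h True C k (\<phi> g p) (\<phi> g q) \<or> ord h False C k p q \<and> ord h False C k (\<phi> g p) (\<phi> g q))"
    by (rule frequently_elim1) (metis (full_types))
  then obtain \<sigma> \<tau> where "\<exists>\<^sub>F k in sequentially. ord h \<sigma> C k p q \<and> ord h \<tau> C k (\<phi> g p) (\<phi> g q)"
    unfolding frequently_disj_iff by blast
  from overlap_stab[OF h(1,2) C g this len] show ?thesis by (cases "\<sigma> = \<tau>") auto
qed

lemma stab_small_card: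
  assumes h: "lox c h" "c \<le> 500 * \<Delta>"
  shows "finite {e \<in> stab h True. ell e \<le> 10000 * \<kappa>}"
    "real (card {e \<in> stab h True. ell e \<le> 10000 * \<kappa>}) \<le> real N * (502 * \<kappa> / \<Delta>)"
proof -
  have k0: "0 \<le> 10000 * \<kappa>" using kappa Delta_pos by simp
  note b = stab_ball_card[OF h k0]
  show "finite {e \<in> stab h True. ell e \<le> 10000 * \<kappa>}" using b by simp
  have "(2 * (10000 * \<kappa>) + 12 * \<Delta>) / (40 * \<Delta>) + 1 \<le> 502 * \<kappa> / \<Delta>"
    using kappa Delta_pos by (simp add: field_simps)
  then have "real N * ((2 * (10000 * \<kappa>) + 12 * \<Delta>) / (40 * \<Delta>) + 1) \<le> real N * (502 * \<kappa> / \<Delta>)"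
    by (intro mult_left_mono) auto
  then show "real (card {e \<in> stab h True. ell e \<le> 10000 * \<kappa>}) \<le> real N * (502 * \<kappa> / \<Delta>)" using b by linarith
qed

lemma axis_segment_near:
  assumes h: "lox c h" and e: "gp (en h False k) (en h True k) (pt e) \<le> c + 12 * \<Delta>"
    and o: "ord h \<sigma> C k x0 (pt e)" and y: "gp x0 (pt e) y = 0"
  shows "gp (en h False k) (en h True k) y \<le> C + c + 15 * \<Delta>"
proof -
  have yy: "gp x0 (pt e) (pt e) \<le> 0" "gp x0 (pt e) y \<le> 0" by (simp_all add: y)
  have yd: "dist x0 y \<le> dist x0 (pt e)"
    using y two_gp[of x0 "pt e" y] zero_le_dist[of "pt e" y] by linarith
  have "ord h \<sigma> (C + 3 * 0 + 3 * \<Delta>) k y (pt e)" by (rule ord_between[OF o yy(2,1) yd])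
  then have 1: "gp (en h (\<not> \<sigma>) k) (pt e) y \<le> C + 3 * \<Delta>" by (simp add: ord_def)
  have "gp (en h (\<not> \<sigma>) k) (en h \<sigma> k) (pt e) \<le> c + 12 * \<Delta>"
    using e by (cases \<sigma>) (simp_all add: gp_commute)
  then have "gp (en h (\<not> \<sigma>) k) (en h \<sigma> k) y \<le> C + c + 15 * \<Delta>"
    using 1 two_gp[of "en h (\<not> \<sigma>) k" "pt e" y] two_gp[of "en h (\<not> \<sigma>) k" "en h \<sigma> k" "pt e"]
      two_gp[of "en h (\<not> \<sigma>) k" "en h \<sigma> k" y] dist_triangle[of "en h \<sigma> k" y "pt e"]
      dist_commute[of y "pt e"] by linarith
  then show ?thesis by (cases \<sigma>) (simp_all add: gp_commute)
qed

lemma geodesic_to: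
  assumes "0 \<le> t" "t \<le> dist x0 z"
  obtains y where "dist x0 y = t" "gp x0 z y = 0" "gp y z x0 = t"
proof -
  obtain y where "dist x0 y = t" "dist y z = dist x0 z - t" using geod[OF assms] by auto
  then show ?thesis using that[of y] by (simp add: gp_def dist_commute)
qed

text \<open>If [x0, w x0] followed the axis for much more than a period, it would pass close enough
  to some h^j x0 to make that point nearer to w x0 than the base point is, against
  \<open>min\<close>.\<close>

lemma gp_orbit_bound:
  assumes h: "lox c h" "c \<le> 400 * \<Delta>" and s: "10000 * \<kappa> \<le> ell h" and w: "w \<in> carrier G"
    and min: "\<And>j::int. ell w - \<Delta> \<le> dist (pt (h [^] j)) (pt w)" and e: "e \<in> stab h True"
  shows "gp (pt w) (pt e) x0 \<le> 2 * ell h"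
proof -
  let ?r = "gp (pt w) (pt e) x0"
  have c0: "0 \<le> c" by (rule lox_nonneg[OF h(1)])
  obtain y where y: "dist x0 y = ?r" "gp x0 (pt e) y = 0" "gp y (pt e) x0 = ?r"
    using geodesic_to[of ?r "pt e"] gp_nonneg gp_le_dist(2)[of "pt w" "pt e" x0] by (metis dist_commute)
  have "?r - 3 * \<Delta> \<le> gp y (pt w) x0"
    by (rule hyp_ge[of _ _ "pt e"]) (use y in \<open>simp_all add: gp_commute\<close>)
  then have yw: "dist y (pt w) \<le> ell w - ?r + 6 * \<Delta>"
    using two_gp[of y "pt w" x0] y(1) dist_commute[of y x0] dist_commute[of "pt w" x0] by linarith
  obtain k where "gp (en h False k) (en h True k) (pt e) \<le> c + 12 * \<Delta>"
    and "ord h True (2 * c + 27 * \<Delta>) k x0 (pt e) \<or> ord h False (2 * c + 27 * \<Delta>) k x0 (pt e)"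
    using eventually_happens'[OF sequentially_bot eventually_conj[OF orbit_near[OF h(1) e, of True] ord_orbit[OF h(1) e]]]
    unfolding not_True_eq_False by blast
  then have "gp (en h False k) (en h True k) y \<le> 2 * c + 27 * \<Delta> + c + 15 * \<Delta>"
    using axis_segment_near[OF h(1) _ _ y(2)] by blast
  then obtain j :: int where j: "dist y (pt (h [^] j)) \<le> ell h + 4 * (2 * c + 27 * \<Delta> + c + 15 * \<Delta>) + 6 * \<Delta>"
    using axis_cobounded[OF h(1)] c0 Delta_pos by fastforce
  have "ell w - \<Delta> \<le> dist y (pt (h [^] j)) + dist y (pt w)"
    using min[of j] dist_triangle[of "pt (h [^] j)" "pt w" y] by (simp add: dist_commute)
  then have "?r \<le> ell h + 4 * (2 * c + 27 * \<Delta> + c + 15 * \<Delta>) + 13 * \<Delta>" using j yw by linarith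
  also have "\<dots> \<le> 2 * ell h" using h(2) s kappa Delta_pos by simp
  finally show ?thesis .
qed

end

text \<open>Overlaps of axes are only bounded by multiples of \<open>ell h\<close>, which may be
  huge compared with \<kappa>. Near-minimality of \<open>h\<close> repairs this: an element of the
  stabiliser shorter than half of \<open>ell h\<close> is already shorter than 10000 \<kappa>, so
  balls of radius a multiple of \<open>ell h\<close> contain boundedly many elements.\<close>

locale minimal_axis = hyp_action +
  fixes c :: real and h
  assumes h: "lox c h" "c \<le> 400 * \<Delta>" and s: "10000 * \<kappa> \<le> ell h"
    and h_min: "\<And>y. y \<in> stab h True \<Longrightarrow> 10000 * \<kappa> \<le> ell y \<Longrightarrow> ell h \<le> 2 * ell y"
begin

lemma hc [simp]: "h \<in> carrier G"
  by (rule lox_carrier[OF h(1)])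

lemma ell_pos: "0 < ell h"
  using s kappa Delta_pos by linarith

text \<open>Two elements in one window of width \<open>ell h / 4\<close> along the axis differ by an
  element shorter than \<open>ell h / 2\<close>, hence by one of the few shorter than 10000
  \<kappa>.\<close>

lemma stab_card:
  assumes D: "0 \<le> D"
  shows "finite {e \<in> stab h True. ell e \<le> D}"
    "real (card {e \<in> stab h True. ell e \<le> D}) \<le> real N * (502 * \<kappa> / \<Delta>) * (8 * D / ell h + 1)"
proof -
  let ?S = "{e \<in> stab h True. ell e \<le> D}"
  have c5: "c \<le> 500 * \<Delta>" using h Delta_pos by simp
  show fin: "finite ?S" using stab_ball_card[OF h(1) c5 D] by simp
  obtain k where k: "\<And>e. e \<in> ?S \<Longrightarrow> gp (en h False k) (en h True k) (pt e) \<le> c + 12 * \<Delta>"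
    using eventually_happens'[OF sequentially_bot eventually_ball_finite[OF fin, of "\<lambda>k e. gp (en h False k) (en h True k) (pt e) \<le> c + 12 * \<Delta>"]]
      orbit_near[OF h(1), of _ True True] by auto
  define f where "f e = dist (en h False k) (pt e)" for e
  have "real (card ?S) \<le> real N * (502 * \<kappa> / \<Delta>) * (2 * D / (ell h / 4) + 1)"
  proof (rule card_le_windows[OF fin, where f = f and a = "dist (en h False k) x0 - D"])
    show "dist (en h False k) x0 - D \<le> f g \<and> f g \<le> dist (en h False k) x0 - D + 2 * D" if "g \<in> ?S" for g
      using that abs_dist_diff_le[of x0 "en h False k" "pt g"] by (auto simp: f_def dist_commute)
    show "0 < ell h / 4" "0 \<le> 2 * D" using D ell_pos by auto
    show "0 \<le> real N * (502 * \<kappa> / \<Delta>)" using kappa Delta_pos by simp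
    fix g assume g: "g \<in> ?S"
    have gc: "g \<in> carrier G" using g stab_carrier by auto
    have "(\<lambda>e. inv g \<otimes> e) ` {e \<in> ?S. \<bar>f e - f g\<bar> \<le> ell h / 4} \<subseteq> {e \<in> stab h True. ell e \<le> 10000 * \<kappa>}"
    proof
      fix y assume "y \<in> (\<lambda>e. inv g \<otimes> e) ` {e \<in> ?S. \<bar>f e - f g\<bar> \<le> ell h / 4}"
      then obtain e where e: "e \<in> ?S" "\<bar>f e - f g\<bar> \<le> ell h / 4" "y = inv g \<otimes> e" by auto
      have ec: "e \<in> carrier G" using e stab_carrier by auto
      have y: "y \<in> stab h True" using stab_mult[OF stab_inv[of g h True], of e True] g e by simp
      have "dist (pt g) (pt e) \<le> ell h / 4 + 2 * (c + 12 * \<Delta>) + 6 * \<Delta>"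
        using near_dist[OF k[OF g] k[OF e(1)]] e(2) unfolding f_def by linarith
      also have "\<dots> < ell h / 2" using h s kappa Delta_pos by simp
      finally have "ell y < ell h / 2" using e(3) gc ec by (simp add: dist_pt)
      then show "y \<in> {e \<in> stab h True. ell e \<le> 10000 * \<kappa>}" using h_min[OF y] y by force
    qed
    moreover have "inj_on (\<lambda>e. inv g \<otimes> e) {e \<in> ?S. \<bar>f e - f g\<bar> \<le> ell h / 4}"
      using gc stab_carrier by (intro inj_onI) (metis (no_types, lifting) inv_closed Units_eq Units_l_cancel mem_Collect_eq)
    ultimately have "card {e \<in> ?S. \<bar>f e - f g\<bar> \<le> ell h / 4} \<le> card {e \<in> stab h True. ell e \<le> 10000 * \<kappa>}"
      using stab_small_card(1)[OF h(1) c5] by (intro card_inj_on_le)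
    then show "real (card {e \<in> ?S. \<bar>f e - f g\<bar> \<le> ell h / 4}) \<le> real N * (502 * \<kappa> / \<Delta>)"
      using stab_small_card(2)[OF h(1) c5] by linarith
  qed
  then show "real (card ?S) \<le> real N * (502 * \<kappa> / \<Delta>) * (8 * D / ell h + 1)" by (simp add: mult.commute)
qed

end

text \<open>The element \<open>v\<close> realises, up to \<open>\<Delta>\<close>, the distance between the axes of \<open>h\<close> and \<open>v h v\<^sup>-\<^sup>1\<close>.\<close>
locale transverse = minimal_axis +
  fixes v
  assumes vc [simp]: "v \<in> carrier G" and v: "v \<notin> stab h True \<union> stab h False"
    and v_min: "\<And>(i::int) (j::int). ell v - \<Delta> \<le> ell (h [^] i \<otimes> v \<otimes> h [^] j)"
begin

lemma gp_bridge:
  assumes "e \<in> stab h True"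
  shows "gp (pt v) (pt e) x0 \<le> 2 * ell h" "gp (pt (inv v)) (pt e) x0 \<le> 2 * ell h"
proof -
  show "gp (pt v) (pt e) x0 \<le> 2 * ell h"
  proof (rule gp_orbit_bound[OF h s vc _ assms])
    show "ell v - \<Delta> \<le> dist (pt (h [^] j)) (pt v)" for j :: int
      using v_min[of "- j" 0] by (simp add: dist_pt int_pow_neg)
  qed
  show "gp (pt (inv v)) (pt e) x0 \<le> 2 * ell h"
  proof (rule gp_orbit_bound[OF h s _ _ assms])
    show "ell (inv v) - \<Delta> \<le> dist (pt (h [^] j)) (pt (inv v))" for j :: int
      using v_min[of 0 j] by (simp add: dist_pt dist_commute[of "pt (h [^] j)"] ell_inv)
  qed simp
qed

text \<open>\<open>overlap_stab\<close> needs \<open>N\<close> periods; two more cover the initial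
  stretch shared with [x0, v x0] and two the terms in \<kappa> and \<Delta>.\<close>

definition D3 :: real where "D3 = (real N + 4) * ell h"

lemma D3_ge: "5 * ell h \<le> D3"
  unfolding D3_def using N1 ell_pos by (intro mult_right_mono) auto

text \<open>A longer overlap of the axis with its translate by \<open>v\<close> would contain a
  segment which v^-1 carries onto the axis again, long enough for \<open>overlap_stab\<close>; then
  \<open>v\<close> would lie in the stabiliser.\<close>

lemma gp_transverse:
  assumes e: "e \<in> stab h True" and e': "e' \<in> stab h True"
  shows "gp (pt e) (\<phi> v (pt e')) x0 \<le> D3"
proof (rule ccontr)
  let ?z = "\<phi> v (pt e')"
  define r where "r = gp (pt e) ?z x0"
  assume "\<not> gp (pt e) (\<phi> v (pt e')) x0 \<le> D3"
  then have r: "D3 < r" by (simp add: r_def)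
  have sk: "10000 * \<Delta> \<le> ell h" "\<kappa> + 10010 * \<Delta> \<le> 2 * ell h" using s kappa Delta_pos by linarith+
  have re: "r \<le> dist x0 (pt e)" "r \<le> dist x0 ?z"
    using gp_le_dist[of "pt e" ?z x0] by (simp_all add: r_def dist_commute)
  have br: "gp (pt v) ?z x0 \<le> 2 * ell h + 3 * \<Delta>"
    using hyp_cut[of "pt e" "pt v" x0 "2 * ell h" ?z] gp_bridge(1)[OF e] r D3_ge sk Delta_pos
    unfolding r_def by (simp add: gp_commute)
  \<comment> \<open>2c + 27 \<Delta> from \<open>ord_orbit\<close>, plus 3 * 15 \<Delta> + 3
    \<Delta> from \<open>ord_between\<close>.\<close>
  define C where "C = 2 * c + 75 * \<Delta>"
  \<comment> \<open>Before 2 \<open>ell h\<close> the geodesic to v e' x0 may still follow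
    [x0, v x0]; afterwards it follows the translated axis, so that v^-1 returns it to
    [x0, e' x0].\<close>
  have pts: "\<exists>y. dist x0 y = t \<and> gp x0 (pt e) y = 0 \<and> gp x0 (pt e') (\<phi> (inv v) y) \<le> 15 * \<Delta>"
    if t: "2 * ell h + 10 * \<Delta> \<le> t" "t \<le> r" for t
  proof -
    have t0: "0 \<le> t" using t sk Delta_pos by linarith
    obtain y where y: "dist x0 y = t" "gp x0 (pt e) y = 0" "gp y (pt e) x0 = t"
      using geodesic_to[of t "pt e"] t0 t re by auto
    obtain y' where y': "dist x0 y' = t" "gp x0 ?z y' = 0" "gp y' ?z x0 = t"
      using geodesic_to[of t ?z] t0 t re by auto
    have "t - 3 * \<Delta> \<le> gp y ?z x0" by (rule hyp_ge[of _ _ "pt e"]) (use y t in \<open>simp_all add: r_def\<close>)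
    then have "t - 3 * \<Delta> - 3 * \<Delta> \<le> gp y y' x0"
      by (rule hyp_ge) (use y' Delta_pos in \<open>simp add: gp_commute\<close>)
    then have d: "dist y y' \<le> 12 * \<Delta>"
      using two_gp[of y y' x0] y(1) y'(1) dist_commute[of y x0] dist_commute[of y' x0] by linarith
    have "gp (pt v) y' x0 \<le> 2 * ell h + 6 * \<Delta>"
      using hyp_cut[of ?z "pt v" x0 "2 * ell h + 3 * \<Delta>" y'] br y'(3) t Delta_pos by (simp add: gp_commute)
    then have "3 * \<Delta> < gp x0 (pt v) y'"
      using gp_add[of x0 "pt v" y'] y'(1) t Delta_pos gp_commute[of y' "pt v" x0] by linarith
    then have "gp (pt v) ?z y' \<le> 0 + 3 * \<Delta>" using y'(2) by (intro hyp_cut[of x0 ?z y' 0]) simp_all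
    then have "gp (pt v) ?z y \<le> 15 * \<Delta>" using gp_base_le[of "pt v" ?z y y'] d by linarith
    moreover have "gp x0 (pt e') (\<phi> (inv v) y) = gp (pt v) ?z y"
      using act_gp[OF vc, of x0 "pt e'" "\<phi> (inv v) y"] by simp
    ultimately show ?thesis using y by auto
  qed
  have D3r: "D3 = real N * ell h + 4 * ell h" by (simp add: D3_def algebra_simps)
  have Nl: "0 \<le> real N * ell h" by simp
  obtain y1 where y1: "dist x0 y1 = 2 * ell h + 10 * \<Delta>" "gp x0 (pt e) y1 = 0" "gp x0 (pt e') (\<phi> (inv v) y1) \<le> 15 * \<Delta>"
    using pts[of "2 * ell h + 10 * \<Delta>"] r D3r Nl sk Delta_pos by auto
  obtain y2 where y2: "dist x0 y2 = r" "gp x0 (pt e) y2 = 0" "gp x0 (pt e') (\<phi> (inv v) y2) \<le> 15 * \<Delta>"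
    using pts[of r] r D3r Nl sk Delta_pos by auto
  have ordy: "\<exists>\<sigma>. ord h \<sigma> C k z1 z2"
    if or: "ord h True (2 * c + 27 * \<Delta>) k x0 (pt f) \<or> ord h False (2 * c + 27 * \<Delta>) k x0 (pt f)"
      and z: "gp x0 (pt f) z1 \<le> 15 * \<Delta>" "gp x0 (pt f) z2 \<le> 15 * \<Delta>" for f k z1 z2
  proof -
    obtain \<sigma> where o: "ord h \<sigma> (2 * c + 27 * \<Delta>) k x0 (pt f)" using or by blast
    show ?thesis
    proof (cases "dist x0 z1 \<le> dist x0 z2")
      case True
      have "ord h \<sigma> (2 * c + 27 * \<Delta> + 3 * (15 * \<Delta>) + 3 * \<Delta>) k z1 z2" by (rule ord_between[OF o z True])
      then have "ord h \<sigma> C k z1 z2" by (simp add: C_def algebra_simps)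
      then show ?thesis ..
    next
      case False
      then have "ord h \<sigma> (2 * c + 27 * \<Delta> + 3 * (15 * \<Delta>) + 3 * \<Delta>) k z2 z1"
        by (intro ord_between[OF o z(2,1)]) simp
      then have "ord h \<sigma> C k z2 z1" by (simp add: C_def algebra_simps)
      then have "ord h (\<not> \<sigma>) C k z1 z2" by (simp add: ord_flip)
      then show ?thesis ..
    qed
  qed
  have "inv v \<in> stab h True \<union> stab h False"
  proof (rule overlap_stab_unordered[OF h(1), of C _ y1 y2])
    show "c \<le> 500 * \<Delta>" "C \<le> 1600 * \<Delta>" using h Delta_pos by (simp_all add: C_def)
    have "r - (2 * ell h + 10 * \<Delta>) \<le> dist y1 y2" using y1 y2 dist_triangle[of x0 y2 y1] by simp
    then show "real N * ell h + \<kappa> + 10000 * \<Delta> \<le> dist y1 y2" using r D3r sk by linarith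
    show "\<forall>\<^sub>F k in sequentially. (\<exists>\<sigma>. ord h \<sigma> C k y1 y2) \<and> (\<exists>\<tau>. ord h \<tau> C k (\<phi> (inv v) y1) (\<phi> (inv v) y2))"
      using eventually_conj[OF ord_orbit[OF h(1) e] ord_orbit[OF h(1) e']]
    proof eventually_elim
      case (elim k)
      then show ?case using ordy[of k e y1 y2] ordy[of k e' "\<phi> (inv v) y1" "\<phi> (inv v) y2"] y1 y2 Delta_pos by simp
    qed
  qed simp
  then show False using v stab_inv[of "inv v"] by auto
qed

text \<open>The ping-pong invariant: after \<open>v\<close>, a word leaves every direction of the
  stabiliser's orbit within a fixed distance.\<close>

definition transverse_set :: "'a set \<Rightarrow> bool" where
  "transverse_set X \<longleftrightarrow> X \<subseteq> carrier G \<and>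
    (\<forall>w\<in>X. \<forall>e\<in>stab h True. gp (pt e) (\<phi> v (pt w)) x0 \<le> D3 + 3 * \<Delta>)"

lemma transverse_stab: "F \<subseteq> stab h True \<Longrightarrow> transverse_set F"
  unfolding transverse_set_def using gp_transverse stab_carrier Delta_pos by (smt (verit) subset_iff)

lemma D3_le: "D3 + 3 * \<Delta> \<le> 6 * real N * ell h"
proof -
  have "1 * ell h \<le> real N * ell h" using N1 by (intro mult_right_mono) auto
  then have "(real N + 5) * ell h \<le> 6 * real N * ell h" by (simp add: algebra_simps)
  moreover have "D3 + 3 * \<Delta> \<le> (real N + 5) * ell h"
    using s kappa Delta_pos unfolding D3_def by (simp add: algebra_simps)
  ultimately show ?thesis by linarith
qed

text \<open>As \<open>f\<close> is long, v f v w x0 follows v f x0 beyond D3 + 3 \<Delta>, so the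
  bound D3 of \<open>gp_transverse\<close> for v f passes to the whole word at a cost of 3 \<Delta>.
  The constant therefore does not grow with the length of the word.\<close>

lemma transverse_mult:
  assumes X: "transverse_set X" and F: "F \<subseteq> stab h True" and long: "\<And>f. f \<in> F \<Longrightarrow> 20 * real N * ell h \<le> ell f"
  shows "transverse_set ((\<lambda>(f, w). f \<otimes> (v \<otimes> w)) ` (F \<times> X))"
proof -
  have NL: "1 * ell h \<le> real N * ell h" using N1 by (intro mult_right_mono) auto
  have Xc: "X \<subseteq> carrier G" using X by (simp add: transverse_set_def)
  have Fc: "F \<subseteq> carrier G" using F stab_carrier by auto
  have "gp (pt e) (\<phi> v (pt (f \<otimes> (v \<otimes> w)))) x0 \<le> D3 + 3 * \<Delta>"
    if f: "f \<in> F" and w: "w \<in> X" and e: "e \<in> stab h True" for f w e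
  proof -
    have fc [simp]: "f \<in> carrier G" and wc [simp]: "w \<in> carrier G" using f w Fc Xc by auto
    have fs: "f \<in> stab h True" "inv f \<in> stab h True" using f F stab_inv by auto
    let ?vw = "\<phi> v (pt w)"
    have IH: "gp (pt (inv f)) ?vw x0 \<le> D3 + 3 * \<Delta>" using X w fs by (simp add: transverse_set_def)
    have "gp (pt (inv f)) (pt (inv f \<otimes> inv v)) x0 = ell f - gp (pt f) (pt (inv v)) x0"
    proof -
      have "gp (pt (inv f)) (pt (inv f \<otimes> inv v)) x0 + gp x0 (pt (inv f \<otimes> inv v)) (pt (inv f)) = dist (pt (inv f)) x0"
        by (rule gp_add)
      moreover have "gp x0 (pt (inv f \<otimes> inv v)) (pt (inv f)) = gp (pt f) (pt (inv v)) x0"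
        using act_gp[of "inv f" "pt f" "pt (inv v)" x0] by (simp add: act_mult)
      ultimately show ?thesis by (simp add: dist_commute[of _ x0] ell_inv)
    qed
    then have "20 * real N * ell h - 2 * ell h \<le> gp (pt (inv f)) (pt (inv f \<otimes> inv v)) x0"
      using long[OF f] gp_bridge(2)[OF fs(1)] by (simp add: gp_commute)
    then have X1: "gp (pt (inv f \<otimes> inv v)) ?vw x0 \<le> D3 + 3 * \<Delta> + 3 * \<Delta>"
      using IH D3_le NL s kappa Delta_pos by (intro hyp_cut[of "pt (inv f)" ?vw x0 "D3 + 3 * \<Delta>" "pt (inv f \<otimes> inv v)"]) linarith+
    have "gp (\<phi> v (pt f)) (\<phi> v (pt (f \<otimes> (v \<otimes> w)))) x0 = gp (pt f) (pt (f \<otimes> (v \<otimes> w))) (pt (inv v))"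
      using act_gp[OF vc, of "pt f" "pt (f \<otimes> (v \<otimes> w))" "pt (inv v)"] by simp
    also have "\<dots> = dist (pt f) (pt (inv v)) - gp (pt (inv v)) (pt (f \<otimes> (v \<otimes> w))) (pt f)"
      using gp_add[of "pt f" "pt (f \<otimes> (v \<otimes> w))" "pt (inv v)"] by simp
    also have "gp (pt (inv v)) (pt (f \<otimes> (v \<otimes> w))) (pt f) = gp (pt (inv f \<otimes> inv v)) ?vw x0"
      using act_gp[OF fc, of "pt (inv f \<otimes> inv v)" ?vw x0] by (simp add: act_mult)
    finally have "dist (pt f) (pt (inv v)) - (D3 + 6 * \<Delta>) \<le> gp (\<phi> v (pt f)) (\<phi> v (pt (f \<otimes> (v \<otimes> w)))) x0"
      using X1 by simp
    moreover have "ell f - 4 * ell h \<le> dist (pt f) (pt (inv v))"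
      using two_gp[of "pt (inv v)" "pt f" x0] gp_bridge(2)[OF fs(1)] zero_le_dist[of "pt (inv v)" x0]
        dist_commute[of "pt (inv v)" "pt f"] dist_commute[of "pt f" x0] by linarith
    ultimately have "D3 + 3 * \<Delta> < gp (\<phi> v (pt f)) (\<phi> v (pt (f \<otimes> (v \<otimes> w)))) x0"
      using long[OF f] D3_le NL s kappa Delta_pos by linarith
    then have "gp (\<phi> v (pt (f \<otimes> (v \<otimes> w)))) (pt e) x0 \<le> D3 + 3 * \<Delta>"
      using gp_transverse[OF e fs(1)] by (intro hyp_cut[of "\<phi> v (pt f)"]) (simp_all add: gp_commute)
    then show ?thesis by (simp add: gp_commute)
  qed
  moreover have "(\<lambda>(f, w). f \<otimes> (v \<otimes> w)) ` (F \<times> X) \<subseteq> carrier G"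
    using Xc Fc vc by (auto intro!: m_closed)
  ultimately show ?thesis unfolding transverse_set_def by auto
qed

text \<open>If two first letters f, f0 occur in the same product g, then g leaves [f x0, f0 x0]
  within D3 + 3 \<Delta> of either endpoint; the two products add up to the distance between f x0
  and f0 x0, and \<open>stab_card\<close> counts the possible quotients.\<close>

lemma transverse_card:
  assumes X: "transverse_set X" "finite X" and F: "F \<subseteq> stab h True" "finite F"
  shows "real (card F) * real (card X) \<le> real N * (502 * \<kappa> / \<Delta>) * (100 * real N) *
    real (card ((\<lambda>(f, w). f \<otimes> (v \<otimes> w)) ` (F \<times> X)))"
proof (rule card_product_ge)
  have Xc: "X \<subseteq> carrier G" using X by (simp add: transverse_set_def)
  have Fc: "F \<subseteq> carrier G" using F stab_carrier by auto
  show "finite F" "finite X" "F \<subseteq> carrier G" "X \<subseteq> carrier G" "v \<in> carrier G" using X F Xc Fc by auto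
  fix f0 w0 assume 0: "f0 \<in> F" "w0 \<in> X"
  define D where "D = 12 * real N * ell h"
  have D0: "0 \<le> D" by (simp add: D_def)
  have fc0 [simp]: "f0 \<in> carrier G" "w0 \<in> carrier G" using 0 Fc Xc by auto
  have "(\<lambda>f. inv f0 \<otimes> f) ` {f \<in> F. \<exists>w\<in>X. f \<otimes> (v \<otimes> w) = f0 \<otimes> (v \<otimes> w0)} \<subseteq> {e \<in> stab h True. ell e \<le> D}"
  proof
    fix y assume "y \<in> (\<lambda>f. inv f0 \<otimes> f) ` {f \<in> F. \<exists>w\<in>X. f \<otimes> (v \<otimes> w) = f0 \<otimes> (v \<otimes> w0)}"
    then obtain f w where f: "f \<in> F" "w \<in> X" "f \<otimes> (v \<otimes> w) = f0 \<otimes> (v \<otimes> w0)" "y = inv f0 \<otimes> f" by auto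
    have fc [simp]: "f \<in> carrier G" "w \<in> carrier G" using f Fc Xc by auto
    let ?g = "f0 \<otimes> (v \<otimes> w0)"
    have ys: "y \<in> stab h True" using stab_mult[OF stab_inv[of f0 h True], of f True] f 0 F by auto
    have ys': "inv f \<otimes> f0 \<in> stab h True" using stab_mult[OF stab_inv[of f h True], of f0 True] f 0 F by auto
    have "gp (pt f) (pt ?g) (pt f0) = gp (pt y) (\<phi> v (pt w0)) x0"
      using act_gp[of f0 "pt y" "\<phi> v (pt w0)" x0] f(4) by (simp add: act_mult)
    then have 1: "gp (pt f) (pt ?g) (pt f0) \<le> D3 + 3 * \<Delta>" using X(1) 0 ys by (simp add: transverse_set_def)
    have "gp (pt f0) (pt ?g) (pt f) = gp (pt (inv f \<otimes> f0)) (\<phi> v (pt w)) x0"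
      using act_gp[of f "pt (inv f \<otimes> f0)" "\<phi> v (pt w)" x0] unfolding f(3)[symmetric] by (simp add: act_mult)
    then have 2: "gp (pt f0) (pt ?g) (pt f) \<le> D3 + 3 * \<Delta>" using X(1) f ys' by (simp add: transverse_set_def)
    have "dist (pt f0) (pt f) \<le> D"
      using 1 2 gp_add[of "pt f" "pt ?g" "pt f0"] D3_le by (simp add: D_def dist_commute)
    then show "y \<in> {e \<in> stab h True. ell e \<le> D}" using ys f(4) by (simp add: dist_pt)
  qed
  moreover have "inj_on (\<lambda>f. inv f0 \<otimes> f) {f \<in> F. \<exists>w\<in>X. f \<otimes> (v \<otimes> w) = f0 \<otimes> (v \<otimes> w0)}"
    using Fc by (intro inj_onI) (metis (no_types, lifting) fc0(1) inv_closed Units_eq Units_l_cancel mem_Collect_eq subsetD)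
  ultimately have "card {f \<in> F. \<exists>w\<in>X. f \<otimes> (v \<otimes> w) = f0 \<otimes> (v \<otimes> w0)} \<le> card {e \<in> stab h True. ell e \<le> D}"
    using stab_card(1)[OF D0] by (intro card_inj_on_le)
  moreover have "8 * D / ell h + 1 \<le> 100 * real N"
    using ell_pos N1 by (simp add: D_def)
  then have "real N * (502 * \<kappa> / \<Delta>) * (8 * D / ell h + 1) \<le> real N * (502 * \<kappa> / \<Delta>) * (100 * real N)"
    using kappa Delta_pos by (intro mult_left_mono) auto
  ultimately show "real (card {f \<in> F. \<exists>w\<in>X. f \<otimes> (v \<otimes> w) = f0 \<otimes> (v \<otimes> w0)}) \<le> real N * (502 * \<kappa> / \<Delta>) * (100 * real N)"
    using stab_card(2)[OF D0] by linarith
qed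

end

context hyp_action
begin

text \<open>The infimum of displacements at least 10000 \<kappa> need not be attained, but being
  positive it is attained up to a factor 2. The new element has the ends of \<open>h0\<close>, hence
  the same stabilisers.\<close>

lemma minimal_axis_exists:
  assumes h0: "lox c h0" "c \<le> 300 * \<Delta>" "10000 * \<kappa> \<le> ell h0"
  shows "\<exists>h. minimal_axis G \<phi> \<Delta> \<kappa> N x0 (c + 18 * \<Delta>) h \<and> (\<forall>\<rho>. stab h \<rho> = stab h0 \<rho>)"
proof -
  define S where "S = {ell y | y. y \<in> stab h0 True \<and> 10000 * \<kappa> \<le> ell y}"
  have "h0 \<in> stab h0 True" using stab_pow[OF h0(1), of 1] lox_carrier[OF h0(1)] by simp
  then have ne: "S \<noteq> {}" using h0 by (auto simp: S_def)
  have lb: "10000 * \<kappa> \<le> x" if "x \<in> S" for x using that by (auto simp: S_def)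
  have bdd: "bdd_below S" using lb by (intro bdd_belowI)
  have "10000 * \<kappa> \<le> Inf S" using ne lb by (intro cInf_greatest)
  then have "Inf S < 2 * Inf S" using kappa Delta_pos by linarith
  then obtain x where x: "x \<in> S" "x < 2 * Inf S" using cInf_lessD[OF ne \<open>Inf S < 2 * Inf S\<close>] by blast
  then obtain h where h: "h \<in> stab h0 True" "10000 * \<kappa> \<le> ell h" "ell h < 2 * Inf S" by (auto simp: S_def)
  have lh: "lox (c + 18 * \<Delta>) h" using h h0 kappa Delta_pos by (intro stab_lox) auto
  have "\<exists>\<tau>. \<forall>\<sigma>. asy (en h \<sigma>) (en h0 (\<sigma> = \<tau>))"
    using h h0 kappa Delta_pos lh by (intro same_ends[of c h0 "c + 18 * \<Delta>" h]) auto
  then obtain \<tau> where "\<forall>\<sigma>. asy (en h \<sigma>) (en h0 (\<sigma> = \<tau>))" by blast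
  then have eq: "stab h \<rho> = stab h0 \<rho>" for \<rho> by (rule stab_eq_of_ends)
  have "minimal_axis G \<phi> \<Delta> \<kappa> N x0 (c + 18 * \<Delta>) h"
  proof unfold_locales
    show "lox (c + 18 * \<Delta>) h" by (rule lh)
    show "c + 18 * \<Delta> \<le> 400 * \<Delta>" using h0 Delta_pos by simp
    show "10000 * \<kappa> \<le> ell h" by (rule h(2))
    fix y assume "y \<in> stab h True" "10000 * \<kappa> \<le> ell y"
    then have "Inf S \<le> ell y" using eq bdd by (intro cInf_lower) (auto simp: S_def)
    then show "ell h \<le> 2 * ell y" using h by linarith
  qed
  then show ?thesis using eq by blast
qed

lemma inv_cancel: "p \<in> carrier G \<Longrightarrow> x \<in> carrier G \<Longrightarrow> inv p \<otimes> (p \<otimes> x) = x"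
  "p \<in> carrier G \<Longrightarrow> x \<in> carrier G \<Longrightarrow> p \<otimes> (inv p \<otimes> x) = x"
  by (simp_all add: m_assoc[symmetric])

text \<open>Since \<beta> = (\<beta> b1^-1) b1, the word \<beta> v0 w is an element of the
  stabiliser followed by b1 v0 w, and b1 v0 carries the axis to one with bounded overlap: ping-pong
  applies.\<close>

lemma periodic_growth:
  assumes ax: "minimal_axis G \<phi> \<Delta> \<kappa> N x0 c h" and U: "finite U" "U \<subseteq> carrier G"
    and B: "B \<subseteq> U" "b1 \<in> carrier G" "\<And>\<beta>. \<beta> \<in> B \<Longrightarrow> \<beta> \<otimes> inv b1 \<in> stab h True"
    and v0: "v0 \<in> U" "b1 \<otimes> v0 \<notin> stab h True \<union> stab h False"
    and M: "M = real N * (502 * \<kappa> / \<Delta>) * (100 * real N)" and card: "4 * M \<le> real (card B)"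
  shows "\<exists>W \<subseteq> set_pow G U (2 * k + 1). (real (card B) / (2 * M)) ^ (k + 1) \<le> real (card W)"
proof -
  interpret ax: minimal_axis G \<phi> \<Delta> \<kappa> N x0 c h by (rule ax)
  have hc: "h \<in> carrier G" by simp
  have Bc: "\<beta> \<in> carrier G" if "\<beta> \<in> B" for \<beta> using that B U by auto
  have v0c: "v0 \<in> carrier G" using v0 U by auto
  define m where "m = b1 \<otimes> v0"
  have mc: "m \<in> carrier G" using B v0c by (simp add: m_def)
  \<comment> \<open>An almost shortest element of the double coset of \<open>m\<close> by the powers
    of \<open>h\<close> serves as \<open>v\<close>; the powers introduced lie in the stabiliser and
    can be moved to its letters.\<close>
  define S where "S = {ell (h [^] i \<otimes> m \<otimes> h [^] j) | (i::int) (j::int). True}"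
  have "S \<noteq> {}" "bdd_below S" by (auto simp: S_def intro!: bdd_belowI[of _ 0])
  moreover have "Inf S < Inf S + \<Delta>" using Delta_pos by simp
  ultimately obtain x where x: "x \<in> S" "x < Inf S + \<Delta>" using cInf_lessD by blast
  then obtain a b :: int where ab: "ell (h [^] a \<otimes> m \<otimes> h [^] b) < Inf S + \<Delta>" by (auto simp: S_def)
  define p where "p = h [^] a"
  define q where "q = h [^] b"
  have pq [simp]: "p \<in> carrier G" "q \<in> carrier G" using hc by (simp_all add: p_def q_def)
  have pqs: "p \<in> stab h True" "q \<in> stab h True" unfolding p_def q_def by (rule stab_pow[OF ax.h(1)])+
  define v where "v = p \<otimes> m \<otimes> q"
  have vc: "v \<in> carrier G" using mc by (simp add: v_def)
  interpret tr: transverse G \<phi> \<Delta> \<kappa> N x0 c h v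
  proof unfold_locales
    show "v \<in> carrier G" by (rule vc)
    show "v \<notin> stab h True \<union> stab h False"
    proof
      assume "v \<in> stab h True \<union> stab h False"
      then obtain \<tau> where "v \<in> stab h \<tau>" by blast
      then have "inv p \<otimes> v \<otimes> inv q \<in> stab h \<tau>"
        using stab_mult[OF stab_mult[OF stab_inv[OF pqs(1)]] stab_inv[OF pqs(2)]] by simp
      moreover have "inv p \<otimes> v \<otimes> inv q = m" using mc by (simp add: v_def m_assoc inv_cancel)
      ultimately show False using v0(2) by (cases \<tau>) (auto simp: m_def)
    qed
    fix i j :: int
    have "h [^] i \<otimes> v \<otimes> h [^] j = h [^] (i + a) \<otimes> m \<otimes> h [^] (b + j)"
      using hc mc by (simp add: v_def p_def q_def int_pow_mult m_assoc)
    then have "ell (h [^] i \<otimes> v \<otimes> h [^] j) \<in> S" by (auto simp: S_def)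
    then have "Inf S \<le> ell (h [^] i \<otimes> v \<otimes> h [^] j)" using \<open>bdd_below S\<close> by (rule cInf_lower)
    then show "ell v - \<Delta> \<le> ell (h [^] i \<otimes> v \<otimes> h [^] j)" using ab by (simp add: v_def p_def q_def)
  qed
  \<comment> \<open>Chosen so that T (\<beta> v0 w) = T' \<beta> v T w: words in the letters of
    \<open>U\<close> become words alternating between the stabiliser and \<open>v\<close>.\<close>
  define T where "T w = inv q \<otimes> w \<otimes> inv b1" for w
  define T' where "T' w = T w \<otimes> inv p" for w
  have Ts: "T \<beta> \<in> stab h True" "T' \<beta> \<in> stab h True" if "\<beta> \<in> B" for \<beta>
  proof -
    have "T \<beta> = inv q \<otimes> (\<beta> \<otimes> inv b1)" using Bc[OF that] B(2) by (simp add: T_def m_assoc)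
    then show 1: "T \<beta> \<in> stab h True" using stab_mult[OF stab_inv[OF pqs(2)] B(3)[OF that]] by simp
    show "T' \<beta> \<in> stab h True" unfolding T'_def using stab_mult[OF 1 stab_inv[OF pqs(1)]] by simp
  qed
  have injT: "inj_on T (carrier G)" "inj_on T' (carrier G)"
  proof -
    have "q \<otimes> T w \<otimes> b1 = w" "q \<otimes> (T' w \<otimes> p) \<otimes> b1 = w" if "w \<in> carrier G" for w
      using that B(2) by (simp_all add: T_def T'_def m_assoc inv_cancel)
    then show "inj_on T (carrier G)" "inj_on T' (carrier G)" by (metis inj_onI)+
  qed
  \<comment> \<open>Ping-pong needs long stabiliser elements; by \<open>stab_card\<close> at most 2
    M letters are too short, no more than half of \<open>B\<close>.\<close>
  define B' where "B' = {\<beta> \<in> B. 20 * real N * ell h \<le> ell (T' \<beta>)}"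
  have finB0: "finite B" using finite_subset[OF B(1) U(1)] .
  then have finB: "finite B" "finite B'" unfolding B'_def by simp_all
  have kD: "1 \<le> \<kappa> / \<Delta>" using kappa Delta_pos by simp
  have M1: "1 \<le> M"
  proof -
    have "1 * (502 * 1) * (100 * 1) \<le> real N * (502 * (\<kappa> / \<Delta>)) * (100 * real N)"
      using N1 kD kappa Delta_pos by (intro mult_mono) auto
    then show ?thesis by (simp add: M)
  qed
  have B'card: "real (card B) / 2 \<le> real (card B')"
  proof -
    define D where "D = 20 * real N * ell h"
    have D0: "0 \<le> D" by (simp add: D_def)
    have "T' ` (B - B') \<subseteq> {e \<in> stab h True. ell e \<le> D}" using Ts by (auto simp: B'_def D_def)
    moreover have "inj_on T' (B - B')" using inj_on_subset[OF injT(2)] Bc by blast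
    ultimately have "card (B - B') \<le> card {e \<in> stab h True. ell e \<le> D}"
      using ax.stab_card(1)[OF D0] by (intro card_inj_on_le)
    moreover have "8 * D / ell h + 1 \<le> 200 * real N"
      using ax.ell_pos N1 by (simp add: D_def)
    then have "real N * (502 * \<kappa> / \<Delta>) * (8 * D / ell h + 1) \<le> real N * (502 * \<kappa> / \<Delta>) * (200 * real N)"
      using kappa Delta_pos by (intro mult_left_mono) auto
    ultimately have "real (card (B - B')) \<le> 2 * M"
      using ax.stab_card(2)[OF D0] by (simp add: M)
    moreover have "card (B - B') = card B - card B'"
      using finB by (intro card_Diff_subset) (auto simp: B'_def)
    moreover have "card B' \<le> card B" using finB by (intro card_mono) (auto simp: B'_def)
    ultimately show ?thesis using card by simp
  qed
  have "\<exists>W \<subseteq> set_pow G U (2 * k + 1). (real (card B) / (2 * M)) ^ (k + 1) \<le> real (card W) \<and> tr.transverse_set (T ` W)"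
  proof (induction k)
    case 0
    have "B \<subseteq> set_pow G U (2 * 0 + 1)" using B(1) set_pow_one[OF U(2)] by auto
    moreover have "real (card B) / (2 * M) \<le> real (card B) / 1"
      using M1 by (intro divide_left_mono) auto
    moreover have "tr.transverse_set (T ` B)" using Ts by (intro tr.transverse_stab) auto
    ultimately show ?case by (intro exI[of _ B]) simp
  next
    case (Suc k)
    then obtain W where W: "W \<subseteq> set_pow G U (2 * k + 1)" "(real (card B) / (2 * M)) ^ (k + 1) \<le> real (card W)"
      "tr.transverse_set (T ` W)" by auto
    have finW: "finite W" using W(1) set_pow_finite[OF U(1)] finite_subset by blast
    have Wc: "W \<subseteq> carrier G" using W(1) set_pow_carrier[OF U(2)] by blast
    let ?W = "(\<lambda>(\<beta>, w). \<beta> \<otimes> (v0 \<otimes> w)) ` (B' \<times> W)"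
    have sub: "?W \<subseteq> set_pow G U (2 * Suc k + 1)"
    proof (rule image_subsetI, clarify)
      fix \<beta> w assume "\<beta> \<in> B'" "w \<in> W"
      then show "\<beta> \<otimes> (v0 \<otimes> w) \<in> set_pow G U (2 * Suc k + 1)"
        using W(1) B(1) v0(1) set_pow_mult2[of \<beta> U v0 w "2 * k + 1"] by (auto simp: B'_def)
    qed
    have alg: "T (\<beta> \<otimes> (v0 \<otimes> w)) = T' \<beta> \<otimes> (v \<otimes> T w)" if "\<beta> \<in> B'" "w \<in> W" for \<beta> w
      using that Bc Wc B(2) v0c mc by (auto simp: T_def T'_def v_def m_def B'_def m_assoc inv_cancel subset_iff)
    have im: "T ` ?W = (\<lambda>(f, w). f \<otimes> (v \<otimes> w)) ` (T' ` B' \<times> T ` W)"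
    proof -
      have "T ` ?W = (\<lambda>(\<beta>, w). T' \<beta> \<otimes> (v \<otimes> T w)) ` (B' \<times> W)"
        unfolding image_image using alg by (intro image_cong) auto
      also have "\<dots> = (\<lambda>(f, w). f \<otimes> (v \<otimes> w)) ` (T' ` B' \<times> T ` W)" by force
      finally show ?thesis .
    qed
    have T's: "T' ` B' \<subseteq> stab h True" using Ts by (auto simp: B'_def)
    have tW: "tr.transverse_set (T ` ?W)"
      unfolding im by (rule tr.transverse_mult[OF W(3) T's]) (auto simp: B'_def)
    have c1: "card (T' ` B') = card B'" "card (T ` W) = card W"
    proof -
      have "B' \<subseteq> carrier G" using Bc by (auto simp: B'_def)
      from card_image[OF inj_on_subset[OF injT(2) this]] show "card (T' ` B') = card B'" .
      from card_image[OF inj_on_subset[OF injT(1) Wc]] show "card (T ` W) = card W" .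
    qed
    have "real (card (T' ` B')) * real (card (T ` W)) \<le> M * real (card (T ` ?W))"
      unfolding im M using tr.transverse_card[OF W(3) finite_imageI[OF finW] T's finite_imageI[OF finB(2)]] .
    also have "\<dots> \<le> M * real (card ?W)" using M1 card_image_le[of ?W T] finB finW by (intro mult_left_mono) auto
    finally have "real (card B) / 2 * real (card W) \<le> M * real (card ?W)"
      using mult_right_mono[OF B'card, of "real (card W)"] unfolding c1 by simp
    then have "real (card B) / (2 * M) * real (card W) \<le> real (card ?W)" using M1 by (simp add: field_simps)
    moreover have "(real (card B) / (2 * M)) ^ (Suc k + 1) \<le> real (card B) / (2 * M) * real (card W)"
      using mult_left_mono[OF W(2), of "real (card B) / (2 * M)"] M1 by simp
    ultimately show ?case using sub tW by (intro exI[of _ ?W]) auto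
  qed
  then show ?thesis by blast
qed

subsection \<open>Many elements of small displacement\<close>

text \<open>In f v w the long \<open>v\<close> carries the position: [x0, f v w x0] passes close to
  the images under \<open>f\<close> of two points near the beginning of [x0, v x0]. As
  \<open>f\<close> displaces them by at most \<open>T\<close>, \<open>shift_count\<close> bounds the
  number of \<open>f\<close> with a given product by \<open>M\<close>.\<close>

lemma concentrated_growth:
  assumes U: "finite U" "U \<subseteq> carrier G" and v: "v \<in> U" and F0: "F0 \<subseteq> U" and T: "10000 * \<kappa> \<le> T"
    and small: "\<And>f. f \<in> F0 \<Longrightarrow> ell f \<le> T" and big: "1000 * T \<le> ell v"
    and M: "M = real N * (2 * T / (40 * \<Delta>) + 1)" and card: "2 * M \<le> real (card F0)"
  shows "\<exists>W \<subseteq> set_pow G U (2 * k + 1). (real (card F0) / (2 * M)) ^ (k + 1) \<le> real (card W)"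
proof -
  have T0: "10000 * \<Delta> \<le> T" "\<kappa> \<le> T" using T kappa Delta_pos by linarith+
  have F0c: "F0 \<subseteq> carrier G" and vc [simp]: "v \<in> carrier G" using F0 U v by auto
  have finF0: "finite F0" using F0 U finite_subset by blast
  \<comment> \<open>10 T and 20 T: far enough apart for displacements up to \<open>T\<close> to
    preserve the order and for acylindricity to apply, and early enough to stay clear of the turn at
    the end of \<open>v\<close>.\<close>
  obtain z1 where z1: "dist x0 z1 = 10 * T" "dist z1 (pt v) = ell v - 10 * T"
    using geod[of "10 * T" x0 "pt v"] big T0 Delta_pos by auto
  obtain z2 where z2: "dist x0 z2 = 20 * T" "dist z2 (pt v) = ell v - 20 * T"
    using geod[of "20 * T" x0 "pt v"] big T0 Delta_pos by auto
  have z: "10 * T \<le> dist x0 z \<and> dist x0 z \<le> 20 * T \<and> dist z (pt v) = ell v - dist x0 z" if "z \<in> {z1, z2}" for z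
    using that z1 z2 T0 Delta_pos by auto
  have fz: "dist x0 z - T \<le> dist x0 (\<phi> f z) \<and> dist x0 (\<phi> f z) \<le> dist x0 z + T" if "f \<in> F0" for f z
  proof -
    have "dist (pt f) (\<phi> f z) = dist x0 z" using that F0c by auto
    then show ?thesis
      using small[OF that] dist_triangle[of x0 "\<phi> f z" "pt f"] dist_triangle[of "pt f" "\<phi> f z" x0]
      by (simp add: dist_commute)
  qed
  have start: "gp x0 (\<phi> f (pt v)) (\<phi> f z) \<le> 3 * \<Delta>" if f: "f \<in> F0" and zz: "z \<in> {z1, z2}" for f z
  proof -
    have fc: "f \<in> carrier G" using f F0c by auto
    have "gp (pt f) (\<phi> f (pt v)) (\<phi> f z) = gp x0 (pt v) z" using fc by simp
    also have "\<dots> = 0" using z[OF zz] by (simp add: gp_def dist_commute)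
    finally have a: "gp (pt f) (\<phi> f (pt v)) (\<phi> f z) = 0" .
    have "dist (pt f) (\<phi> f z) = dist x0 z" using fc by simp
    then have "3 * \<Delta> < gp (pt f) x0 (\<phi> f z)"
      using gp_add[of "pt f" x0 "\<phi> f z"] gp_le_dist(2)[of "\<phi> f z" x0 "pt f"] small[OF f] z[OF zz] T0 Delta_pos by linarith
    then show ?thesis using a hyp_cut[of "pt f" "\<phi> f (pt v)" "\<phi> f z" 0 x0] by simp
  qed
  \<comment> \<open>Applied to two targets \<open>Q\<close>: to v^-1 x0, for discarding letters that
    turn back, and to the value g x0 of a word, for bounding the fibres.\<close>
  have cnt: "real (card S) \<le> M" if S: "S \<subseteq> F0" and n: "\<And>f z. f \<in> S \<Longrightarrow> z \<in> {z1, z2} \<Longrightarrow> gp x0 Q (\<phi> f z) \<le> 12 * \<Delta>" for S Q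
    unfolding M
  proof (rule conjunct2[OF shift_count[of S z1 z2 "2 * T" x0 Q "9 * T"]])
    show "S \<subseteq> carrier G" using S F0c by auto
    show "\<kappa> \<le> dist z1 z2" using z1 z2 T0 dist_triangle[of x0 z2 z1] Delta_pos by simp
    show "0 \<le> 2 * T" using T0 Delta_pos by simp
    show "gp x0 Q (\<phi> f z1) \<le> 12 * \<Delta>" "gp x0 Q (\<phi> f z2) \<le> 12 * \<Delta>" if "f \<in> S" for f using n that by auto
    show "dist x0 (\<phi> f z1) \<le> dist x0 (\<phi> f z2)" if "f \<in> S" for f
      using fz[of f z1] fz[of f z2] that S z1 z2 T0 Delta_pos by force
    show "9 * T \<le> dist x0 (\<phi> f z1) \<and> dist x0 (\<phi> f z1) \<le> 9 * T + 2 * T" if "f \<in> S" for f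
      using fz[of f z1] that S z1 by auto
  qed
  define r where "r = 100 * T"
  \<comment> \<open>For the other letters f v x0 heads back towards v^-1 x0, which would spoil the
    turn between a preceding \<open>v\<close> and f v; there are at most \<open>M\<close> of
    them.\<close>
  define F where "F = {f \<in> F0. gp (pt (inv v)) (\<phi> f (pt v)) x0 \<le> r}"
  have "real (card (F0 - F)) \<le> M"
  proof (rule cnt[of _ "pt (inv v)"])
    fix f z' assume f: "f \<in> F0 - F" and zz: "z' \<in> {z1, z2}"
    have "r < gp (\<phi> f (pt v)) (pt (inv v)) x0" using f by (auto simp: F_def gp_commute)
    also have "\<dots> \<le> gp (\<phi> f (pt v)) (pt (inv v)) (\<phi> f z') + dist x0 (\<phi> f z')" by (rule gp_base_le)
    finally have "3 * \<Delta> + 3 * \<Delta> < gp (\<phi> f (pt v)) (pt (inv v)) (\<phi> f z')"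
      using fz[of f z'] f z[OF zz] T0 Delta_pos by (simp add: r_def)
    moreover have "gp (\<phi> f (pt v)) x0 (\<phi> f z') \<le> 3 * \<Delta>" using start[of f z'] f zz by (simp add: gp_commute)
    ultimately have "gp (pt (inv v)) x0 (\<phi> f z') \<le> 3 * \<Delta> + 3 * \<Delta>" by (intro hyp_cut[of "\<phi> f (pt v)"])
    then show "gp x0 (pt (inv v)) (\<phi> f z') \<le> 12 * \<Delta>" using Delta_pos by (simp add: gp_commute)
  qed auto
  moreover have "card (F0 - F) = card F0 - card F" "card F \<le> card F0"
    using finF0 by (auto intro!: card_Diff_subset card_mono simp: F_def)
  ultimately have Fcard: "real (card F0) / 2 \<le> real (card F)" using card by simp
  have finF: "finite F" and FF0: "F \<subseteq> F0" using finF0 by (auto simp: F_def)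
  have M1: "1 \<le> M"
  proof -
    have "1 * 1 \<le> real N * (2 * T / (40 * \<Delta>) + 1)" using N1 T0 Delta_pos by (intro mult_mono) auto
    then show ?thesis by (simp add: M)
  qed
  have turn: "gp x0 (pt (f \<otimes> (v \<otimes> w))) (\<phi> f (pt v)) \<le> r + 3 * \<Delta> + T"
    if f: "f \<in> F" and w: "w \<in> carrier G" "gp (pt (inv v)) (pt w) x0 \<le> r + 3 * \<Delta>" for f w
  proof -
    have fc: "f \<in> carrier G" using f FF0 F0c by auto
    have "gp x0 (pt (f \<otimes> (v \<otimes> w))) (\<phi> f (pt v)) = gp (pt (inv f)) (\<phi> v (pt w)) (pt v)"
      using act_gp[OF fc, of "pt (inv f)" "\<phi> v (pt w)" "pt v"] fc w by (simp add: act_mult)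
    also have "\<dots> \<le> gp x0 (\<phi> v (pt w)) (pt v) + dist (pt (inv f)) x0" by (rule gp_fst_le)
    also have "gp x0 (\<phi> v (pt w)) (pt v) = gp (pt (inv v)) (pt w) x0"
      using act_gp[OF vc, of "pt (inv v)" "pt w" x0] by simp
    finally show ?thesis using w small[of f] f FF0 ell_inv[OF fc] by (auto simp: dist_commute)
  qed
  have "\<exists>W \<subseteq> set_pow G U (2 * k + 1). (real (card F0) / (2 * M)) ^ (k + 1) \<le> real (card W) \<and>
      (\<forall>w\<in>W. gp (pt (inv v)) (pt w) x0 \<le> r + 3 * \<Delta>)"
  proof (induction k)
    case 0
    have "F0 \<subseteq> set_pow G U (2 * 0 + 1)" using F0 set_pow_one[OF U(2)] by auto
    moreover have "real (card F0) / (2 * M) \<le> real (card F0) / 1"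
      using M1 by (intro divide_left_mono) auto
    moreover have "gp (pt (inv v)) (pt w) x0 \<le> r + 3 * \<Delta>" if "w \<in> F0" for w
      using small[OF that] gp_le_dist(2)[of "pt (inv v)" "pt w" x0] T0 Delta_pos by (simp add: r_def dist_commute)
    ultimately show ?case by (intro exI[of _ F0]) simp
  next
    case (Suc k)
    then obtain W where W: "W \<subseteq> set_pow G U (2 * k + 1)" "(real (card F0) / (2 * M)) ^ (k + 1) \<le> real (card W)"
      "\<And>w. w \<in> W \<Longrightarrow> gp (pt (inv v)) (pt w) x0 \<le> r + 3 * \<Delta>" by auto
    have finW: "finite W" using W(1) set_pow_finite[OF U(1)] finite_subset by blast
    have Wc: "W \<subseteq> carrier G" using W(1) set_pow_carrier[OF U(2)] by blast
    let ?W = "(\<lambda>(f, w). f \<otimes> (v \<otimes> w)) ` (F \<times> W)"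
    have sub: "?W \<subseteq> set_pow G U (2 * Suc k + 1)"
    proof (rule image_subsetI, clarify)
      fix f w assume "f \<in> F" "w \<in> W"
      then show "f \<otimes> (v \<otimes> w) \<in> set_pow G U (2 * Suc k + 1)"
        using W(1) F0 FF0 v set_pow_mult2[of f U v w "2 * k + 1"] by auto
    qed
    have turn2: "gp (pt (inv v)) (pt (f \<otimes> (v \<otimes> w))) x0 \<le> r + 3 * \<Delta>" if f: "f \<in> F" and w: "w \<in> W" for f w
    proof -
      have fc: "f \<in> carrier G" using f FF0 F0c by auto
      have "ell v - T \<le> dist x0 (\<phi> f (pt v))" using fz[of f "pt v"] f FF0 by auto
      then have "r + 3 * \<Delta> < gp (\<phi> f (pt v)) (pt (f \<otimes> (v \<otimes> w))) x0"
        using gp_add[of "\<phi> f (pt v)" "pt (f \<otimes> (v \<otimes> w))" x0] turn[OF f _ W(3)[OF w]] w Wc big T0 Delta_pos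
        by (auto simp: r_def dist_commute)
      moreover have "gp (\<phi> f (pt v)) (pt (inv v)) x0 \<le> r" using f by (simp add: F_def gp_commute)
      ultimately have "gp (pt (f \<otimes> (v \<otimes> w))) (pt (inv v)) x0 \<le> r + 3 * \<Delta>" by (intro hyp_cut[of "\<phi> f (pt v)"])
      then show ?thesis by (simp add: gp_commute)
    qed
    have "real (card F) * real (card W) \<le> M * real (card ?W)"
    proof (rule card_product_ge)
      show "finite F" "finite W" "F \<subseteq> carrier G" "W \<subseteq> carrier G" "v \<in> carrier G" using finF finW FF0 F0c Wc by auto
      fix f0 w0 assume 0: "f0 \<in> F" "w0 \<in> W"
      let ?g = "f0 \<otimes> (v \<otimes> w0)"
      show "real (card {f \<in> F. \<exists>w\<in>W. f \<otimes> (v \<otimes> w) = ?g}) \<le> M"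
      proof (rule cnt[of _ "pt ?g"])
        show "{f \<in> F. \<exists>w\<in>W. f \<otimes> (v \<otimes> w) = ?g} \<subseteq> F0" using FF0 by auto
        fix f z' assume "f \<in> {f \<in> F. \<exists>w\<in>W. f \<otimes> (v \<otimes> w) = ?g}" and zz: "z' \<in> {z1, z2}"
        then obtain w where f: "f \<in> F" "w \<in> W" "f \<otimes> (v \<otimes> w) = ?g" by auto
        have fc: "f \<in> carrier G" and f0: "f \<in> F0" using f FF0 F0c by auto
        let ?y = "\<phi> f z'" and ?e = "\<phi> f (pt v)"
        have t: "gp x0 (pt ?g) ?e \<le> r + 3 * \<Delta> + T"
          using turn[OF f(1) _ W(3)[OF f(2)]] f Wc unfolding f(3) by auto
        have d: "dist ?y ?e = ell v - dist x0 z'" using fc z[OF zz] by simp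
        have "r + 3 * \<Delta> + T + 3 * \<Delta> < gp x0 ?y ?e"
          using gp_add[of ?y x0 ?e] start[OF f0 zz] gp_commute[of x0 ?y ?e] gp_commute[of ?e x0 ?y]
            d z[OF zz] big T0 Delta_pos r_def by linarith
        then have "gp ?y (pt ?g) ?e \<le> r + 3 * \<Delta> + T + 3 * \<Delta>" using t by (intro hyp_cut[of x0])
        then have "3 * \<Delta> + 3 * \<Delta> < gp ?e (pt ?g) ?y"
          using gp_add[of ?e "pt ?g" ?y] d z[OF zz] big T0 Delta_pos by (simp add: r_def dist_commute)
        moreover have "gp ?e x0 ?y \<le> 3 * \<Delta>" using start[OF f0 zz] by (simp add: gp_commute)
        ultimately have "gp (pt ?g) x0 ?y \<le> 3 * \<Delta> + 3 * \<Delta>" by (intro hyp_cut[of ?e])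
        then show "gp x0 (pt ?g) ?y \<le> 12 * \<Delta>" using Delta_pos by (simp add: gp_commute)
      qed
    qed
    then have "real (card F0) / 2 * real (card W) \<le> M * real (card ?W)"
      using mult_right_mono[OF Fcard, of "real (card W)"] by simp
    then have "real (card F0) / (2 * M) * real (card W) \<le> real (card ?W)" using M1 by (simp add: field_simps)
    moreover have "(real (card F0) / (2 * M)) ^ (Suc k + 1) \<le> real (card F0) / (2 * M) * real (card W)"
      using mult_left_mono[OF W(2), of "real (card F0) / (2 * M)"] M1 by simp
    ultimately show ?case using sub turn2 by (intro exI[of _ ?W]) auto
  qed
  then show ?thesis by blast
qed

end

subsection \<open>Splitting the directions\<close>

text \<open>For a random set of colours \<open>S\<close>, a given \<open>u\<close> has
  \<open>f u\<close> outside and \<open>g u\<close> inside with probability 1/4. The proof counts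
  pairs (S, u) in both orders.\<close>

lemma directed_cut:
  fixes f g :: "'b \<Rightarrow> 'c"
  assumes V: "finite V" and ne: "\<And>u. u \<in> V \<Longrightarrow> f u \<noteq> g u"
  shows "\<exists>S. card V \<le> 4 * card {u \<in> V. f u \<notin> S \<and> g u \<in> S}"
proof (rule ccontr)
  assume "\<not> ?thesis"
  then have less: "4 * card {u \<in> V. f u \<notin> S \<and> g u \<in> S} < card V" for S by (simp add: not_le)
  define C where "C = f ` V \<union> g ` V"
  have fC: "finite C" using V by (simp add: C_def)
  have one: "4 * card {S \<in> Pow C. f u \<notin> S \<and> g u \<in> S} = 2 ^ card C" if u: "u \<in> V" for u
  proof -
    have "{S \<in> Pow C. f u \<notin> S \<and> g u \<in> S} = insert (g u) ` Pow (C - {f u, g u})"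
    proof
      show "{S \<in> Pow C. f u \<notin> S \<and> g u \<in> S} \<subseteq> insert (g u) ` Pow (C - {f u, g u})"
      proof
        fix S assume "S \<in> {S \<in> Pow C. f u \<notin> S \<and> g u \<in> S}"
        then have "S = insert (g u) (S - {g u})" "S - {g u} \<in> Pow (C - {f u, g u})" by auto
        then show "S \<in> insert (g u) ` Pow (C - {f u, g u})" by blast
      qed
      show "insert (g u) ` Pow (C - {f u, g u}) \<subseteq> {S \<in> Pow C. f u \<notin> S \<and> g u \<in> S}"
        using u ne[OF u] by (auto simp: C_def)
    qed
    moreover have "inj_on (insert (g u)) (Pow (C - {f u, g u}))"
      by (rule inj_onI) (auto simp: insert_eq_iff)
    ultimately have "card {S \<in> Pow C. f u \<notin> S \<and> g u \<in> S} = 2 ^ card (C - {f u, g u})"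
      using fC by (simp add: card_image card_Pow)
    moreover have "card C = card (C - {f u, g u}) + 2"
    proof -
      have "{f u, g u} \<subseteq> C" using u by (auto simp: C_def)
      then have "card (C - {f u, g u}) = card C - card {f u, g u}" "card {f u, g u} \<le> card C"
        using fC by (auto intro!: card_Diff_subset card_mono)
      then show ?thesis using ne[OF u] by simp
    qed
    ultimately show ?thesis by (simp add: power_add)
  qed
  have "(\<Sum>S\<in>Pow C. card {u \<in> V. f u \<notin> S \<and> g u \<in> S})
      = (\<Sum>S\<in>Pow C. \<Sum>u\<in>V. if f u \<notin> S \<and> g u \<in> S then 1 else 0)"
    using V by (simp add: sum.If_cases Int_def)
  also have "\<dots> = (\<Sum>u\<in>V. \<Sum>S\<in>Pow C. if f u \<notin> S \<and> g u \<in> S then 1 else 0)" by (rule sum.swap)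
  also have "\<dots> = (\<Sum>u\<in>V. card {S \<in> Pow C. f u \<notin> S \<and> g u \<in> S})"
    using fC by (simp add: sum.If_cases Int_def)
  finally have "4 * (\<Sum>S\<in>Pow C. card {u \<in> V. f u \<notin> S \<and> g u \<in> S})
      = (\<Sum>u\<in>V. 4 * card {S \<in> Pow C. f u \<notin> S \<and> g u \<in> S})" by (simp add: sum_distrib_left)
  also have "\<dots> = card V * 2 ^ card C" using one by simp
  finally have "(\<Sum>S\<in>Pow C. 4 * card {u \<in> V. f u \<notin> S \<and> g u \<in> S}) = card V * card (Pow C)"
    using fC by (simp add: sum_distrib_left card_Pow)
  moreover have "(\<Sum>S\<in>Pow C. 4 * card {u \<in> V. f u \<notin> S \<and> g u \<in> S}) < (\<Sum>S\<in>Pow C. card V)"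
    using fC less by (intro sum_strict_mono) auto
  ultimately show False by simp
qed

text \<open>Take a largest union of classes of weight at most 75 percent. If it were below 14
  percent, adding one more class, of at most 60, would keep it admissible; and the complement keeps
  at least 89 - 75 percent.\<close>

lemma balanced_grouping:
  fixes f :: "'b \<Rightarrow> 'c" and n :: real
  assumes V: "finite V" and n: "0 < n" "89 / 100 * n \<le> real (card V)"
    and small: "\<And>x. real (card {u \<in> V. f u = x}) \<le> 60 / 100 * n"
  shows "\<exists>S. 14 / 100 * n \<le> real (card {u \<in> V. f u \<in> S}) \<and> 14 / 100 * n \<le> real (card {u \<in> V. f u \<notin> S})"
proof -
  define m where "m S = card {u \<in> V. f u \<in> S}" for S
  define Q where "Q = {S \<in> Pow (f ` V). real (m S) \<le> 75 / 100 * n}"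
  have "finite Q" "{} \<in> Q" using V n by (auto simp: Q_def m_def)
  then obtain S where S: "S \<in> Q" and max: "\<And>S'. S' \<in> Q \<Longrightarrow> m S' \<le> m S"
    using Max_in[of "m ` Q"] Max_ge[of "m ` Q"] by (metis (no_types, lifting) empty_iff finite_imageI image_iff image_is_empty)
  have compl: "card {u \<in> V. f u \<notin> S} + m S = card V"
  proof -
    have "V = {u \<in> V. f u \<notin> S} \<union> {u \<in> V. f u \<in> S}" by auto
    then show ?thesis using V unfolding m_def by (metis (no_types, lifting) card_Un_disjoint disjoint_iff finite_Un mem_Collect_eq)
  qed
  have "14 / 100 * n \<le> real (m S)"
  proof (rule ccontr)
    assume a: "\<not> ?thesis"
    then have "real (m S) < real (card V)" using n by linarith
    then obtain u where u: "u \<in> V" "f u \<notin> S" using V unfolding m_def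
      by (metis (no_types, lifting) mem_Collect_eq of_nat_less_iff order_less_irrefl subsetI subset_antisym)
    have "{w \<in> V. f w \<in> insert (f u) S} = {w \<in> V. f w \<in> S} \<union> {w \<in> V. f w = f u}" by auto
    then have e: "m (insert (f u) S) = m S + card {w \<in> V. f w = f u}"
      unfolding m_def using V u by (subst card_Un_disjoint[symmetric]) auto
    then have "real (m (insert (f u) S)) \<le> 75 / 100 * n" using a small[of "f u"] by simp
    then have "insert (f u) S \<in> Q" using S u by (auto simp: Q_def)
    then have "card {w \<in> V. f w = f u} = 0" using max[of "insert (f u) S"] e by simp
    then show False using u V by auto
  qed
  moreover have "14 / 100 * n \<le> real (card {u \<in> V. f u \<notin> S})"
    using compl S n unfolding Q_def by (auto simp flip: of_nat_add)
  ultimately show ?thesis unfolding m_def by blast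
qed

lemma median_exists:
  fixes f :: "'b \<Rightarrow> real"
  assumes A: "finite A"
  shows "\<exists>\<theta>. card A \<le> 2 * card {a \<in> A. f a \<le> \<theta>} \<and> card A \<le> 2 * card {a \<in> A. \<theta> \<le> f a}"
proof (cases "A = {}")
  case False
  define Q where "Q = {y \<in> f ` A. card A \<le> 2 * card {a \<in> A. f a \<le> y}}"
  have "{a \<in> A. f a \<le> Max (f ` A)} = A" using A by auto
  then have "Max (f ` A) \<in> Q" using A False by (auto simp: Q_def)
  then have Q: "finite Q" "Q \<noteq> {}" using A by (auto simp: Q_def)
  define \<theta> where "\<theta> = Min Q"
  have \<theta>: "\<theta> \<in> Q" "\<And>y. y \<in> Q \<Longrightarrow> \<theta> \<le> y" using Q by (auto simp: \<theta>_def)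
  have "2 * card {a \<in> A. f a < \<theta>} \<le> card A"
  proof (cases "{a \<in> A. f a < \<theta>} = {}")
    case True
    show ?thesis unfolding True by simp
  next
    case ne: False
    define y where "y = Max (f ` {a \<in> A. f a < \<theta>})"
    have fin: "finite (f ` {a \<in> A. f a < \<theta>})" using A by simp
    have y: "y \<in> f ` {a \<in> A. f a < \<theta>}" unfolding y_def by (rule Max_in[OF fin]) (use ne in blast)
    have "{a \<in> A. f a < \<theta>} = {a \<in> A. f a \<le> y}"
      using y Max_ge[OF fin] unfolding y_def by fastforce
    moreover have "y \<notin> Q" using y \<theta>(2)[of y] by auto
    ultimately show ?thesis using y by (auto simp: Q_def)
  qed
  moreover have "card A = card {a \<in> A. f a < \<theta>} + card {a \<in> A. \<theta> \<le> f a}"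
    using A by (subst card_Un_disjoint[symmetric]) (auto intro!: arg_cong[of _ _ card])
  ultimately have "card A \<le> 2 * card {a \<in> A. \<theta> \<le> f a}" by linarith
  then show ?thesis using \<theta>(1) by (auto simp: Q_def)
qed simp

context hyp_action
begin

text \<open>If most elements start and end in the same direction, the energy drops when the base point
  moves in that direction.\<close>
lemma direction_not_dominant:
  assumes U: "finite U" "U \<subseteq> carrier G" "U \<noteq> {}" and en: "avg_displacement \<phi> U x0 \<le> energy \<phi> U + \<Delta>"
    and V: "V \<subseteq> U" "\<And>u. u \<in> V \<Longrightarrow> 100 * \<Delta> \<le> ell u"
    and same: "\<And>u w. u \<in> V \<Longrightarrow> w \<in> V \<Longrightarrow> 37 * \<Delta> \<le> gp (pt u) (pt w) x0"
      "\<And>u w. u \<in> V \<Longrightarrow> w \<in> V \<Longrightarrow> 37 * \<Delta> \<le> gp (pt u) (pt (inv w)) x0"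
  shows "real (card V) \<le> 60 / 100 * real (card U)"
proof (rule ccontr)
  assume a: "\<not> ?thesis"
  have finV: "finite V" using V U finite_subset by blast
  have cU: "0 < card U" using U card_gt_0_iff by blast
  have "V \<noteq> {}" using a by auto
  then obtain u0 where u0: "u0 \<in> V" by auto
  have "37 * \<Delta> \<le> dist x0 (pt u0)" "0 \<le> 37 * \<Delta>" using V(2)[OF u0] Delta_pos by linarith+
  \<comment> \<open>\<open>y\<close> lies 37 \<Delta> out in the common direction, the length that
    all members of \<open>V\<close> and their inverses are known to share.\<close>
  then obtain y where y: "dist x0 y = 37 * \<Delta>" "gp y (pt u0) x0 = 37 * \<Delta>" using geodesic_to by metis
  have far: "dist y (\<phi> u y) \<le> ell u + 74 * \<Delta>" if "u \<in> U" for u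
  proof -
    have "dist (pt u) (\<phi> u y) = 37 * \<Delta>" using that U y by auto
    then show ?thesis
      using dist_triangle[of y "\<phi> u y" x0] dist_triangle[of x0 "\<phi> u y" "pt u"] y by (simp add: dist_commute)
  qed
  have near: "dist y (\<phi> u y) \<le> ell u - 56 * \<Delta>" if u: "u \<in> V" for u
  proof -
    have uc: "u \<in> carrier G" using u V U by auto
    have "37 * \<Delta> - 3 * \<Delta> \<le> gp y (pt u) x0"
      by (rule hyp_ge[of _ _ "pt u0"]) (use y same(1)[OF u0 u] in simp_all)
    moreover have "37 * \<Delta> - 3 * \<Delta> \<le> gp y (pt (inv u)) x0"
      by (rule hyp_ge[of _ _ "pt u0"]) (use y same(2)[OF u0 u] in simp_all)
    ultimately have d: "dist y (pt u) \<le> ell u - 31 * \<Delta>" "dist y (pt (inv u)) \<le> ell u - 31 * \<Delta>"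
      using two_gp[of y "pt u" x0] two_gp[of y "pt (inv u)" x0] y(1) ell_inv[OF uc]
      by (simp_all add: dist_commute)
    have e: "dist (\<phi> u y) x0 = dist y (pt (inv u))" "dist (\<phi> u y) (pt u) = dist x0 y"
      using act_dist_move[OF uc, of x0 y] uc by (simp_all add: dist_commute)
    show ?thesis
      using four_point[of y "\<phi> u y" x0 "pt u"] e d y(1) V(2)[OF u] dist_commute[of y x0] Delta_pos by linarith
  qed
  have "(\<Sum>u\<in>U. dist y (\<phi> u y)) = (\<Sum>u\<in>V. dist y (\<phi> u y)) + (\<Sum>u\<in>U - V. dist y (\<phi> u y))"
    using V(1) U(1) by (rule sum.subset_diff[of V U, THEN trans[OF _ add.commute]])
  also have "\<dots> \<le> (\<Sum>u\<in>V. ell u - 56 * \<Delta>) + (\<Sum>u\<in>U - V. ell u + 74 * \<Delta>)"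
    using near far by (intro add_mono sum_mono) auto
  also have "\<dots> = (\<Sum>u\<in>V. ell u) + (\<Sum>u\<in>U - V. ell u) - 56 * \<Delta> * real (card V) + 74 * \<Delta> * real (card (U - V))"
    by (simp add: sum_subtractf sum.distrib)
  also have "(\<Sum>u\<in>V. ell u) + (\<Sum>u\<in>U - V. ell u) = (\<Sum>u\<in>U. ell u)"
    using sum.subset_diff[OF V(1) U(1), of ell] by simp
  also have "real (card (U - V)) = real (card U) - real (card V)"
    using card_Diff_subset[OF finV V(1)] card_mono[OF U(1) V(1)] by simp
  finally have "(\<Sum>u\<in>U. dist y (\<phi> u y)) \<le> (\<Sum>u\<in>U. ell u) + \<Delta> * (74 * real (card U) - 130 * real (card V))"
    by (simp add: algebra_simps)
  \<comment> \<open>More than 60 percent gain 56 \<Delta> and the rest lose at most 74 \<Delta>; as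
    130 * 0.6 = 78, the average drops by 4 \<Delta>, more than the slack \<Delta> allowed to the
    base point.\<close>
  also have "\<dots> \<le> (\<Sum>u\<in>U. ell u) + \<Delta> * (- 4 * real (card U))"
    using a Delta_pos by (intro add_left_mono mult_left_mono) auto
  finally have "avg_displacement \<phi> U y \<le> ((\<Sum>u\<in>U. ell u) + \<Delta> * (- 4 * real (card U))) / real (card U)"
    unfolding avg_displacement_def by (intro divide_right_mono) auto
  also have "\<dots> = avg_displacement \<phi> U x0 - 4 * \<Delta>"
    using cU by (simp add: avg_displacement_def field_simps)
  finally have 1: "avg_displacement \<phi> U y \<le> avg_displacement \<phi> U x0 - 4 * \<Delta>" .
  have "energy \<phi> U \<le> avg_displacement \<phi> U y"
    unfolding energy_def
    by (rule cINF_lower) (auto intro!: bdd_belowI[of _ 0] simp: avg_displacement_def sum_nonneg)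
  then show False using 1 en Delta_pos by linarith
qed

text \<open>\<open>i\<close> and \<open>t\<close> are the classes of the initial direction and of
  the direction of the inverse. If they often differ, \<open>directed_cut\<close> applies; otherwise
  they mostly coincide, no class dominates by \<open>direction_not_dominant\<close>, and classes can
  be grouped into two large halves. Medians of the lengths then order the two sets.\<close>

lemma diffuse_split:
  fixes cls :: "'x \<Rightarrow> 'c"
  assumes U: "finite U" "U \<subseteq> carrier G" "U \<noteq> {}" and en: "avg_displacement \<phi> U x0 \<le> energy \<phi> U + \<Delta>"
    and cls: "\<And>z w. 40 * \<Delta> < dist x0 z \<Longrightarrow> 40 * \<Delta> < dist x0 w \<Longrightarrow> cls z = cls w \<Longrightarrow> 37 * \<Delta> \<le> gp z w x0"
      "\<And>z w. 40 * \<Delta> < dist x0 z \<Longrightarrow> 40 * \<Delta> < dist x0 w \<Longrightarrow> cls z \<noteq> cls w \<Longrightarrow> gp z w x0 \<le> 40 * \<Delta>"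
    and T: "100 * \<Delta> \<le> T" and few: "real (card {u \<in> U. ell u \<le> T}) \<le> real (card U) / 100"
  shows "\<exists>A B. A \<subseteq> U \<and> B \<subseteq> U \<and> real (card U) \<le> 100 * real (card A) \<and> real (card U) \<le> 100 * real (card B) \<and>
    (\<forall>a\<in>A. T < ell a) \<and> (\<forall>b\<in>B. T < ell b) \<and>
    (\<forall>a\<in>A. \<forall>b\<in>B. gp (pt (inv a)) (pt b) x0 \<le> 40 * \<Delta> \<and> gp (pt (inv b)) (pt a) x0 \<le> 40 * \<Delta> \<and> ell a \<le> ell b)"
proof -
  define V where "V = {u \<in> U. T < ell u}"
  define i where "i u = cls (pt u)" for u
  define t where "t u = cls (pt (inv u))" for u
  have V: "V \<subseteq> U" "finite V" using U by (auto simp: V_def)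
  have cU: "0 < real (card U)" using U by (simp add: card_gt_0_iff)
  have "U = {u \<in> U. ell u \<le> T} \<union> V" "{u \<in> U. ell u \<le> T} \<inter> V = {}" by (auto simp: V_def)
  then have "card U = card {u \<in> U. ell u \<le> T} + card V"
    using U V by (metis (no_types, lifting) card_Un_disjoint finite_Un)
  then have cV: "99 / 100 * real (card U) \<le> real (card V)" using few by simp
  have far: "40 * \<Delta> < ell u" "40 * \<Delta> < ell (inv u)" "u \<in> carrier G" if "u \<in> V" for u
    using that T Delta_pos U by (auto simp: V_def ell_inv subset_iff)
  have sep: "gp (pt (inv u)) (pt w) x0 \<le> 40 * \<Delta>" if "u \<in> V" "w \<in> V" "t u \<noteq> i w" for u w
    using cls(2)[OF far(2)[OF that(1)] far(1)[OF that(2)]] that(3) by (simp add: t_def i_def)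
  have "\<exists>A B. A \<subseteq> V \<and> B \<subseteq> V \<and> 1 / 50 * real (card U) \<le> real (card A) \<and> 1 / 50 * real (card U) \<le> real (card B) \<and>
    (\<forall>a\<in>A. \<forall>b\<in>B. t a \<noteq> i b \<and> t b \<noteq> i a)"
  proof (cases "10 / 100 * real (card U) \<le> real (card {u \<in> V. i u \<noteq> t u})")
    case True
    have "\<exists>S. card {u \<in> V. i u \<noteq> t u} \<le> 4 * card {u \<in> {u \<in> V. i u \<noteq> t u}. i u \<notin> S \<and> t u \<in> S}"
      by (rule directed_cut) (use V in auto)
    then obtain S where S: "card {u \<in> V. i u \<noteq> t u} \<le> 4 * card {u \<in> {u \<in> V. i u \<noteq> t u}. i u \<notin> S \<and> t u \<in> S}"
      by blast
    then have "1 / 50 * real (card U) \<le> real (card {u \<in> {u \<in> V. i u \<noteq> t u}. i u \<notin> S \<and> t u \<in> S})"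
      using True by linarith
    \<comment> \<open>One set serves as both \<open>A\<close> and \<open>B\<close>: its initial
      classes avoid \<open>S\<close>, its inverse classes lie in \<open>S\<close>.\<close>
    then show ?thesis
      by (intro exI[of _ "{u \<in> {u \<in> V. i u \<noteq> t u}. i u \<notin> S \<and> t u \<in> S}"]) auto
  next
    case False
    define V' where "V' = {u \<in> V. i u = t u}"
    have V': "finite V'" "V' \<subseteq> V" using V by (auto simp: V'_def)
    have "V = {u \<in> V. i u \<noteq> t u} \<union> V'" "{u \<in> V. i u \<noteq> t u} \<inter> V' = {}" by (auto simp: V'_def)
    then have "card V = card {u \<in> V. i u \<noteq> t u} + card V'"
      using V V' by (metis (no_types, lifting) card_Un_disjoint finite_Un)
    then have c': "89 / 100 * real (card U) \<le> real (card V')" using False cV by simp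
    have small: "real (card {u \<in> V'. i u = x}) \<le> 60 / 100 * real (card U)" for x
    proof (rule direction_not_dominant[OF U en])
      show "{u \<in> V'. i u = x} \<subseteq> U" using V V' by auto
      show "100 * \<Delta> \<le> ell u" if "u \<in> {u \<in> V'. i u = x}" for u using that V' T by (auto simp: V_def)
      fix u w assume "u \<in> {u \<in> V'. i u = x}" "w \<in> {u \<in> V'. i u = x}"
      then have uw: "u \<in> V" "w \<in> V" "i u = x" "i w = x" "t w = x" by (auto simp: V'_def)
      show "37 * \<Delta> \<le> gp (pt u) (pt w) x0"
        using cls(1)[OF far(1)[OF uw(1)] far(1)[OF uw(2)]] uw by (simp add: i_def)
      show "37 * \<Delta> \<le> gp (pt u) (pt (inv w)) x0"
        using cls(1)[OF far(1)[OF uw(1)] far(2)[OF uw(2)]] uw by (simp add: i_def t_def)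
    qed
    from balanced_grouping[OF V'(1) cU c' this]
    obtain S where S: "14 / 100 * real (card U) \<le> real (card {u \<in> V'. i u \<in> S})"
      "14 / 100 * real (card U) \<le> real (card {u \<in> V'. i u \<notin> S})" by auto
    then show ?thesis
      using V' cU by (rule_tac exI[of _ "{u \<in> V'. i u \<in> S}"], rule_tac exI[of _ "{u \<in> V'. i u \<notin> S}"]) (auto simp: V'_def)
  qed
  then obtain A0 B0 where AB: "A0 \<subseteq> V" "B0 \<subseteq> V" "1 / 50 * real (card U) \<le> real (card A0)"
    "1 / 50 * real (card U) \<le> real (card B0)" "\<And>a b. a \<in> A0 \<Longrightarrow> b \<in> B0 \<Longrightarrow> t a \<noteq> i b \<and> t b \<noteq> i a" by metis
  have fin: "finite A0" "finite B0" using AB V finite_subset by auto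
  \<comment> \<open>The side with the smaller median gives up its longer half, the other side its
    shorter half; the factor 2 lost turns 1/50 into 1/100.\<close>
  obtain \<theta> where \<theta>: "card A0 \<le> 2 * card {a \<in> A0. ell a \<le> \<theta>}" "card A0 \<le> 2 * card {a \<in> A0. \<theta> \<le> ell a}"
    using median_exists[OF fin(1), of ell] by blast
  obtain \<theta>' where \<theta>': "card B0 \<le> 2 * card {a \<in> B0. ell a \<le> \<theta>'}" "card B0 \<le> 2 * card {a \<in> B0. \<theta>' \<le> ell a}"
    using median_exists[OF fin(2), of ell] by blast
  have main: "\<exists>A B. A \<subseteq> U \<and> B \<subseteq> U \<and> real (card U) \<le> 100 * real (card A) \<and> real (card U) \<le> 100 * real (card B) \<and>
    (\<forall>a\<in>A. T < ell a) \<and> (\<forall>b\<in>B. T < ell b) \<and>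
    (\<forall>a\<in>A. \<forall>b\<in>B. gp (pt (inv a)) (pt b) x0 \<le> 40 * \<Delta> \<and> gp (pt (inv b)) (pt a) x0 \<le> 40 * \<Delta> \<and> ell a \<le> ell b)"
    if "A1 \<subseteq> V" "B1 \<subseteq> V" "1 / 50 * real (card U) \<le> 2 * real (card {a \<in> A1. ell a \<le> x})"
      "1 / 50 * real (card U) \<le> 2 * real (card {a \<in> B1. x' \<le> ell a})" "x \<le> x'"
      "\<And>a b. a \<in> A1 \<Longrightarrow> b \<in> B1 \<Longrightarrow> t a \<noteq> i b \<and> t b \<noteq> i a" for A1 B1 x x'
  proof (rule exI[of _ "{a \<in> A1. ell a \<le> x}"], rule exI[of _ "{a \<in> B1. x' \<le> ell a}"], intro conjI ballI)
    fix a b assume a: "a \<in> {a \<in> A1. ell a \<le> x}" and b: "b \<in> {a \<in> B1. x' \<le> ell a}"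
    then have ab: "a \<in> V" "b \<in> V" "t a \<noteq> i b" "t b \<noteq> i a" using that by auto
    show "gp (pt (inv a)) (pt b) x0 \<le> 40 * \<Delta>" "gp (pt (inv b)) (pt a) x0 \<le> 40 * \<Delta>" using sep ab by auto
    show "ell a \<le> ell b" using a b that(5) by simp
  qed (use that V in \<open>auto simp: V_def\<close>)
  show ?thesis
  proof (cases "\<theta> \<le> \<theta>'")
    case True
    show ?thesis by (rule main[of A0 B0 \<theta> \<theta>']) (use AB \<theta> \<theta>' True in auto)
  next
    case False
    show ?thesis by (rule main[of B0 A0 \<theta>' \<theta>]) (use AB \<theta> \<theta>' False in auto)
  qed
qed

end

subsection \<open>Blocks in the fibres of a map\<close>

text \<open>The sum of all \<open>p\<close>-step gaps telescopes to at most \<open>p\<close> times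
  the range, and each large gap contributes more than \<open>H\<close>.\<close>

lemma large_gaps_card:
  fixes F :: "nat \<Rightarrow> real"
  assumes mono: "\<And>i j. i \<le> j \<Longrightarrow> j < m + p \<Longrightarrow> F i \<le> F j" and F: "\<And>i. i < m + p \<Longrightarrow> 0 \<le> F i \<and> F i \<le> \<rho>"
    and H: "0 < H" and \<rho>: "0 \<le> \<rho>"
  shows "real (card {k. k < m \<and> H < F (k + p) - F k}) \<le> real p * \<rho> / H"
proof -
  have tel: "(\<Sum>k<m. F (k + p') - F k) \<le> real p' * \<rho>" if "p' \<le> p" for p'
    using that
  proof (induction p')
    case (Suc p')
    show ?case
    proof (cases "m = 0")
      case True
      then show ?thesis using \<rho> by simp
    next
      case False
      have "(\<Sum>k<m. F (k + Suc p') - F k) = (\<Sum>k<m. F (k + p') - F k) + (\<Sum>k<m. F (Suc k + p') - F (k + p'))"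
        by (simp add: sum.distrib[symmetric])
      also have "(\<Sum>k<m. F (Suc k + p') - F (k + p')) = F (m + p') - F p'"
        using sum_lessThan_telescope[of "\<lambda>k. F (k + p')" m] by simp
      also have "\<dots> \<le> \<rho>" using F[of "m + p'"] F[of p'] Suc.prems False by auto
      finally show ?thesis using Suc by (simp add: algebra_simps)
    qed
  qed simp
  let ?K = "{k. k < m \<and> H < F (k + p) - F k}"
  have "real (card ?K) * H = (\<Sum>k\<in>?K. H)" by simp
  also have "\<dots> \<le> (\<Sum>k\<in>?K. F (k + p) - F k)" by (intro sum_mono) simp
  also have "\<dots> \<le> (\<Sum>k<m. F (k + p) - F k)" using mono by (intro sum_mono2) auto
  also have "\<dots> \<le> real p * \<rho>" by (rule tel) simp
  finally show ?thesis using H by (simp add: field_simps)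
qed

text \<open>List each fibre of \<open>f\<close> by increasing value of \<open>l\<close>; \<open>y x j\<close> is the entry \<open>j\<close> places after \<open>x\<close>. All
  but boundedly many points of each fibre have \<open>q\<close> neighbours on both sides within a short window.\<close>
lemma fibre_blocks:
  fixes f :: "'b \<Rightarrow> 'c" and l :: "'b \<Rightarrow> real"
  assumes X: "finite X" and l: "\<And>x. x \<in> X \<Longrightarrow> 0 \<le> l x \<and> l x \<le> \<rho>" and H: "0 < H" and \<rho>: "0 \<le> \<rho>"
  shows "\<exists>Z (y :: 'b \<Rightarrow> int \<Rightarrow> 'b). Z \<subseteq> X \<and>
    real (card (X - Z)) \<le> (2 * real q + 2 * real q * \<rho> / H) * real (card (f ` X)) \<and>
    (\<forall>x\<in>Z. y x 0 = x \<and> (\<forall>j\<in>{- int q..int q}. y x j \<in> X \<and> f (y x j) = f x) \<and> inj_on (y x) {- int q..int q} \<and>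
      (\<forall>i j. - int q \<le> i \<and> i \<le> j \<and> j \<le> int q \<longrightarrow> l (y x i) \<le> l (y x j)) \<and>
      l (y x (int q)) - l (y x (- int q)) \<le> H) \<and>
    (\<forall>j\<in>{- int q..int q}. inj_on (\<lambda>x. y x j) Z)"
proof -
  have "\<exists>xs. distinct xs \<and> set xs = {x \<in> X. f x = g} \<and> sorted (map l xs)" for g
  proof -
    obtain xs where "set xs = {x \<in> X. f x = g}" "distinct xs"
      using finite_distinct_list[of "{x \<in> X. f x = g}"] X by auto
    then show ?thesis by (intro exI[of _ "sort_key l xs"]) simp
  qed
  then obtain L where L: "\<And>g. distinct (L g)" "\<And>g. set (L g) = {x \<in> X. f x = g}" "\<And>g. sorted (map l (L g))"
    by metis
  have "\<exists>i. x \<in> X \<longrightarrow> i < length (L (f x)) \<and> L (f x) ! i = x" for x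
    using L(2)[of "f x"] by (metis (mono_tags, lifting) in_set_conv_nth mem_Collect_eq)
  then obtain idx where idx: "\<And>x. x \<in> X \<Longrightarrow> idx x < length (L (f x)) \<and> L (f x) ! idx x = x" by metis
  have idx_inj: "x = z" if "x \<in> X" "z \<in> X" "f x = f z" "idx x = idx z" for x z
  proof -
    have "x = L (f x) ! idx x" using idx[OF that(1)] by (rule conjunct2[THEN sym])
    also have "\<dots> = L (f z) ! idx z" by (simp only: that(3,4))
    also have "\<dots> = z" using idx[OF that(2)] by (rule conjunct2)
    finally show ?thesis .
  qed
  \<comment> \<open>\<open>nat\<close> truncates negative positions; \<open>Z\<close> admits only
    elements for which all positions used lie within the list.\<close>
  define y where "y x j = L (f x) ! nat (int (idx x) + j)" for x j
  define Z where "Z = {x \<in> X. q \<le> idx x \<and> idx x + q < length (L (f x)) \<and> l (y x (int q)) - l (y x (- int q)) \<le> H}"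
  have nthX: "L g ! i \<in> X \<and> f (L g ! i) = g" if "i < length (L g)" for g i
    using nth_mem[OF that] L(2)[of g] by simp
  have lmono: "l (L g ! i) \<le> l (L g ! j)" if "i \<le> j" "j < length (L g)" for g i j
    using sorted_nth_mono[OF L(3)[of g], of i j] that by simp
  have ind: "nat (int (idx x) + j) < length (L (f x)) \<and> int (nat (int (idx x) + j)) = int (idx x) + j"
    if "x \<in> Z" "j \<in> {- int q..int q}" for x j
    using that by (auto simp: Z_def)
  \<comment> \<open>An excluded entry is among the first \<open>q\<close> or last \<open>q\<close>
    of its list, or is the centre of a window of 2 q steps wider than \<open>H\<close>.\<close>
  have fib: "real (card {x \<in> X - Z. f x = g}) \<le> 2 * real q + 2 * real q * \<rho> / H" for g
  proof -
    define n where "n = length (L g)"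
    define F where "F i = l (L g ! i)" for i
    let ?K = "{k. k < n - 2 * q \<and> H < F (k + 2 * q) - F k}"
    have "idx ` {x \<in> X - Z. f x = g} \<subseteq> {..<q} \<union> {n - q..<n} \<union> (\<lambda>k. k + q) ` ?K"
    proof
      fix i assume "i \<in> idx ` {x \<in> X - Z. f x = g}"
      then obtain x where x: "x \<in> X" "x \<notin> Z" "f x = g" "i = idx x" by auto
      have i: "i < n" using idx[OF x(1)] x by (simp add: n_def)
      show "i \<in> {..<q} \<union> {n - q..<n} \<union> (\<lambda>k. k + q) ` ?K"
      proof (cases "q \<le> i \<and> i + q < n")
        case True
        then have "\<not> l (y x (int q)) - l (y x (- int q)) \<le> H" using x by (auto simp: Z_def n_def)
        moreover have "nat (int i + int q) = (i - q) + 2 * q" "nat (int i - int q) = i - q" using True by auto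
        ultimately have "H < F ((i - q) + 2 * q) - F (i - q)" using x by (simp add: y_def F_def)
        then have "i - q \<in> ?K" using True by auto
        then show ?thesis using True by (intro UnI2 image_eqI[of _ _ "i - q"]) auto
      qed (use i in auto)
    qed
    then have "card (idx ` {x \<in> X - Z. f x = g}) \<le> card ({..<q} \<union> {n - q..<n} \<union> (\<lambda>k. k + q) ` ?K)"
      by (intro card_mono) auto
    also have "\<dots> \<le> card ({..<q} \<union> {n - q..<n}) + card ((\<lambda>k. k + q) ` ?K)" by (rule card_Un_le)
    also have "\<dots> \<le> card {..<q} + card {n - q..<n} + card ?K"
      by (intro add_mono card_Un_le card_image_le) auto
    finally have "card (idx ` {x \<in> X - Z. f x = g}) \<le> 2 * q + card ?K" by simp
    moreover have "inj_on idx {x \<in> X - Z. f x = g}"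
    proof (rule inj_onI)
      fix x z assume x: "x \<in> {x \<in> X - Z. f x = g}" and z: "z \<in> {x \<in> X - Z. f x = g}" and e: "idx x = idx z"
      then have f: "x \<in> X" "z \<in> X" "f x = f z" by simp_all
      show "x = z" by (rule idx_inj[OF f e])
    qed
    ultimately have "card {x \<in> X - Z. f x = g} \<le> 2 * q + card ?K" by (simp add: card_image)
    moreover have "real (card ?K) \<le> real (2 * q) * \<rho> / H"
    proof (cases "2 * q \<le> n")
      case True
      show ?thesis
      proof (rule large_gaps_card[OF _ _ H \<rho>])
        show "F i \<le> F j" if "i \<le> j" "j < n - 2 * q + 2 * q" for i j
          using lmono[of i j g] that True by (simp add: F_def n_def)
        show "0 \<le> F i \<and> F i \<le> \<rho>" if "i < n - 2 * q + 2 * q" for i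
          using nthX[of i g] l that True by (simp add: F_def n_def)
      qed
    next
      case False
      then have "?K = {}" by auto
      then show ?thesis using H \<rho> by (simp del: Collect_empty_eq)
    qed
    ultimately show ?thesis by simp
  qed
  have "real (card (X - Z)) \<le> (2 * real q + 2 * real q * \<rho> / H) * real (card (f ` (X - Z)))"
    using fib by (intro card_le_fibers) (use X in auto)
  also have "\<dots> \<le> (2 * real q + 2 * real q * \<rho> / H) * real (card (f ` X))"
    using X H \<rho> by (intro mult_left_mono of_nat_mono card_mono) auto
  finally have 1: "real (card (X - Z)) \<le> (2 * real q + 2 * real q * \<rho> / H) * real (card (f ` X))" .
  have 2: "y x 0 = x \<and> (\<forall>j\<in>{- int q..int q}. y x j \<in> X \<and> f (y x j) = f x) \<and> inj_on (y x) {- int q..int q} \<and>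
      (\<forall>i j. - int q \<le> i \<and> i \<le> j \<and> j \<le> int q \<longrightarrow> l (y x i) \<le> l (y x j)) \<and>
      l (y x (int q)) - l (y x (- int q)) \<le> H" if x: "x \<in> Z" for x
  proof (intro conjI ballI allI impI)
    have xX: "x \<in> X" using x by (simp add: Z_def)
    show "y x 0 = x" using idx[OF xX] by (simp add: y_def)
    show "y x j \<in> X" "f (y x j) = f x" if "j \<in> {- int q..int q}" for j
      using nthX ind[OF x that] by (simp_all add: y_def)
    show "inj_on (y x) {- int q..int q}"
    proof (rule inj_onI)
      fix i j assume ij: "i \<in> {- int q..int q}" "j \<in> {- int q..int q}" "y x i = y x j"
      then have "L (f x) ! nat (int (idx x) + i) = L (f x) ! nat (int (idx x) + j)" by (simp only: y_def)
      then have "nat (int (idx x) + i) = nat (int (idx x) + j)"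
        using nth_eq_iff_index_eq[OF L(1)[of "f x"]] ind[OF x ij(1)] ind[OF x ij(2)] by blast
      then show "i = j" using ind[OF x ij(1)] ind[OF x ij(2)] by linarith
    qed
    show "l (y x i) \<le> l (y x j)" if "- int q \<le> i \<and> i \<le> j \<and> j \<le> int q" for i j
      unfolding y_def using ind[OF x, of i] ind[OF x, of j] that by (intro lmono) auto
    show "l (y x (int q)) - l (y x (- int q)) \<le> H" using x by (simp add: Z_def)
  qed
  have 3: "inj_on (\<lambda>x. y x j) Z" if j: "j \<in> {- int q..int q}" for j
  proof (rule inj_onI)
    fix x z assume xz: "x \<in> Z" "z \<in> Z" "y x j = y z j"
    have "f (y x j) = f x" "f (y z j) = f z" using 2[OF xz(1)] 2[OF xz(2)] j by blast+
    then have f: "f x = f z" using xz(3) by simp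
    have "L (f z) ! nat (int (idx x) + j) = L (f z) ! nat (int (idx z) + j)" using xz(3) by (simp only: y_def f)
    then have "nat (int (idx x) + j) = nat (int (idx z) + j)"
      using nth_eq_iff_index_eq[OF L(1)[of "f z"]] ind[OF xz(1) j, unfolded f] ind[OF xz(2) j] by blast
    then have "idx x = idx z" using ind[OF xz(1) j] ind[OF xz(2) j] by linarith
    moreover have "x \<in> X" "z \<in> X" using xz by (simp_all add: Z_def)
    ultimately show "x = z" using idx_inj f by blast
  qed
  show ?thesis
  proof (rule exI[of _ Z], rule exI[of _ y], intro conjI)
    show "Z \<subseteq> X" by (auto simp: Z_def)
  qed (rule 1, rule ballI, erule 2, rule ballI, erule 3)
qed

context hyp_action
begin

lemma near_between:
  assumes n: "gp P Q (x::'x) \<le> c" "gp P Q y \<le> c" "gp P Q z \<le> c" and o: "dist P x \<le> dist P y" "dist P y \<le> dist P z"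
  shows "gp x z y \<le> 2 * c + 6 * \<Delta>"
  using near_dist[OF n(1,2)] near_dist[OF n(2,3)] o two_gp[of x z y] dist_triangle[of P z x]
    dist_commute[of z y] by linarith

end

subsection \<open>Words along quasi-geodesics\<close>

text \<open>By \<open>shorter\<close>, the segments [x0, b x0] are at least as long as the range of
  the lengths \<open>ell a\<close>; occurrences of \<open>b\<close> shifted by a small part of that
  range therefore overlap almost entirely.\<close>

locale diffuse = hyp_action +
  fixes A B
  assumes fin: "finite A" "finite B" and AB: "A \<subseteq> carrier G" "B \<subseteq> carrier G"
    and turn: "\<And>a b. a \<in> A \<Longrightarrow> b \<in> B \<Longrightarrow> gp (pt (inv a)) (pt b) x0 \<le> 40 * \<Delta>"
      "\<And>a b. a \<in> A \<Longrightarrow> b \<in> B \<Longrightarrow> gp (pt (inv b)) (pt a) x0 \<le> 40 * \<Delta>"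
    and long: "\<And>a. a \<in> A \<Longrightarrow> 10000000000 * \<kappa> < ell a"
    and shorter: "\<And>a b. a \<in> A \<Longrightarrow> b \<in> B \<Longrightarrow> ell a \<le> ell b"
    and ne: "A \<noteq> {}"
begin

lemma Ac: "a \<in> A \<Longrightarrow> a \<in> carrier G" and Bc: "b \<in> B \<Longrightarrow> b \<in> carrier G"
  using AB by auto

lemma long_Delta: "a \<in> A \<Longrightarrow> 10000000000 * \<Delta> < ell a"
  using long[of a] kappa by linarith

lemma long_B: "b \<in> B \<Longrightarrow> 10000000000 * \<kappa> < ell b" "b \<in> B \<Longrightarrow> 10000000000 * \<Delta> < ell b"
proof -
  assume b: "b \<in> B"
  obtain a where a: "a \<in> A" using ne by auto
  show "10000000000 * \<kappa> < ell b" "10000000000 * \<Delta> < ell b"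
    using long[OF a] shorter[OF a b] kappa by linarith+
qed

text \<open>43 \<Delta> is the 40 \<Delta> of the splitting plus one use of \<open>hyp_cut\<close>.
  Prefixing a b reproduces the bound, so it holds for words of any length.\<close>

definition admissible :: "'a set \<Rightarrow> bool" where
  "admissible W \<longleftrightarrow> finite W \<and> W \<subseteq> carrier G \<and> (\<forall>b\<in>B. \<forall>w\<in>W. gp (pt (inv b)) (pt w) x0 \<le> 43 * \<Delta>)"

lemma admissibleD: "admissible W \<Longrightarrow> w \<in> W \<Longrightarrow> w \<in> carrier G"
  "admissible W \<Longrightarrow> w \<in> W \<Longrightarrow> b \<in> B \<Longrightarrow> gp (pt (inv b)) (pt w) x0 \<le> 43 * \<Delta>"
  by (auto simp: admissible_def)

lemma admissible_A: "admissible A"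
proof -
  have "gp (pt (inv b)) (pt w) x0 \<le> 43 * \<Delta>" if "b \<in> B" "w \<in> A" for b w
    using turn(2)[OF that(2,1)] Delta_pos by linarith
  then show ?thesis unfolding admissible_def using fin AB by blast
qed

text \<open>The letters \<open>a\<close> that occur in the fibre over \<open>g\<close> of the map
  (a, w) -> a b w.\<close>

definition occ :: "'a set \<Rightarrow> 'a \<Rightarrow> 'a \<Rightarrow> 'a \<Rightarrow> bool" where
  "occ W b g a \<longleftrightarrow> admissible W \<and> b \<in> B \<and> a \<in> A \<and> (\<exists>w\<in>W. g = a \<otimes> (b \<otimes> w))"

lemma occ_carrier: "occ W b g a \<Longrightarrow> a \<in> carrier G" "occ W b g a \<Longrightarrow> b \<in> carrier G" "occ W b g a \<Longrightarrow> g \<in> carrier G"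
  by (auto simp: occ_def Ac Bc admissibleD)

lemma turn_word:
  assumes W: "admissible W" and a: "a \<in> A" and b: "b \<in> B" and w: "w \<in> W"
  shows "gp x0 (\<phi> b (pt w)) (pt b) \<le> 43 * \<Delta>" "gp (pt (inv a)) (\<phi> b (pt w)) x0 \<le> 43 * \<Delta>"
    "gp (pt (inv a)) (\<phi> b (pt w)) (pt b) \<le> 46 * \<Delta>"
proof -
  note c [simp] = Ac[OF a] Bc[OF b] admissibleD(1)[OF W w]
  show 1: "gp x0 (\<phi> b (pt w)) (pt b) \<le> 43 * \<Delta>"
    using act_gp[of b "pt (inv b)" "pt w" x0] admissibleD(2)[OF W w b] by simp
  have "40 * \<Delta> + 3 * \<Delta> < gp (pt b) (\<phi> b (pt w)) x0"
    using gp_add[of "pt b" "\<phi> b (pt w)" x0] 1 long_B(2)[OF b] Delta_pos by (simp add: dist_commute)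
  then have "gp (\<phi> b (pt w)) (pt (inv a)) x0 \<le> 40 * \<Delta> + 3 * \<Delta>"
    using turn(1)[OF a b] by (intro hyp_cut[of "pt b"]) (simp_all add: gp_commute)
  then show "gp (pt (inv a)) (\<phi> b (pt w)) x0 \<le> 43 * \<Delta>" by (simp add: gp_commute)
  have "gp (pt b) (pt (inv a)) x0 \<le> 40 * \<Delta>" using turn(1)[OF a b] by (simp add: gp_commute)
  then have "43 * \<Delta> + 3 * \<Delta> < gp x0 (pt (inv a)) (pt b)"
    using gp_add'[of x0 "pt (inv a)" "pt b"] gp_add[of "pt b" "pt (inv a)" x0] long_B(2)[OF b] Delta_pos
    by (simp add: dist_commute)
  then have "gp (pt (inv a)) (\<phi> b (pt w)) (pt b) \<le> 43 * \<Delta> + 3 * \<Delta>" using 1 by (intro hyp_cut[of x0])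
  then show "gp (pt (inv a)) (\<phi> b (pt w)) (pt b) \<le> 46 * \<Delta>" by simp
qed

lemma word_frame:
  assumes "a \<in> carrier G" "b \<in> carrier G" "w \<in> carrier G"
  shows "gp x0 (pt (a \<otimes> (b \<otimes> w))) (\<phi> a z) = gp (pt (inv a)) (\<phi> b (pt w)) z"
    "dist x0 (\<phi> a z) = dist (pt (inv a)) z"
  using act_gp[OF assms(1), of "pt (inv a)" "\<phi> b (pt w)" z] act_dist_move[OF assms(1), of x0 z] assms
  by (simp_all add: act_mult)

lemma admissible_mult:
  assumes W: "admissible W" and b: "b \<in> B"
  shows "admissible ((\<lambda>(a, w). a \<otimes> (b \<otimes> w)) ` (A \<times> W))"
proof -
  have "gp (pt (inv b')) (pt (a \<otimes> (b \<otimes> w))) x0 \<le> 43 * \<Delta>" if "b' \<in> B" "a \<in> A" "w \<in> W" for b' a w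
  proof -
    note c [simp] = Ac[OF that(2)] Bc[OF b] admissibleD(1)[OF W that(3)]
    have "gp x0 (pt (a \<otimes> (b \<otimes> w))) (pt a) \<le> 43 * \<Delta>"
      using word_frame(1)[of a b w x0] turn_word(2)[OF W that(2) b that(3)] by simp
    then have "40 * \<Delta> + 3 * \<Delta> < gp (pt a) (pt (a \<otimes> (b \<otimes> w))) x0"
      using gp_add[of "pt a" "pt (a \<otimes> (b \<otimes> w))" x0] long_Delta[OF that(2)] Delta_pos by (simp add: dist_commute)
    then have "gp (pt (a \<otimes> (b \<otimes> w))) (pt (inv b')) x0 \<le> 40 * \<Delta> + 3 * \<Delta>"
      using turn(2)[OF that(2,1)] by (intro hyp_cut[of "pt a"]) (simp_all add: gp_commute)
    then show ?thesis by (simp add: gp_commute)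
  qed
  moreover have "(\<lambda>(a, w). a \<otimes> (b \<otimes> w)) ` (A \<times> W) \<subseteq> carrier G"
    using Ac Bc[OF b] admissibleD(1)[OF W] by auto
  ultimately show ?thesis using fin W unfolding admissible_def by auto
qed

text \<open>All turns of the word are bounded, so every occurrence in the fibre of \<open>g\<close>
  places a copy of [x0, b x0] along the one geodesic [x0, g x0], beginning about
  \<open>ell a\<close> from its start. Inside the copy the error is only 6 \<Delta>.\<close>

lemma occ_near:
  assumes "occ W b g a"
  shows "gp x0 (pt g) (pt a) \<le> 43 * \<Delta>" "gp x0 (pt g) (\<phi> a (pt b)) \<le> 46 * \<Delta>"
    "ell a + ell b - 80 * \<Delta> \<le> dist x0 (\<phi> a (pt b))" "dist x0 (\<phi> a (pt b)) \<le> ell a + ell b"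
    "dist x0 z + dist z (pt b) = ell b \<Longrightarrow> gp x0 (pt g) (\<phi> a z) \<le> 86 * \<Delta>"
    "dist x0 z + dist z (pt b) = ell b \<Longrightarrow> 50 * \<Delta> < dist x0 z \<Longrightarrow> 53 * \<Delta> < dist z (pt b) \<Longrightarrow>
      gp x0 (pt g) (\<phi> a z) \<le> 6 * \<Delta>"
    "dist x0 z + dist z (pt b) = ell b \<Longrightarrow> 50 * \<Delta> < dist x0 z \<Longrightarrow> 53 * \<Delta> < dist z (pt b) \<Longrightarrow>
      ell a + dist x0 z - 92 * \<Delta> \<le> dist x0 (\<phi> a z) \<and> dist x0 (\<phi> a z) \<le> ell a + dist x0 z"
proof -
  obtain w where W: "admissible W" and b: "b \<in> B" and a: "a \<in> A" and w: "w \<in> W" "g = a \<otimes> (b \<otimes> w)"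
    using assms by (auto simp: occ_def)
  note c [simp] = Ac[OF a] Bc[OF b] admissibleD(1)[OF W w(1)]
  note f = word_frame[of a b w, folded w(2)]
  note t = turn_word[OF W a b w(1)]
  let ?P = "pt (inv a)" and ?Q = "\<phi> b (pt w)"
  have ea: "dist ?P x0 = ell a" using ell_inv[of a] by (simp add: dist_commute)
  show "gp x0 (pt g) (pt a) \<le> 43 * \<Delta>" "gp x0 (pt g) (\<phi> a (pt b)) \<le> 46 * \<Delta>" using t unfolding f(1)[OF c] by simp_all
  show "ell a + ell b - 80 * \<Delta> \<le> dist x0 (\<phi> a (pt b))" "dist x0 (\<phi> a (pt b)) \<le> ell a + ell b"
    using two_gp[of ?P "pt b" x0] turn(1)[OF a b] ea dist_triangle[of ?P "pt b" x0] dist_commute[of "pt b" x0]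
    unfolding f(2)[OF c] ea[symmetric] by linarith+
  assume z: "dist x0 z + dist z (pt b) = ell b"
  have bx: "gp x0 ?Q (pt b) \<le> 43 * \<Delta>" by (rule t(1))
  show "gp x0 (pt g) (\<phi> a z) \<le> 86 * \<Delta>"
    unfolding f(1)[OF c]
    using two_gp[of ?P ?Q z] two_gp[of ?P ?Q x0] two_gp[of x0 ?Q "pt b"] t(1,2) z dist_triangle[of ?P z x0]
      dist_triangle[of ?Q z "pt b"] dist_commute[of "pt b" z] dist_commute[of ?Q x0] dist_triangle[of x0 ?Q "pt b"]
      dist_commute[of "pt b" ?Q] by linarith
  assume z1: "50 * \<Delta> < dist x0 z" and z2: "53 * \<Delta> < dist z (pt b)"
  have "gp ?P (pt b) x0 \<le> 43 * \<Delta>" using turn(1)[OF a b] Delta_pos by linarith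
  from segment_near(1,2)[OF this bx z] z1 z2
  have n: "gp ?P ?Q z \<le> 6 * \<Delta>" "gp ?P z x0 \<le> 46 * \<Delta>" by simp_all
  then show "gp x0 (pt g) (\<phi> a z) \<le> 6 * \<Delta>" unfolding f(1)[OF c] by simp
  show "ell a + dist x0 z - 92 * \<Delta> \<le> dist x0 (\<phi> a z) \<and> dist x0 (\<phi> a z) \<le> ell a + dist x0 z"
    unfolding f(2)[OF c]
    using n(2) two_gp[of ?P z x0] ea dist_triangle[of ?P z x0] dist_commute[of z x0] by linarith
qed

text \<open>Acylindricity on a piece of [x0, b x0] of length at least \<kappa>: its copies lie along
  [x0, g x0], at positions known from \<open>ell a\<close>.\<close>

lemma occ_count:
  assumes S: "\<And>a. a \<in> S \<Longrightarrow> occ W b g a" "\<And>a. a \<in> S \<Longrightarrow> x \<le> ell a \<and> ell a \<le> x + H" and H: "0 \<le> H" and b: "b \<in> B"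
  shows "real (card S) \<le> real N * ((H + 92 * \<Delta>) / (40 * \<Delta>) + 1)"
proof -
  have eb: "1000 * \<Delta> + \<kappa> < ell b" using long_B[OF b] kappa Delta_pos by linarith
  obtain z1 where z1: "dist x0 z1 = 100 * \<Delta>" "dist z1 (pt b) = ell b - 100 * \<Delta>"
    using geod[of "100 * \<Delta>" x0 "pt b"] eb kappa Delta_pos by auto
  obtain z2 where z2: "dist x0 z2 = 300 * \<Delta> + \<kappa>" "dist z2 (pt b) = ell b - (300 * \<Delta> + \<kappa>)"
    using geod[of "300 * \<Delta> + \<kappa>" x0 "pt b"] eb kappa Delta_pos by auto
  have n: "gp x0 (pt g) (\<phi> a z) \<le> 6 * \<Delta>"
    "ell a + dist x0 z - 92 * \<Delta> \<le> dist x0 (\<phi> a z) \<and> dist x0 (\<phi> a z) \<le> ell a + dist x0 z"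
    if "a \<in> S" "z \<in> {z1, z2}" for a z
    using occ_near(6,7)[OF S(1)[OF that(1)], of z] that(2) z1 z2 eb kappa Delta_pos by auto
  show ?thesis
  proof (rule conjunct2[OF shift_count[of S z1 z2 "H + 92 * \<Delta>" x0 "pt g" "x + 100 * \<Delta> - 92 * \<Delta>"]])
    show "S \<subseteq> carrier G" using S(1) occ_carrier(1) by blast
    show "\<kappa> \<le> dist z1 z2" using z1 z2 dist_triangle[of x0 z2 z1] Delta_pos by linarith
    show "0 \<le> H + 92 * \<Delta>" using H Delta_pos by simp
    fix a assume a: "a \<in> S"
    show "gp x0 (pt g) (\<phi> a z1) \<le> 12 * \<Delta>" "gp x0 (pt g) (\<phi> a z2) \<le> 12 * \<Delta>"
      using n(1)[OF a, of z1] n(1)[OF a, of z2] Delta_pos by simp_all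
    show "dist x0 (\<phi> a z1) \<le> dist x0 (\<phi> a z2)"
      using n(2)[OF a, of z1] n(2)[OF a, of z2] z1 z2 kappa Delta_pos by simp
    show "x + 100 * \<Delta> - 92 * \<Delta> \<le> dist x0 (\<phi> a z1) \<and> dist x0 (\<phi> a z1) \<le> x + 100 * \<Delta> - 92 * \<Delta> + (H + 92 * \<Delta>)"
      using n(2)[OF a, of z1] S(2)[OF a] z1 by auto
  qed
qed

text \<open>Two copies of [x0, b x0] along one geodesic, shifted by at most half their length:
  \<open>e\<close> slides the segment along itself, hence is loxodromic with its axis along the
  segment.\<close>

lemma occ_shift_lox:
  assumes o: "occ W b g a1" "occ W b g a2" and s: "10000 * \<Delta> \<le> ell a2 - ell a1" "2 * ell a2 \<le> 2 * ell a1 + ell b"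
  defines "e \<equiv> inv a1 \<otimes> a2"
  shows "lox (101 * \<Delta>) e" "ell a2 - ell a1 \<le> ell e" "ell e \<le> ell a2 - ell a1 + 98 * \<Delta>"
    "\<forall>\<^sub>F k in sequentially. ord e True (110 * \<Delta>) k x0 (pt b)"
proof -
  note c [simp] = occ_carrier[OF o(1)] occ_carrier(1)[OF o(2)]
  have ec [simp]: "e \<in> carrier G" by (simp add: e_def)
  have a2: "\<phi> a1 (\<phi> e z) = \<phi> a2 z" for z by (simp add: e_def act_mult)
  have bB: "b \<in> B" using o(1) by (simp add: occ_def)
  note lb = long_B(2)[OF bB]
  have n: "gp x0 (pt g) (pt a1) \<le> 46 * \<Delta>" "gp x0 (pt g) (pt a2) \<le> 46 * \<Delta>"
    "gp x0 (pt g) (\<phi> a1 (pt b)) \<le> 46 * \<Delta>" "gp x0 (pt g) (\<phi> a2 (pt b)) \<le> 46 * \<Delta>"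
    using occ_near(1,2)[OF o(1)] occ_near(1,2)[OF o(2)] Delta_pos by linarith+
  have p: "ell a1 \<le> ell a2" "ell a2 \<le> dist x0 (\<phi> a1 (pt b))"
    "dist x0 (\<phi> a1 (pt b)) + (ell a2 - ell a1) - 80 * \<Delta> \<le> dist x0 (\<phi> a2 (pt b))"
    using occ_near(3,4)[OF o(1)] occ_near(3,4)[OF o(2)] s lb Delta_pos by linarith+
  then have p4: "dist x0 (\<phi> a1 (pt b)) \<le> dist x0 (\<phi> a2 (pt b))" using s Delta_pos by linarith
  have fr1: "gp (\<phi> a1 x) (\<phi> a1 y) (\<phi> a1 z) = gp x y z" for x y z by simp
  have g1: "gp x0 (pt b) (pt e) \<le> 98 * \<Delta>"
    using near_between[OF n(1,2,3) p(1,2)] fr1[of x0 "pt b" "pt e"] by (simp add: a2)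
  have g2: "gp x0 (\<phi> e (pt b)) (pt e) \<le> 98 * \<Delta>"
    using near_between[OF n(1,2,4) p(1)] p p4 fr1[of x0 "\<phi> e (pt b)" "pt e"] by (simp add: a2)
  have g3: "gp x0 (\<phi> e (pt b)) (pt b) \<le> 98 * \<Delta>"
    using near_between[OF n(1,3,4) _ p4] p fr1[of x0 "\<phi> e (pt b)" "pt b"] by (simp add: a2)
  have g4: "gp (pt e) (\<phi> e (pt b)) (pt b) \<le> 98 * \<Delta>"
    using near_between[OF n(2,3,4) p(2) p4] fr1[of "pt e" "\<phi> e (pt b)" "pt b"] by (simp add: a2)
  have ed: "dist (pt a1) (pt a2) = ell e" using act_dist[of a1 x0 "pt e"] by (simp add: a2)
  show e1: "ell a2 - ell a1 \<le> ell e" using dist_triangle[of x0 "pt a2" "pt a1"] ed by simp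
  show e2: "ell e \<le> ell a2 - ell a1 + 98 * \<Delta>" using near_dist[OF n(1,2)] p(1) ed by simp
  have inv1: "gp (pt (inv e)) (pt b) x0 \<le> 98 * \<Delta>"
    using act_gp[OF ec, of "pt (inv e)" "pt b" x0] g2 by simp
  have "98 * \<Delta> + 3 * \<Delta> < gp (pt b) (pt e) x0"
    using gp_add'[of "pt b" "pt e" x0] g1 e1 s Delta_pos gp_commute[of "pt b" x0] by simp
  then have "gp (pt e) (pt (inv e)) x0 \<le> 98 * \<Delta> + 3 * \<Delta>"
    using inv1 by (intro hyp_cut[of "pt b"]) (simp_all add: gp_commute)
  then have l1: "gp (pt (inv e)) (pt e) x0 \<le> 101 * \<Delta>" by (simp add: gp_commute)
  show lox: "lox (101 * \<Delta>) e" using l1 e1 s Delta_pos by (simp add: lox_def)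
  have be: "ell a2 - ell a1 - 80 * \<Delta> \<le> dist (pt b) (\<phi> e (pt b))"
    using act_dist[of a1 "pt b" "\<phi> e (pt b)"] p(3) dist_triangle[of x0 "\<phi> a2 (pt b)" "\<phi> a1 (pt b)"] by (simp add: a2)
  have g5: "gp (\<phi> (inv e) (pt b)) (\<phi> e (pt b)) (pt b) \<le> 101 * \<Delta>"
  proof -
    have "gp x0 (\<phi> (inv e) (pt b)) (pt b) = gp (pt e) (pt b) (\<phi> e (pt b))"
      using act_gp[OF ec, of x0 "\<phi> (inv e) (pt b)" "pt b"] by simp
    also have "\<dots> = dist (pt b) (\<phi> e (pt b)) - gp (pt e) (\<phi> e (pt b)) (pt b)"
      using gp_add'[of "pt e" "pt b" "\<phi> e (pt b)"] by (simp add: dist_commute)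
    finally have "98 * \<Delta> + 3 * \<Delta> < gp x0 (\<phi> (inv e) (pt b)) (pt b)" using be g4 s Delta_pos by linarith
    from hyp_cut[OF g3 this] show ?thesis by simp
  qed
  \<comment> \<open>The orbit of the base point in the past, then the single edge [x0, b x0], then
    the orbit of b x0. It is a broken geodesic joining the two ends of \<open>e\<close>, so that
    edge lies along the axis.\<close>
  define P where "P i = (if i \<le> 0 then pt (e [^] i) else \<phi> (e [^] (i - 1)) (pt b))" for i :: int
  have em: "e [^] (i - 1) = e [^] i \<otimes> inv e" "e [^] (i + 1) = e [^] i \<otimes> e" for i :: int
    using int_pow_mult[of e i "-1"] int_pow_mult[of e i 1] by (simp_all add: int_pow_neg)
  have tP: "gp (P (i - 1)) (P (i + 1)) (P i) \<le> 101 * \<Delta>" for i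
  proof -
    consider "i < 0" | "i = 0" | "i = 1" | "1 < i" by linarith
    then show ?thesis
    proof cases
      case 1
      then show ?thesis using l1 by (simp add: P_def em act_mult)
    next
      case 2
      then show ?thesis using inv1 Delta_pos by (simp add: P_def int_pow_neg)
    next
      case 3
      then show ?thesis using g3 Delta_pos by (simp add: P_def)
    next
      case 4
      have e': "e [^] (i - 2) = e [^] (i - 1) \<otimes> inv e" "e [^] i = e [^] (i - 1) \<otimes> e"
        using em(1)[of "i - 1"] em(2)[of "i - 1"] by simp_all
      have "P (i - 1) = \<phi> (e [^] (i - 2)) (pt b)" "P (i + 1) = \<phi> (e [^] i) (pt b)" "P i = \<phi> (e [^] (i - 1)) (pt b)"
        using 4 by (simp_all add: P_def)
      then show ?thesis using g5 unfolding e' by (simp add: act_mult)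
    qed
  qed
  have lP: "2 * (101 * \<Delta>) + 20 * \<Delta> \<le> dist (P i) (P (i + 1))" for i
  proof -
    consider "i < 0" | "i = 0" | "0 < i" by linarith
    then show ?thesis
    proof cases
      case 1
      then show ?thesis using e1 s Delta_pos by (simp add: P_def em act_mult)
    next
      case 2
      then show ?thesis using lb Delta_pos by (simp add: P_def)
    next
      case 3
      have "e [^] i = e [^] (i - 1) \<otimes> e" using em(2)[of "i - 1"] by simp
      then have "P (i + 1) = \<phi> (e [^] (i - 1)) (\<phi> e (pt b))" "P i = \<phi> (e [^] (i - 1)) (pt b)"
        using 3 by (simp_all add: P_def act_mult)
      then show ?thesis using be s Delta_pos by simp
    qed
  qed
  have o1: "gp (en e False k) (pt b) x0 \<le> 107 * \<Delta>" for k
    using broken_geodesic(1)[of P, OF tP lP, of "- int k" 0 1] by (simp add: P_def en_def)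
  have o2: "gp x0 (\<phi> (e [^] int k) (pt b)) (pt b) \<le> 107 * \<Delta>" for k
    using broken_geodesic(1)[of P, OF tP lP, of 0 1 "int k + 1"] by (simp add: P_def)
  have "asy (\<lambda>k. \<phi> (e [^] int k) (pt b)) (en e True)"
    by (rule asy_near[OF asy_en_refl[OF lox], of True _ "ell b"]) (simp add: en_def)
  from end_change1[OF this, of x0 "pt b" "107 * \<Delta>"]
  show "\<forall>\<^sub>F k in sequentially. ord e True (110 * \<Delta>) k x0 (pt b)"
  proof eventually_elim
    case (elim k)
    have "gp (en e True k) x0 (pt b) \<le> 110 * \<Delta>"
      using elim o2[of k] gp_commute[of x0 "\<phi> (e [^] int k) (pt b)" "pt b"] by simp
    then show ?case using o1[of k] Delta_pos by (simp add: ord_def gp_commute)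
  qed
qed

end

section \<open>Axes extracted from large fibres\<close>

context diffuse
begin

text \<open>The hypothesis \<open>ev\<close> says that the axis of \<open>e\<close> runs along \<open>[x0, b x0]\<close>.\<close>

lemma occ_pair_stab:
  assumes e: "lox c e" "c \<le> 500 * \<Delta>" and ev: "\<forall>\<^sub>F k in sequentially. ord e True (110 * \<Delta>) k x0 (pt b)"
    and o: "occ W b g a1" "occ W b g a2" and s: "\<bar>ell a2 - ell a1\<bar> \<le> 2 * H" and H: "10000 * \<kappa> \<le> H"
    and len: "20 * H + real N * ell e + \<kappa> + 10000 * \<Delta> \<le> ell b"
  shows "inv a1 \<otimes> a2 \<in> stab e True"
proof -
  note c [simp] = occ_carrier[OF o(1)] occ_carrier(1)[OF o(2)]
  let ?u = "inv a1 \<otimes> a2"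
  have uc: "?u \<in> carrier G" by simp
  have H0: "10000 * \<Delta> \<le> H" "0 \<le> real N * ell e" using H kappa by simp_all
  have a2: "\<phi> a1 (\<phi> ?u z) = \<phi> a2 z" for z by (simp add: act_mult[symmetric] m_assoc[symmetric])
  have "0 \<le> 3 * H" "3 * H \<le> ell b" "0 \<le> ell b - 3 * H" "ell b - 3 * H \<le> ell b"
    using H0 len kappa Delta_pos by linarith+
  \<comment> \<open>A margin of 3 H at both ends keeps \<open>p\<close> and \<open>q\<close> inside
    the other copy after a shift by at most 2 H.\<close>
  then obtain p q where p: "dist x0 p = 3 * H" "dist p (pt b) = ell b - 3 * H"
    and q: "dist x0 q = ell b - 3 * H" "dist q (pt b) = 3 * H"
    using geod[of "3 * H" x0 "pt b"] geod[of "ell b - 3 * H" x0 "pt b"] by auto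
  have gp0: "gp x0 (pt b) p \<le> 0" "gp x0 (pt b) q \<le> 0" using p q by (simp_all add: gp_def dist_commute)
  have n: "gp x0 (pt g) (pt a1) \<le> 86 * \<Delta>" "gp x0 (pt g) (\<phi> a1 (pt b)) \<le> 86 * \<Delta>"
    "gp x0 (pt g) (\<phi> a2 p) \<le> 86 * \<Delta>" "gp x0 (pt g) (\<phi> a2 q) \<le> 86 * \<Delta>"
    using occ_near(1,2)[OF o(1)] occ_near(5)[OF o(2), of p] occ_near(5)[OF o(2), of q] p q Delta_pos by linarith+
  have pos: "ell a2 + 3 * H - 92 * \<Delta> \<le> dist x0 (\<phi> a2 p)" "dist x0 (\<phi> a2 p) \<le> ell a2 + 3 * H"
    "ell a2 + ell b - 3 * H - 92 * \<Delta> \<le> dist x0 (\<phi> a2 q)" "dist x0 (\<phi> a2 q) \<le> ell a2 + ell b - 3 * H"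
    "ell a1 + ell b - 80 * \<Delta> \<le> dist x0 (\<phi> a1 (pt b))"
    using occ_near(7)[OF o(2), of p] occ_near(7)[OF o(2), of q] occ_near(3)[OF o(1)] p q H0 len kappa Delta_pos by linarith+
  have sp: "ell a1 \<le> dist x0 (\<phi> a2 p)" "dist x0 (\<phi> a2 p) \<le> dist x0 (\<phi> a1 (pt b))"
    "ell a1 \<le> dist x0 (\<phi> a2 q)" "dist x0 (\<phi> a2 q) \<le> dist x0 (\<phi> a1 (pt b))"
    using pos s H0 len kappa Delta_pos by linarith+
  have "gp (pt a1) (\<phi> a1 (pt b)) (\<phi> a2 p) \<le> 178 * \<Delta>"
    using near_between[OF n(1,3,2) sp(1,2)] by simp
  then have up: "gp x0 (pt b) (\<phi> ?u p) \<le> 178 * \<Delta>"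
    using act_gp[of a1 x0 "pt b" "\<phi> ?u p"] by (simp only: a2 c)
  have "gp (pt a1) (\<phi> a1 (pt b)) (\<phi> a2 q) \<le> 178 * \<Delta>"
    using near_between[OF n(1,4,2) sp(3,4)] by simp
  then have uq: "gp x0 (pt b) (\<phi> ?u q) \<le> 178 * \<Delta>"
    using act_gp[of a1 x0 "pt b" "\<phi> ?u q"] by (simp only: a2 c)
  have "dist (pt a1) (\<phi> a2 p) \<le> dist x0 (\<phi> a2 p) - ell a1 + 178 * \<Delta>"
    using near_dist[OF n(1,3)] sp(1) by simp
  moreover have "dist x0 (\<phi> a2 q) - ell a1 \<le> dist (pt a1) (\<phi> a2 q)"
    using dist_triangle[of x0 "\<phi> a2 q" "pt a1"] by simp
  moreover have "dist (pt a1) (\<phi> a2 p) = dist x0 (\<phi> ?u p)" "dist (pt a1) (\<phi> a2 q) = dist x0 (\<phi> ?u q)"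
    using act_dist[of a1 x0 "\<phi> ?u p"] act_dist[of a1 x0 "\<phi> ?u q"] by (simp_all only: a2 c)
  ultimately have ord: "dist x0 (\<phi> ?u p) \<le> dist x0 (\<phi> ?u q)"
    using pos s H0 len kappa Delta_pos by linarith
  have ev': "\<forall>\<^sub>F k in sequentially. ord e True (700 * \<Delta>) k p q \<and> ord e True (700 * \<Delta>) k (\<phi> ?u p) (\<phi> ?u q)"
    using ev
  proof eventually_elim
    case (elim k)
    have "dist x0 p \<le> dist x0 q" using p q H0 len kappa Delta_pos by linarith
    from ord_between[OF elim gp0 this] ord_between[OF elim up uq ord]
    show ?case using Delta_pos by (auto elim!: ord_mono)
  qed
  have "?u \<in> stab e (True = True)"
  proof (rule overlap_stab[OF e _ uc eventually_frequently[OF sequentially_bot ev']])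
    show "700 * \<Delta> \<le> 1600 * \<Delta>" using Delta_pos by simp
    show "real N * ell e + \<kappa> + 10000 * \<Delta> \<le> dist p q"
      using p q dist_triangle[of x0 q p] len H0 Delta_pos by linarith
  qed
  then show ?thesis by simp
qed

text \<open>Seen from \<open>a\<close>, the copy of [x0, b x0] that begins at the earlier occurrence
  covers the stretch leading up to the base point, and it lies along the axis of \<open>e\<close>
  because a^-1 a' preserves the ends. So the last part of \<open>a\<close> follows that
  axis.\<close>

lemma occ_tail:
  assumes ev: "\<forall>\<^sub>F k in sequentially. ord e True (110 * \<Delta>) k x0 (pt b)"
    and o: "occ W b g a'" "occ W b g a" and s: "ell a' \<le> ell a" "ell a - ell a' + 80 * \<Delta> \<le> ell b"
    and st: "inv a \<otimes> a' \<in> stab e True"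
  shows "\<forall>\<^sub>F k in sequentially. ord e True (410 * \<Delta>) k (pt (inv a \<otimes> a')) x0"
proof -
  note c [simp] = occ_carrier[OF o(1)] occ_carrier(1)[OF o(2)]
  let ?u = "inv a \<otimes> a'"
  have n: "gp x0 (pt g) (pt a') \<le> 46 * \<Delta>" "gp x0 (pt g) (pt a) \<le> 46 * \<Delta>" "gp x0 (pt g) (\<phi> a' (pt b)) \<le> 46 * \<Delta>"
    using occ_near(1,2)[OF o(1)] occ_near(1)[OF o(2)] Delta_pos by linarith+
  have "gp (pt a') (\<phi> a' (pt b)) (pt a) \<le> 98 * \<Delta>"
    using near_between[OF n s(1)] occ_near(3)[OF o(1)] s by simp
  moreover have "\<phi> (inv a) (\<phi> a' z) = \<phi> ?u z" for z by (simp add: act_mult)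
  ultimately have g: "gp (pt ?u) (\<phi> ?u (pt b)) x0 \<le> 98 * \<Delta>"
    using act_gp[of "inv a" "pt a'" "\<phi> a' (pt b)" "pt a"] by simp
  have "\<forall>\<^sub>F k in sequentially. ord e True (110 * \<Delta>) k x0 (pt b) \<longrightarrow>
      ord e (True = True) (110 * \<Delta> + 3 * \<Delta>) k (pt ?u) (\<phi> ?u (pt b))" by (rule ord_stab[OF st])
  from eventually_conj[OF ev this] show ?thesis
  proof eventually_elim
    case (elim k)
    then have "ord e True (110 * \<Delta> + 3 * \<Delta>) k (pt ?u) (\<phi> ?u (pt b))" by simp
    from ord_between[OF this _ g, of "pt ?u"] show ?case using Delta_pos by (auto elim!: ord_mono)
  qed
qed

text \<open>The copy that begins at a later occurrence reaches past the end of the copy at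
  \<open>a\<close>, so the beginning of \<open>w\<close> continues along the axis for about the
  difference of the two positions.\<close>

lemma occ_head:
  assumes ev: "\<forall>\<^sub>F k in sequentially. ord e True (110 * \<Delta>) k x0 (pt b)"
    and o: "occ W b g a" "occ W b g a'" and w: "w \<in> W" "g = a \<otimes> (b \<otimes> w)"
    and s: "ell a' - ell a + 80 * \<Delta> \<le> ell b" and t: "200 * \<Delta> \<le> t" "t + 172 * \<Delta> \<le> ell a' - ell a"
    and y: "dist x0 y = t" "dist y (pt w) = ell w - t" and st: "inv a \<otimes> a' \<in> stab e True"
  shows "\<forall>\<^sub>F k in sequentially. ord e True (410 * \<Delta>) k (pt b) (\<phi> b y)"
proof -
  note c [simp] = occ_carrier[OF o(1)] occ_carrier(1)[OF o(2)]
  have wc [simp]: "w \<in> carrier G" using o(1) w by (auto simp: occ_def admissibleD)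
  let ?u = "inv a \<otimes> a'"
  let ?y = "\<phi> a (\<phi> b y)" and ?b = "\<phi> a (pt b)"
  have gw: "pt g = \<phi> a (\<phi> b (pt w))" unfolding w(2) by (simp add: act_mult)
  have d: "dist ?b ?y = t" "dist ?y (pt g) = ell w - t" "dist ?b (pt g) = ell w"
    using y by (simp_all add: gw)
  have n: "gp x0 (pt g) (pt a') \<le> 46 * \<Delta>" "gp x0 (pt g) ?b \<le> 46 * \<Delta>" "gp x0 (pt g) (\<phi> a' (pt b)) \<le> 46 * \<Delta>"
    using occ_near(1,2)[OF o(2)] occ_near(2)[OF o(1)] Delta_pos by linarith+
  have ny: "gp x0 (pt g) ?y \<le> 46 * \<Delta>"
    using n(2) two_gp[of x0 "pt g" ?b] two_gp[of x0 "pt g" ?y] d dist_triangle[of x0 ?y ?b]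
      dist_commute[of "pt g" ?b] dist_commute[of "pt g" ?y] by linarith
  have py: "dist x0 ?b + t - 92 * \<Delta> \<le> dist x0 ?y" "dist x0 ?y \<le> dist x0 ?b + t"
    using n(2) two_gp[of x0 "pt g" ?b] d dist_triangle[of x0 ?y ?b] dist_triangle[of x0 "pt g" ?y]
      dist_commute[of "pt g" ?b] by linarith+
  have p: "ell a' \<le> dist x0 ?b" "dist x0 ?b \<le> dist x0 (\<phi> a' (pt b))" "ell a' \<le> dist x0 ?y" "dist x0 ?y \<le> dist x0 (\<phi> a' (pt b))"
    using occ_near(3,4)[OF o(1)] occ_near(3)[OF o(2)] s t py Delta_pos by linarith+
  have g: "gp (pt a') (\<phi> a' (pt b)) ?b \<le> 98 * \<Delta>" "gp (pt a') (\<phi> a' (pt b)) ?y \<le> 98 * \<Delta>"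
    using near_between[OF n p(1,2)] near_between[OF n(1) ny n(3) p(3,4)] by simp_all
  have u: "\<phi> a (\<phi> ?u z) = \<phi> a' z" for z by (simp add: act_mult[symmetric] m_assoc[symmetric])
  have gb: "gp (pt ?u) (\<phi> ?u (pt b)) (pt b) \<le> 98 * \<Delta>"
    using g(1) act_gp[of a "pt ?u" "\<phi> ?u (pt b)" "pt b"] by (simp only: u c)
  have gy: "gp (pt ?u) (\<phi> ?u (pt b)) (\<phi> b y) \<le> 98 * \<Delta>"
    using g(2) act_gp[of a "pt ?u" "\<phi> ?u (pt b)" "\<phi> b y"] by (simp only: u c)
  have "dist (pt a') ?b \<le> dist x0 ?b - ell a' + 98 * \<Delta>" using near_dist[OF n(1,2)] p(1) by simp
  moreover have "dist x0 ?y - ell a' \<le> dist (pt a') ?y" using dist_triangle[of x0 ?y "pt a'"] by simp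
  moreover have "dist (pt a') ?b = dist (pt ?u) (pt b)" "dist (pt a') ?y = dist (pt ?u) (\<phi> b y)"
    using act_dist[of a "pt ?u" "pt b"] act_dist[of a "pt ?u" "\<phi> b y"] by (simp_all only: u c)
  ultimately have dd: "dist (pt ?u) (pt b) \<le> dist (pt ?u) (\<phi> b y)" using py t Delta_pos by linarith
  have "\<forall>\<^sub>F k in sequentially. ord e True (110 * \<Delta>) k x0 (pt b) \<longrightarrow>
      ord e (True = True) (110 * \<Delta> + 3 * \<Delta>) k (pt ?u) (\<phi> ?u (pt b))" by (rule ord_stab[OF st])
  from eventually_conj[OF ev this] show ?thesis
  proof eventually_elim
    case (elim k)
    then have "ord e True (110 * \<Delta> + 3 * \<Delta>) k (pt ?u) (\<phi> ?u (pt b))" by simp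
    from ord_between[OF this gb gy dd] show ?case using Delta_pos by (auto elim!: ord_mono)
  qed
qed

lemma occ_word_long:
  assumes o: "occ W b g a" "occ W b g a'" and w: "w \<in> W" "g = a \<otimes> (b \<otimes> w)"
  shows "ell a' - ell a \<le> ell w + 172 * \<Delta>"
proof -
  note c [simp] = occ_carrier[OF o(1)]
  have wc [simp]: "w \<in> carrier G" using o(1) w by (auto simp: occ_def admissibleD)
  have "dist (\<phi> a (pt b)) (pt g) = ell w" unfolding w(2) by (simp add: act_mult)
  then show ?thesis
    using occ_near(2,3)[OF o(2)] occ_near(4)[OF o(1)] two_gp[of x0 "pt g" "\<phi> a' (pt b)"]
      dist_triangle[of x0 "pt g" "\<phi> a (pt b)"] zero_le_dist[of "pt g" "\<phi> a' (pt b)"] by linarith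
qed

lemma occ_near_pair:
  assumes o: "occ W b g a'" "occ W b g a" and le: "ell a' \<le> ell a"
  shows "gp x0 (pt a) (pt a') \<le> 92 * \<Delta>"
  using near_between[of x0 "pt g" x0 "43 * \<Delta>" "pt a'" "pt a"] occ_near(1)[OF o(1)] occ_near(1)[OF o(2)] le Delta_pos by simp

text \<open>Both \<open>a\<close> and the slightly earlier a' end with a stretch that follows the
  axis of \<open>e\<close> in their own frames. These stretches overlap on the geodesic, and a'^-1 a
  carries one frame to the other, so it carries a long segment of the axis to the axis.\<close>

lemma occ_two_tails:
  assumes e: "lox c e" "c \<le> 500 * \<Delta>" and ev: "\<forall>\<^sub>F k in sequentially. ord e True (110 * \<Delta>) k x0 (pt b)"
    and o: "occ W b g am" "occ W b g a" and o': "occ W b g' am'" "occ W b g' a'"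
    and st: "inv a \<otimes> am \<in> stab e True" "inv a' \<otimes> am' \<in> stab e True"
    and aa: "gp x0 (pt a) (pt a') \<le> 92 * \<Delta>" "ell a' \<le> ell a"
    and span: "ell a - ell am + 80 * \<Delta> \<le> ell b" "ell a' - ell am' + 80 * \<Delta> \<le> ell b"
    and len: "real N * ell e + \<kappa> + 11000 * \<Delta> \<le> ell a' - ell am" "real N * ell e + \<kappa> + 11000 * \<Delta> \<le> ell a' - ell am'"
  shows "inv a' \<otimes> a \<in> stab e True"
proof -
  note c [simp] = occ_carrier(1)[OF o(1)] occ_carrier(1)[OF o(2)] occ_carrier(1)[OF o'(1)] occ_carrier(1)[OF o'(2)]
  have Nl: "0 \<le> real N * ell e" by simp
  have le: "ell am \<le> ell a'" "ell am' \<le> ell a'" "ell am \<le> ell a" using len aa Nl kappa Delta_pos by linarith+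
  \<comment> \<open>The later of the two tail starts, where the common stretch up to a' x0
    begins.\<close>
  define p where "p = (if ell am' \<le> ell am then pt am else pt am')"
  have n1: "gp x0 (pt a) (pt am) \<le> 92 * \<Delta>" by (rule occ_near_pair[OF o le(3)])
  have n2: "gp x0 (pt a') (pt am') \<le> 92 * \<Delta>" by (rule occ_near_pair[OF o' le(2)])
  have n3: "gp x0 (pt a) (pt am') \<le> 184 * \<Delta>"
    using n2 aa(1) two_gp[of x0 "pt a" "pt am'"] two_gp[of x0 "pt a'" "pt am'"] two_gp[of x0 "pt a" "pt a'"]
      dist_triangle[of "pt a" "pt am'" "pt a'"] by linarith
  have n: "gp x0 (pt a) (pt am) \<le> 184 * \<Delta>" "gp x0 (pt a) (pt am') \<le> 184 * \<Delta>" "gp x0 (pt a) (pt a') \<le> 184 * \<Delta>"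
    "gp x0 (pt a) (pt a) \<le> 184 * \<Delta>" "gp x0 (pt a) p \<le> 184 * \<Delta>"
    using n1 n3 aa(1) Delta_pos by (simp_all add: p_def)
  have pp: "ell am \<le> dist x0 p" "ell am' \<le> dist x0 p" "dist x0 p \<le> ell a'" "dist x0 p \<le> ell a"
    "real N * ell e + \<kappa> + 11000 * \<Delta> \<le> ell a' - dist x0 p"
    using le len aa by (auto simp: p_def)
  have g1: "gp (pt am) (pt a) p \<le> 374 * \<Delta>" "gp (pt am) (pt a) (pt a') \<le> 374 * \<Delta>"
    using near_between[OF n(1,5,4) pp(1,4)] near_between[OF n(1,3,4) le(1) aa(2)] by simp_all
  have g2: "gp (pt am') (pt a') p \<le> 374 * \<Delta>" using near_between[OF n(2,5,3) pp(2,3)] by simp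
  have g2': "gp (pt am') (pt a') (pt a') \<le> 374 * \<Delta>" using Delta_pos by simp
  have dd: "dist (pt am) p \<le> dist (pt am) (pt a')" "dist (pt am') p \<le> dist (pt am') (pt a')"
    using near_dist[OF n(1,5)] near_dist[OF n(2,5)] pp dist_triangle[of x0 "pt a'" "pt am"]
      dist_triangle[of x0 "pt a'" "pt am'"] Nl kappa Delta_pos by linarith+
  let ?u = "inv a' \<otimes> a"
  have uc: "?u \<in> carrier G" by simp
  have inv: "\<phi> (inv a) (pt am) = pt (inv a \<otimes> am)" "\<phi> (inv a') (pt am') = pt (inv a' \<otimes> am')"
    "\<phi> ?u (\<phi> (inv a) z) = \<phi> (inv a') z" for z by (simp_all add: act_mult)
  have ev2: "\<forall>\<^sub>F k in sequentially. ord e True (1600 * \<Delta>) k (\<phi> (inv a) p) (\<phi> (inv a) (pt a')) \<and>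
      ord e True (1600 * \<Delta>) k (\<phi> ?u (\<phi> (inv a) p)) (\<phi> ?u (\<phi> (inv a) (pt a')))"
    using eventually_conj[OF occ_tail[OF ev o le(3) span(1) st(1)] occ_tail[OF ev o' le(2) span(2) st(2)]]
  proof eventually_elim
    case (elim k)
    then have k1: "ord e True (410 * \<Delta>) k (\<phi> (inv a) (pt am)) (\<phi> (inv a) (pt a))"
      and k2: "ord e True (410 * \<Delta>) k (\<phi> (inv a') (pt am')) (\<phi> (inv a') (pt a'))"
      unfolding inv by simp_all
    have "ord e True (410 * \<Delta> + 3 * (374 * \<Delta>) + 3 * \<Delta>) k (\<phi> (inv a) p) (\<phi> (inv a) (pt a'))"
      by (rule ord_between[OF k1]) (use g1 dd in \<open>simp_all del: act_inv\<close>)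
    moreover have "ord e True (410 * \<Delta> + 3 * (374 * \<Delta>) + 3 * \<Delta>) k (\<phi> (inv a') p) (\<phi> (inv a') (pt a'))"
      by (rule ord_between[OF k2]) (use g2 g2' dd in \<open>simp_all del: act_inv\<close>)
    ultimately show ?case unfolding inv(3) using Delta_pos by (auto elim!: ord_mono)
  qed
  have "dist (\<phi> (inv a) p) (\<phi> (inv a) (pt a')) = dist p (pt a')" by (rule act_dist) simp
  then have "real N * ell e + \<kappa> + 10000 * \<Delta> \<le> dist (\<phi> (inv a) p) (\<phi> (inv a) (pt a'))"
    using pp(5) dist_triangle[of x0 "pt a'" p] Delta_pos by linarith
  with overlap_stab[OF e order_refl uc eventually_frequently[OF sequentially_bot ev2]]
  have "?u \<in> stab e (True = True)" by blast
  then show ?thesis by simp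
qed

text \<open>\<open>y x j\<close> is the entry \<open>j\<close> places after \<open>x\<close> in the fibre of \<open>(a, w) \<mapsto> a b w\<close> containing \<open>x\<close>, ordered
  by \<open>ell a\<close>; \<open>s\<close> is the least distance spanned by \<open>m\<close> consecutive entries, and \<open>e\<close> realises it.\<close>
definition axis_blocks ::
    "'a set \<Rightarrow> nat \<Rightarrow> real \<Rightarrow> 'a \<Rightarrow> ('a \<times> 'a) set \<Rightarrow> ('a \<times> 'a \<Rightarrow> int \<Rightarrow> 'a \<times> 'a) \<Rightarrow> 'a \<Rightarrow> real \<Rightarrow> bool" where
  "axis_blocks W m H b Z y e s \<longleftrightarrow> b \<in> B \<and> Z \<subseteq> A \<times> W \<and> lox (101 * \<Delta>) e \<and>
    (\<exists>a1\<in>A. \<exists>a2\<in>A. e = inv a1 \<otimes> a2) \<and> 10000 * \<kappa> \<le> s \<and> s \<le> ell e \<and> ell e \<le> s + 98 * \<Delta> \<and> s \<le> H \<and>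
    (\<forall>\<^sub>F k in sequentially. ord e True (110 * \<Delta>) k x0 (pt b)) \<and>
    (\<forall>x\<in>Z. y x 0 = x \<and>
      (\<forall>j. \<bar>j\<bar> \<le> int (8 * N * m) \<longrightarrow>
        y x j \<in> A \<times> W \<and> occ W b (fst x \<otimes> (b \<otimes> snd x)) (fst (y x j)) \<and> \<bar>ell (fst (y x j)) - ell (fst x)\<bar> \<le> H) \<and>
      (\<forall>i j (t::nat). - int (8 * N * m) \<le> i \<and> i + int (t * m) \<le> j \<and> j \<le> int (8 * N * m) \<longrightarrow>
        real t * s \<le> ell (fst (y x j)) - ell (fst (y x i)))) \<and>
    inj_on (\<lambda>x. y x (- int m)) Z"

text \<open>If the image is small, fibres are long on average, and by \<open>fibre_blocks\<close>
  nine tenths of the pairs sit amid many neighbours within a window of length \<open>H\<close>.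
  Choosing \<open>e\<close> by the least gap makes every later span comparable with multiples of
  \<open>ell e\<close>, although \<open>ell e\<close> itself has no bound in terms of
  \<kappa>.\<close>

lemma axis_blocks_exist:
  assumes W: "admissible W" and b: "b \<in> B" and \<rho>: "\<And>a. a \<in> A \<Longrightarrow> ell a \<le> \<rho>" "1000000000 * real N * \<kappa> \<le> \<rho>" "\<rho> \<le> ell b"
    and H: "H = \<rho> / (100 * real N)" and m: "m = nat \<lfloor>254 * real N * \<kappa> / \<Delta>\<rfloor> + 1"
    and small: "5000000 * real N ^ 3 * \<kappa> / \<Delta> * real (card ((\<lambda>(a, w). a \<otimes> (b \<otimes> w)) ` (A \<times> W))) < real (card (A \<times> W))"
  shows "\<exists>Z y e s. axis_blocks W m H b Z y e s \<and> 10 * real (card (A \<times> W - Z)) < real (card (A \<times> W))"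
proof -
  have N0: "1 \<le> real N" using N1 by simp
  have k1: "1 \<le> \<kappa> / \<Delta>" and k0: "0 \<le> \<kappa>" using kappa Delta_pos by simp_all
  have \<rho>H: "\<rho> = 100 * real N * H" using H N0 by simp
  have H0: "10000000 * \<kappa> \<le> H" using \<rho>(2) N0 unfolding H by (simp add: field_simps)
  have Hp: "0 < H" "10000000 * \<Delta> \<le> H" using H0 kappa Delta_pos by linarith+
  have "H * 1 \<le> H * real N" using N0 Hp by (intro mult_left_mono) auto
  then have HN: "100 * H \<le> \<rho>" unfolding \<rho>H by (simp add: algebra_simps)
  \<comment> \<open>\<open>8 * N\<close> gaps on either side: each spans at least \<open>s\<close>,
    and \<open>ell e\<close> exceeds \<open>s\<close> by at most 98 \<Delta>, so a side is longer
    than the \<open>N\<close> periods needed by \<open>overlap_stab\<close>.\<close>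
  define q where "q = 8 * N * m"
  define f where "f = (\<lambda>(a, w). a \<otimes> (b \<otimes> w))"
  let ?X = "A \<times> W" and ?l = "\<lambda>x. ell (fst x)"
  have fW: "finite W" using W by (simp add: admissible_def)
  have X: "finite ?X" using fin fW by simp
  have "m \<le> q" using N1 mult_le_mono1[of 1 "8 * N" m] by (simp add: q_def)
  obtain Z and y :: "'a \<times> 'a \<Rightarrow> int \<Rightarrow> 'a \<times> 'a" where Z: "Z \<subseteq> ?X"
    and cZ: "real (card (?X - Z)) \<le> (2 * real q + 2 * real q * \<rho> / H) * real (card (f ` ?X))"
    and bl: "\<forall>x\<in>Z. y x 0 = x \<and> (\<forall>j\<in>{- int q..int q}. y x j \<in> ?X \<and> f (y x j) = f x) \<and> inj_on (y x) {- int q..int q} \<and>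
      (\<forall>i j. - int q \<le> i \<and> i \<le> j \<and> j \<le> int q \<longrightarrow> ?l (y x i) \<le> ?l (y x j)) \<and>
      ?l (y x (int q)) - ?l (y x (- int q)) \<le> H"
    and inj: "\<forall>j\<in>{- int q..int q}. inj_on (\<lambda>x. y x j) Z"
    using fibre_blocks[OF X, of ?l \<rho> H q f] \<rho>(1) Hp HN by auto
  have mk: "real m \<le> 255 * (real N * \<kappa> / \<Delta>)"
  proof -
    have "1 * 1 \<le> real N * (\<kappa> / \<Delta>)" using N0 k1 by (intro mult_mono) auto
    then have 1: "1 \<le> real N * \<kappa> / \<Delta>" by simp
    have "real (nat \<lfloor>254 * real N * \<kappa> / \<Delta>\<rfloor>) \<le> 254 * real N * \<kappa> / \<Delta>"
      using k0 Delta_pos by (intro of_nat_floor) simp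
    moreover have "254 * real N * \<kappa> / \<Delta> = 254 * (real N * \<kappa> / \<Delta>)" by simp
    moreover have "real m = real (nat \<lfloor>254 * real N * \<kappa> / \<Delta>\<rfloor>) + 1" by (simp add: m)
    ultimately show ?thesis using 1 by linarith
  qed
  have card: "10 * real (card (?X - Z)) < real (card ?X)"
  proof -
    define E where "E = 2 * real q + 2 * real q * \<rho> / H"
    have "10 * E = 160 * real N * real m * (1 + 100 * real N)"
      using Hp unfolding E_def \<rho>H q_def by (simp add: field_simps)
    also have "\<dots> \<le> 160 * real N * (255 * (real N * \<kappa> / \<Delta>)) * (101 * real N)"
      using mk N0 k0 Delta_pos by (intro mult_mono) auto
    also have "\<dots> = 4120800 * (real N ^ 3 * \<kappa> / \<Delta>)" by (simp add: power3_eq_cube)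
    also have "\<dots> \<le> 5000000 * (real N ^ 3 * \<kappa> / \<Delta>)" using kappa Delta_pos by (intro mult_right_mono) auto
    finally have c: "10 * E \<le> 5000000 * real N ^ 3 * \<kappa> / \<Delta>" by simp
    have "10 * real (card (?X - Z)) \<le> 10 * E * real (card (f ` ?X))"
      using cZ unfolding E_def[symmetric] by simp
    also have "\<dots> \<le> 5000000 * real N ^ 3 * \<kappa> / \<Delta> * real (card (f ` ?X))"
      using c by (intro mult_right_mono) auto
    finally show ?thesis using small unfolding f_def by linarith
  qed
  have Zne: "Z \<noteq> {}"
  proof
    assume "Z = {}"
    then show False using card by simp
  qed
  have fZ: "finite Z" using Z X finite_subset by blast
  have oc: "occ W b (f x) (fst (y x j))" "y x j \<in> ?X" "f (y x j) = f x" if "x \<in> Z" "\<bar>j\<bar> \<le> int q" for x j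
  proof -
    have "j \<in> {- int q..int q}" using that(2) by auto
    then show r: "y x j \<in> ?X" "f (y x j) = f x" using bl that(1) by blast+
    have "f x = fst (y x j) \<otimes> (b \<otimes> snd (y x j))" using r(2) by (simp add: f_def split: prod.splits)
    then show "occ W b (f x) (fst (y x j))" using W b r(1) unfolding occ_def by (metis mem_Times_iff)
  qed
  have mono: "?l (y x i) \<le> ?l (y x j)" if "x \<in> Z" "- int q \<le> i" "i \<le> j" "j \<le> int q" for x i j
    using bl that by blast
  have span: "?l (y x j) - ?l (y x i) \<le> H" if "x \<in> Z" "- int q \<le> i" "i \<le> j" "j \<le> int q" for x i j
  proof -
    have "?l (y x (int q)) - ?l (y x (- int q)) \<le> H" using bl that(1) by blast
    then show ?thesis using mono[OF that(1), of "- int q" i] mono[OF that(1), of j "int q"] that by linarith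
  qed
  \<comment> \<open>Otherwise m + 1 occurrences would lie within 10000 \<kappa>, more than
    \<open>occ_count\<close> permits; this dictates the value of \<open>m\<close>.\<close>
  have gap: "10000 * \<kappa> < ?l (y x (i + int m)) - ?l (y x i)" if x: "x \<in> Z" and i: "- int q \<le> i" "i + int m \<le> int q" for x i
  proof (rule ccontr)
    assume n: "\<not> 10000 * \<kappa> < ?l (y x (i + int m)) - ?l (y x i)"
    define S where "S = (\<lambda>j. fst (y x j)) ` {i..i + int m}"
    have "inj_on (\<lambda>j. fst (y x j)) {i..i + int m}"
    proof (rule inj_onI)
      fix j k assume jk: "j \<in> {i..i + int m}" "k \<in> {i..i + int m}" "fst (y x j) = fst (y x k)"
      have jq: "\<bar>j\<bar> \<le> int q" "\<bar>k\<bar> \<le> int q" using jk i by auto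
      obtain a w w' where yj: "y x j = (a, w)" "y x k = (a, w')" using jk(3) by (metis prod.collapse)
      then have aw: "a \<in> A" "w \<in> W" "w' \<in> W" using oc(2)[OF x jq(1)] oc(2)[OF x jq(2)] by auto
      have "f (a, w) = f (a, w')" using oc(3)[OF x jq(1)] oc(3)[OF x jq(2)] yj by simp
      then have "w = w'"
        using aw Ac[OF aw(1)] Bc[OF b] admissibleD(1)[OF W] by (simp add: f_def)
      then have "y x j = y x k" using yj by simp
      moreover have "inj_on (y x) {- int q..int q}" using bl x by blast
      moreover have "j \<in> {- int q..int q}" "k \<in> {- int q..int q}" using jq by auto
      ultimately show "j = k" by (blast dest: inj_onD)
    qed
    then have cS: "card S = m + 1" unfolding S_def by (simp add: card_image)
    have "real (card S) \<le> real N * ((10000 * \<kappa> + 92 * \<Delta>) / (40 * \<Delta>) + 1)"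
    proof (rule occ_count[of S W b "f x" "?l (y x i)"])
      show "occ W b (f x) a" if "a \<in> S" for a using that oc(1)[OF x] i by (auto simp: S_def)
      show "?l (y x i) \<le> ell a \<and> ell a \<le> ?l (y x i) + 10000 * \<kappa>" if "a \<in> S" for a
      proof -
        obtain j where j: "a = fst (y x j)" "i \<le> j" "j \<le> i + int m" using \<open>a \<in> S\<close> by (auto simp: S_def)
        show ?thesis using mono[OF x i(1) j(2)] mono[OF x _ j(3) i(2)] j i n by auto
      qed
      show "0 \<le> 10000 * \<kappa>" using kappa Delta_pos by simp
    qed (rule b)
    also have "\<dots> = real N * (250 * (\<kappa> / \<Delta>) + 33 / 10)" using Delta_pos by (simp add: field_simps)
    also have "\<dots> \<le> real N * (254 * (\<kappa> / \<Delta>))" using k1 by (intro mult_left_mono) auto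
    also have "\<dots> = 254 * real N * \<kappa> / \<Delta>" by simp
    also have "\<dots> < real m" unfolding m by linarith
    finally show False using cS by simp
  qed
  define gp' where "gp' = (\<lambda>(x, i). ?l (y x (i + int m)) - ?l (y x i))"
  \<comment> \<open>All gaps of \<open>m\<close> steps in all blocks; the one attaining the minimum
    provides \<open>s\<close> and \<open>e\<close>.\<close>
  define P where "P = Z \<times> {- int q..int q - int m}"
  have P: "finite P" "P \<noteq> {}" using fZ Zne \<open>m \<le> q\<close> by (auto simp: P_def)
  have "Min (gp' ` P) \<in> gp' ` P" using P by (intro Min_in) auto
  then obtain p where p: "p \<in> P" "Min (gp' ` P) = gp' p" by (rule imageE)
  obtain x0' i0 where pe: "p = (x0', i0)" by (cases p)
  then have xi: "x0' \<in> Z" "- int q \<le> i0" "i0 + int m \<le> int q" using p by (auto simp: P_def)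
  define s where "s = ?l (y x0' (i0 + int m)) - ?l (y x0' i0)"
  have smin: "s \<le> ?l (y x (i + int m)) - ?l (y x i)" if "x \<in> Z" "- int q \<le> i" "i + int m \<le> int q" for x i
  proof -
    have "(x, i) \<in> P" using that by (simp add: P_def)
    then have "Min (gp' ` P) \<le> gp' (x, i)" using P by simp
    then show ?thesis using p(2) by (simp add: pe gp'_def s_def)
  qed
  have s: "10000 * \<kappa> < s" "s \<le> H" using gap[OF xi] span[OF xi(1,2) _ xi(3)] by (auto simp: s_def)
  have tgap: "real t * s \<le> ?l (y x (i + int (t * m))) - ?l (y x i)"
    if "x \<in> Z" "- int q \<le> i" "i + int (t * m) \<le> int q" for x i and t :: nat
    using that(3)
  proof (induction t)
    case (Suc t)
    have e: "i + int (Suc t * m) = i + int (t * m) + int m" by (simp add: algebra_simps)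
    have "real t * s \<le> ?l (y x (i + int (t * m))) - ?l (y x i)" using Suc e by linarith
    moreover have "s \<le> ?l (y x (i + int (t * m) + int m)) - ?l (y x (i + int (t * m)))"
    proof (rule smin[OF that(1)])
      have "0 \<le> int (t * m)" by simp
      then show "- int q \<le> i + int (t * m)" using that(2) by linarith
    qed (use Suc.prems e in linarith)
    moreover have "real (Suc t) * s = real t * s + s" by (simp add: algebra_simps)
    ultimately show ?case unfolding e by linarith
  qed simp
  let ?a1 = "fst (y x0' i0)" and ?a2 = "fst (y x0' (i0 + int m))"
  have i0q: "\<bar>i0\<bar> \<le> int q" "\<bar>i0 + int m\<bar> \<le> int q" using xi by auto
  have sa: "10000 * \<Delta> \<le> ell ?a2 - ell ?a1" "2 * ell ?a2 \<le> 2 * ell ?a1 + ell b"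
    using s HN \<rho>(3) kappa Hp unfolding s_def by linarith+
  note ax = occ_shift_lox[OF oc(1)[OF xi(1) i0q(1)] oc(1)[OF xi(1) i0q(2)] sa]
  have a12: "?a1 \<in> A" "?a2 \<in> A" using oc(2)[OF xi(1) i0q(1)] oc(2)[OF xi(1) i0q(2)] by auto
  have "axis_blocks W m H b Z y (inv ?a1 \<otimes> ?a2) s"
    unfolding axis_blocks_def q_def[symmetric]
  proof (intro conjI ballI allI impI)
    show "lox (101 * \<Delta>) (inv ?a1 \<otimes> ?a2)" "\<forall>\<^sub>F k in sequentially. ord (inv ?a1 \<otimes> ?a2) True (110 * \<Delta>) k x0 (pt b)"
      by (rule ax)+
    show "s \<le> ell (inv ?a1 \<otimes> ?a2)" "ell (inv ?a1 \<otimes> ?a2) \<le> s + 98 * \<Delta>" using ax(2,3) by (simp_all add: s_def)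
    show "\<exists>a1\<in>A. \<exists>a2\<in>A. inv ?a1 \<otimes> ?a2 = inv a1 \<otimes> a2" using a12 by blast
    show "b \<in> B" "Z \<subseteq> A \<times> W" "10000 * \<kappa> \<le> s" "s \<le> H" using b Z s by simp_all
    show "inj_on (\<lambda>x. y x (- int m)) Z" using inj \<open>m \<le> q\<close> by simp
    fix x assume x: "x \<in> Z"
    show y0: "y x 0 = x" using bl x by blast
    {
      fix j assume j: "\<bar>j\<bar> \<le> int q"
      show "y x j \<in> A \<times> W" by (rule oc(2)[OF x j])
      show "occ W b (fst x \<otimes> (b \<otimes> snd x)) (fst (y x j))" using oc(1)[OF x j] by (simp add: f_def split: prod.splits)
      show "\<bar>ell (fst (y x j)) - ell (fst x)\<bar> \<le> H"
        using span[OF x, of 0 j] span[OF x, of j 0] mono[OF x, of 0 j] mono[OF x, of j 0] j y0 by (cases "0 \<le> j") auto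
    }
    fix i j and t :: nat assume ij: "- int q \<le> i \<and> i + int (t * m) \<le> j \<and> j \<le> int q"
    have 0: "- int q \<le> i" "i + int (t * m) \<le> j" "j \<le> int q" using ij by auto
    have "0 \<le> int (t * m)" by simp
    then have 1: "- int q \<le> i + int (t * m)" "i + int (t * m) \<le> int q" using 0 by linarith+
    show "real t * s \<le> ell (fst (y x j)) - ell (fst (y x i))"
      using tgap[OF x 0(1) 1(2)] mono[OF x 1(1) 0(2,3)] by linarith
  qed
  then show ?thesis using card by blast
qed

lemma axis_blocksD:
  assumes "axis_blocks W m H b Z y e s"
  shows "b \<in> B" "lox (101 * \<Delta>) e" "10000 * \<kappa> \<le> s" "s \<le> ell e" "ell e \<le> s + 98 * \<Delta>" "s \<le> H"
    "\<forall>\<^sub>F k in sequentially. ord e True (110 * \<Delta>) k x0 (pt b)" "Z \<subseteq> A \<times> W" "\<exists>a1\<in>A. \<exists>a2\<in>A. e = inv a1 \<otimes> a2"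
    "inj_on (\<lambda>x. y x (- int m)) Z" "x \<in> Z \<Longrightarrow> y x 0 = x"
    "x \<in> Z \<Longrightarrow> \<bar>j\<bar> \<le> int (8 * N * m) \<Longrightarrow> y x j \<in> A \<times> W"
    "x \<in> Z \<Longrightarrow> \<bar>j\<bar> \<le> int (8 * N * m) \<Longrightarrow> occ W b (fst x \<otimes> (b \<otimes> snd x)) (fst (y x j))"
    "x \<in> Z \<Longrightarrow> \<bar>j\<bar> \<le> int (8 * N * m) \<Longrightarrow> \<bar>ell (fst (y x j)) - ell (fst x)\<bar> \<le> H"
    "x \<in> Z \<Longrightarrow> - int (8 * N * m) \<le> i \<Longrightarrow> i + int (t * m) \<le> j \<Longrightarrow> j \<le> int (8 * N * m) \<Longrightarrow>
      real t * s \<le> ell (fst (y x j)) - ell (fst (y x i))"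
  using assms unfolding axis_blocks_def by blast+

context
  fixes H :: real
  assumes wide: "\<And>b. b \<in> B \<Longrightarrow> 100 * real N * H \<le> ell b"
begin

lemma axis_blocks_size:
  assumes bl: "axis_blocks W m H b Z y e s"
  shows "10000 * \<Delta> \<le> s" "real N * ell e \<le> real N * s + 98 * (real N * \<Delta>)" "real N * s \<le> real N * H"
    "10000 * (real N * \<Delta>) \<le> real N * s" "10000 * (real N * \<kappa>) \<le> real N * s" "\<Delta> \<le> real N * \<Delta>" "\<kappa> \<le> real N * \<kappa>" "H \<le> real N * H"
    "s \<le> real N * s"
proof -
  note d = axis_blocksD[OF bl]
  have N0: "1 \<le> real N" using N1 by simp
  show s: "10000 * \<Delta> \<le> s" using d(3) kappa by linarith
  have p: "0 \<le> s" "0 \<le> \<kappa>" "0 \<le> H" using s d(6) kappa Delta_pos by linarith+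
  show "real N * ell e \<le> real N * s + 98 * (real N * \<Delta>)"
    using mult_left_mono[OF d(5), of "real N"] by (simp add: algebra_simps)
  show "real N * s \<le> real N * H" using d(6) by (intro mult_left_mono) auto
  show "10000 * (real N * \<Delta>) \<le> real N * s" using mult_left_mono[OF s, of "real N"] by (simp add: algebra_simps)
  show "10000 * (real N * \<kappa>) \<le> real N * s" using mult_left_mono[OF d(3), of "real N"] by (simp add: algebra_simps)
  show "\<Delta> \<le> real N * \<Delta>" "\<kappa> \<le> real N * \<kappa>" "H \<le> real N * H" "s \<le> real N * s"
    using mult_right_mono[OF N0, of \<Delta>] mult_right_mono[OF N0, of \<kappa>] mult_right_mono[OF N0, of H]
      mult_right_mono[OF N0, of s] p Delta_pos by simp_all
qed

lemma axis_blocks_pair: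
  assumes bl: "axis_blocks W m H b Z y e s" and x: "x \<in> Z"
    and ij: "\<bar>i\<bar> \<le> int (8 * N * m)" "\<bar>j\<bar> \<le> int (8 * N * m)"
  shows "inv (fst (y x i)) \<otimes> fst (y x j) \<in> stab e True"
proof -
  note d = axis_blocksD[OF bl] and z = axis_blocks_size[OF bl]
  have h: "100 * (real N * H) \<le> ell b" using wide[OF d(1)] by simp
  show ?thesis
  proof (rule occ_pair_stab[OF d(2) _ d(7) d(13)[OF x ij(1)] d(13)[OF x ij(2)], of H])
    show "101 * \<Delta> \<le> 500 * \<Delta>" using Delta_pos by simp
    show "\<bar>ell (fst (y x j)) - ell (fst (y x i))\<bar> \<le> 2 * H" using d(14)[OF x ij(1)] d(14)[OF x ij(2)] by linarith
    show "10000 * \<kappa> \<le> H" using d(3,6) by linarith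
    show "20 * H + real N * ell e + \<kappa> + 10000 * \<Delta> \<le> ell b" using z h d(3,6) kappa Delta_pos by linarith
  qed
qed

text \<open>The quotient \<open>u\<close> of \<open>x\<close> and its predecessor in the block for
  \<open>b\<close> lies in the stabiliser of \<open>e\<close>. Both entries also have tails along
  the axis of e' from their blocks for \<open>c\<close>, so \<open>u\<close> lies in that stabiliser
  too. As \<open>u\<close> is long, it is loxodromic and its ends are those of both \<open>e\<close>
  and e'.\<close>

lemma axis_blocks_ends:
  assumes bl: "axis_blocks W m H b Z y e s" and bl': "axis_blocks W m H c Z' y' e' s'"
    and x: "x \<in> Z" "x \<in> Z'" "y x (- int m) \<in> Z'" and le: "ell (fst (y' x (- int m))) \<le> ell (fst (y x (- int m)))"
  shows "\<exists>\<tau>. \<forall>\<sigma>. asy (en e \<sigma>) (en e' (\<sigma> = \<tau>))"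
proof -
  note d = axis_blocksD[OF bl] and z = axis_blocks_size[OF bl]
  note d' = axis_blocksD[OF bl'] and z' = axis_blocks_size[OF bl']
  define q where "q = 8 * N * m"
  have h: "100 * (real N * H) \<le> ell c" using wide[OF d'(1)] by simp
  have mq: "m \<le> q" using N1 mult_le_mono1[of 1 "8 * N" m] by (simp add: q_def)
  have i: "\<bar>- int m\<bar> \<le> int (8 * N * m)" "\<bar>- int q\<bar> \<le> int (8 * N * m)" "\<bar>0\<bar> \<le> int (8 * N * m)"
    using mq by (simp_all add: q_def del: of_nat_mult)
  have y0: "y x 0 = x" "y' x 0 = x" "y' (y x (- int m)) 0 = y x (- int m)"
    using d(11)[OF x(1)] d'(11)[OF x(2)] d'(11)[OF x(3)] by simp_all
  define x' where "x' = y x (- int m)"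
  define u where "u = inv (fst x') \<otimes> fst x"
  have g1: "real 1 * s \<le> ell (fst x) - ell (fst x')"
    using d(15)[OF x(1), of "- int m" 1 0] mq y0 by (simp add: q_def x'_def del: of_nat_mult)
  \<comment> \<open>By \<open>le\<close>, \<open>x'\<close> lies no earlier than the m-th
    predecessor of \<open>x\<close> in the block for \<open>c\<close>, so 8 N - 1 gaps of that block
    still precede it.\<close>
  have "(8 * N - 1) * m = q - m" by (simp add: q_def diff_mult_distrib)
  then have mm: "int ((8 * N - 1) * m) = int q - int m" using mq by (simp add: of_nat_diff del: of_nat_mult)
  have g2: "real (8 * N - 1) * s' \<le> ell (fst (y' x (- int m))) - ell (fst (y' x (- int q)))"
    using d'(15)[OF x(2), of "- int q" "8 * N - 1" "- int m"] mm
    by (simp add: q_def del: of_nat_mult)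
  have g3: "real (8 * N) * s' \<le> ell (fst x') - ell (fst (y' x' (- int q)))"
    using d'(15)[OF x(3), of "- int q" "8 * N" 0] y0
    by (simp add: q_def x'_def del: of_nat_mult)
  have "real (8 * N - 1) = 8 * real N - 1" using N1 by simp
  then have r: "real (8 * N - 1) * s' = 8 * (real N * s') - s'" "real (8 * N) * s' = 8 * (real N * s')"
    by (simp_all add: left_diff_distrib)
  note dx = d(13)[OF x(1) i(1)] d(13)[OF x(1) i(3)]
  have near: "gp x0 (pt (fst x)) (pt (fst x')) \<le> 92 * \<Delta>" "ell (fst x') \<le> ell (fst x)"
    using occ_near_pair[OF dx] g1 y0 z Delta_pos by (simp_all add: x'_def)
  have us: "u \<in> stab e' True"
    unfolding u_def
  proof (rule occ_two_tails[OF d'(2) _ d'(7) d'(13)[OF x(2) i(2)] d'(13)[OF x(2) i(3), unfolded y0]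
        d'(13)[OF x(3) i(2)] d'(13)[OF x(3) i(3), unfolded y0], folded x'_def])
    show "101 * \<Delta> \<le> 500 * \<Delta>" using Delta_pos by simp
    show "inv (fst x) \<otimes> fst (y' x (- int q)) \<in> stab e' True" using axis_blocks_pair[OF bl' x(2) i(3,2)] y0 by simp
    show "inv (fst x') \<otimes> fst (y' x' (- int q)) \<in> stab e' True"
      using axis_blocks_pair[OF bl' x(3) i(3,2)] y0 by (simp add: x'_def)
    show "gp x0 (pt (fst x)) (pt (fst x')) \<le> 92 * \<Delta>" "ell (fst x') \<le> ell (fst x)" by (rule near)+
    show "ell (fst x) - ell (fst (y' x (- int q))) + 80 * \<Delta> \<le> ell c"
      using d'(14)[OF x(2) i(2)] z' h d'(6) Delta_pos by linarith
    show "ell (fst x') - ell (fst (y' x' (- int q))) + 80 * \<Delta> \<le> ell c"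
      using d'(14)[OF x(3) i(2)] z' h d'(6) Delta_pos unfolding x'_def by linarith
    show "real N * ell e' + \<kappa> + 11000 * \<Delta> \<le> ell (fst x') - ell (fst (y' x (- int q)))"
      using g2 le r z' d'(3) kappa Delta_pos unfolding x'_def by linarith
    show "real N * ell e' + \<kappa> + 11000 * \<Delta> \<le> ell (fst x') - ell (fst (y' x' (- int q)))"
      using g3 r z' d'(3) kappa Delta_pos by linarith
  qed
  have us': "u \<in> stab e True" using axis_blocks_pair[OF bl x(1) i(1,3)] y0 by (simp add: u_def x'_def)
  have xc: "fst x \<in> carrier G" "fst x' \<in> carrier G"
    using occ_carrier(1)[OF dx(1)] occ_carrier(1)[OF dx(2)] y0 by (simp_all add: x'_def)
  have "s \<le> ell u"
    using g1 dist_triangle[of x0 "pt (fst x)" "pt (fst x')"] dist_pt[OF xc(2,1)] by (simp add: u_def)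
  then have ul: "10000 * \<Delta> \<le> ell u" using z(1) by linarith
  have cc: "101 * \<Delta> \<le> 500 * \<Delta>" "101 * \<Delta> \<le> 400 * \<Delta>" "101 * \<Delta> + 18 * \<Delta> \<le> 500 * \<Delta>" using Delta_pos by simp_all
  have ulx: "lox (101 * \<Delta> + 18 * \<Delta>) u" by (rule stab_lox[OF d(2) cc(2) us' ul])
  obtain \<tau>1 where t1: "asy (en u \<sigma>) (en e (\<sigma> = \<tau>1))" for \<sigma>
    using same_ends[OF d(2) cc(1) ulx cc(3) ul us'] by blast
  obtain \<tau>2 where t2: "asy (en u \<sigma>) (en e' (\<sigma> = \<tau>2))" for \<sigma>
    using same_ends[OF d'(2) cc(1) ulx cc(3) ul us] by blast
  have "asy (en e \<sigma>) (en e' (\<sigma> = (\<tau>1 = \<tau>2)))" for \<sigma>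
  proof -
    have "((\<sigma> = \<tau>1) = \<tau>1) = \<sigma>" "((\<sigma> = \<tau>1) = \<tau>2) = (\<sigma> = (\<tau>1 = \<tau>2))" by auto
    then show ?thesis using asy_trans[OF asy_sym[OF t1[of "\<sigma> = \<tau>1"]] t2[of "\<sigma> = \<tau>1"]] by simp
  qed
  then show ?thesis by blast
qed

text \<open>The word w = \<open>snd x\<close> begins along the axis of \<open>e\<close> when it
  follows \<open>b\<close>, and along the axis of e' when it follows \<open>c\<close>. Thus c b^-1
  carries a long segment of the axis to a segment along the same two ends.\<close>

lemma axis_blocks_coset:
  assumes bl: "axis_blocks W m H b Z y e s" and bl': "axis_blocks W m H c Z' y' e' s'"
    and x: "x \<in> Z" "x \<in> Z'" and ss: "s \<le> s'" and en: "\<And>\<sigma>. asy (en e \<sigma>) (en e' (\<sigma> = \<tau>))"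
  shows "c \<otimes> inv b \<in> stab e True \<union> stab e False"
proof -
  note d = axis_blocksD[OF bl] and z = axis_blocks_size[OF bl]
  note d' = axis_blocksD[OF bl'] and z' = axis_blocks_size[OF bl']
  define q where "q = 8 * N * m"
  have h: "100 * (real N * H) \<le> ell b" "100 * (real N * H) \<le> ell c" using wide[OF d(1)] wide[OF d'(1)] by simp_all
  have i: "\<bar>int q\<bar> \<le> int (8 * N * m)" "\<bar>0\<bar> \<le> int (8 * N * m)" by (simp_all add: q_def)
  have y0: "y x 0 = x" "y' x 0 = x" using d(11)[OF x(1)] d'(11)[OF x(2)] by simp_all
  note ob = d(13)[OF x(1) i(2), unfolded y0] d(13)[OF x(1) i(1)]
  note oc = d'(13)[OF x(2) i(2), unfolded y0] d'(13)[OF x(2) i(1)]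
  have w: "snd x \<in> W" using d(8) x by auto
  have g: "real (8 * N) * s \<le> ell (fst (y x (int q))) - ell (fst x)"
    "real (8 * N) * s' \<le> ell (fst (y' x (int q))) - ell (fst x)"
    using d(15)[OF x(1), of 0 "8 * N" "int q"] d'(15)[OF x(2), of 0 "8 * N" "int q"] y0 by (simp_all add: q_def)
  have r: "real (8 * N) * s = 8 * (real N * s)" "real (8 * N) * s' = 8 * (real N * s')" by simp_all
  have Ns: "real N * s \<le> real N * s'" using ss by (intro mult_left_mono) auto
  \<comment> \<open>172 \<Delta> is the loss in \<open>occ_head\<close>; since s <= s', this length
    is also available after \<open>c\<close>.\<close>
  define t where "t = 8 * (real N * s) - 172 * \<Delta>"
  have t: "200 * \<Delta> \<le> t" "t + 172 * \<Delta> \<le> ell (fst (y x (int q))) - ell (fst x)"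
    "t + 172 * \<Delta> \<le> ell (fst (y' x (int q))) - ell (fst x)"
    using g Ns z(1,9) Delta_pos unfolding t_def r by linarith+
  have "t \<le> ell (snd x)" using occ_word_long[OF ob w refl] t by linarith
  then obtain p where p: "dist x0 p = t" "dist p (pt (snd x)) = ell (snd x) - t"
    using geod[of t x0 "pt (snd x)"] t Delta_pos by auto
  have H0: "80 * \<Delta> \<le> H" "0 \<le> H" using z d(6) Delta_pos by linarith+
  have hb: "\<forall>\<^sub>F k in sequentially. ord e True (410 * \<Delta>) k (pt b) (\<phi> b p)"
  proof (rule occ_head[OF d(7) ob w refl _ t(1,2) p])
    show "ell (fst (y x (int q))) - ell (fst x) + 80 * \<Delta> \<le> ell b"
      using d(14)[OF x(1) i(1)] h z H0 by linarith
    show "inv (fst x) \<otimes> fst (y x (int q)) \<in> stab e True" using axis_blocks_pair[OF bl x(1) i(2,1)] y0 by simp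
  qed
  have hc: "\<forall>\<^sub>F k in sequentially. ord e' True (410 * \<Delta>) k (pt c) (\<phi> c p)"
  proof (rule occ_head[OF d'(7) oc w refl _ t(1,3) p])
    show "ell (fst (y' x (int q))) - ell (fst x) + 80 * \<Delta> \<le> ell c"
      using d'(14)[OF x(2) i(1)] h z H0 by linarith
    show "inv (fst x) \<otimes> fst (y' x (int q)) \<in> stab e' True" using axis_blocks_pair[OF bl' x(2) i(2,1)] y0 by simp
  qed
  have bc [simp]: "b \<in> carrier G" "c \<in> carrier G" using d(1) d'(1) by (auto intro: Bc)
  have gc: "\<phi> (c \<otimes> inv b) (\<phi> b v) = \<phi> c v" for v by (simp add: act_mult)
  have e': "asy (en e' False) (en e (\<not> \<tau>))" "asy (en e' True) (en e \<tau>)"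
    using asy_sym[OF en[of "\<not> \<tau>"]] asy_sym[OF en[of \<tau>]] by simp_all
  have ev: "\<forall>\<^sub>F k in sequentially. (\<exists>\<sigma>. ord e \<sigma> (413 * \<Delta>) k (pt b) (\<phi> b p)) \<and>
      (\<exists>\<sigma>. ord e \<sigma> (413 * \<Delta>) k (\<phi> (c \<otimes> inv b) (pt b)) (\<phi> (c \<otimes> inv b) (\<phi> b p)))"
    using hb hc end_change1[OF e'(1), of "\<phi> c p" "pt c" "410 * \<Delta>"] end_change1[OF e'(2), of "pt c" "\<phi> c p" "410 * \<Delta>"]
  proof eventually_elim
    case (elim k)
    have "ord e \<tau> (413 * \<Delta>) k (pt c) (\<phi> c p)"
      using elim(2-4) by (simp add: ord_def gp_commute[of "pt c"])
    moreover have "ord e True (413 * \<Delta>) k (pt b) (\<phi> b p)" using elim(1) Delta_pos by (auto elim: ord_mono)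
    ultimately show ?case unfolding gc by blast
  qed
  show ?thesis
  proof (rule overlap_stab_unordered[OF d(2) _ _ _ ev])
    show "101 * \<Delta> \<le> 500 * \<Delta>" "413 * \<Delta> \<le> 1600 * \<Delta>" "c \<otimes> inv b \<in> carrier G" using Delta_pos by simp_all
    show "real N * ell e + \<kappa> + 10000 * \<Delta> \<le> dist (pt b) (\<phi> b p)"
    proof -
      have "dist (pt b) (\<phi> b p) = t" using p by simp
      then show ?thesis using z d(3) kappa Delta_pos unfolding t_def by linarith
    qed
  qed
qed

text \<open>Four bad sets each hold less than a tenth of the pairs, the last two because passing to
  the m-th predecessor is injective. So some \<open>x\<close> is good for \<open>b\<close> and
  \<open>c\<close> together with both its predecessors; which predecessor is later decides the roles
  of \<open>b\<close> and \<open>c\<close>.\<close>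

lemma axis_blocks_common:
  assumes bl: "axis_blocks W m H b Z y e s" and bl': "axis_blocks W m H c Z' y' e' s'" and W: "finite W"
    and card: "10 * real (card (A \<times> W - Z)) < real (card (A \<times> W))" "10 * real (card (A \<times> W - Z')) < real (card (A \<times> W))"
  shows "c \<otimes> inv b \<in> stab e True \<union> stab e False"
proof -
  note d = axis_blocksD[OF bl] and d' = axis_blocksD[OF bl']
  let ?X = "A \<times> W"
  have X: "finite ?X" using fin W by simp
  have "m \<le> 8 * N * m" using N1 mult_le_mono1[of 1 "8 * N" m] by simp
  then have m8: "\<bar>- int m\<bar> \<le> int (8 * N * m)" by (simp del: of_nat_mult)
  let ?B = "{x \<in> Z. y x (- int m) \<notin> Z'}" and ?B' = "{x \<in> Z'. y' x (- int m) \<notin> Z}"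
  have "card ?B \<le> card (?X - Z')"
  proof (rule card_inj_on_le[of "\<lambda>x. y x (- int m)"])
    show "inj_on (\<lambda>x. y x (- int m)) ?B" using d(10) by (rule inj_on_subset) auto
    show "(\<lambda>x. y x (- int m)) ` ?B \<subseteq> ?X - Z'" using d(12)[OF _ m8] by blast
  qed (use X in simp)
  moreover have "card ?B' \<le> card (?X - Z)"
  proof (rule card_inj_on_le[of "\<lambda>x. y' x (- int m)"])
    show "inj_on (\<lambda>x. y' x (- int m)) ?B'" using d'(10) by (rule inj_on_subset) auto
    show "(\<lambda>x. y' x (- int m)) ` ?B' \<subseteq> ?X - Z" using d'(12)[OF _ m8] by blast
  qed (use X in simp)
  moreover have "card ((?X - Z) \<union> (?X - Z') \<union> ?B \<union> ?B') \<le> card (?X - Z) + card (?X - Z') + card ?B + card ?B'"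
    by (intro order_trans[OF card_Un_le] add_mono) auto
  ultimately have less: "card ((?X - Z) \<union> (?X - Z') \<union> ?B \<union> ?B') < card ?X" using card by linarith
  have finS: "finite ((?X - Z) \<union> (?X - Z') \<union> ?B \<union> ?B')"
    using X finite_subset[OF d(8) X] finite_subset[OF d'(8) X] by simp
  have "\<not> ?X \<subseteq> (?X - Z) \<union> (?X - Z') \<union> ?B \<union> ?B'"
    using card_mono[OF finS, of ?X] less by linarith
  then obtain x where x: "x \<in> Z" "x \<in> Z'" "y x (- int m) \<in> Z'" "y' x (- int m) \<in> Z" by blast
  have "\<exists>\<tau>. \<forall>\<sigma>. asy (en e \<sigma>) (en e' (\<sigma> = \<tau>))"
  proof (cases "ell (fst (y' x (- int m))) \<le> ell (fst (y x (- int m)))")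
    case True
    then show ?thesis by (rule axis_blocks_ends[OF bl bl' x(1-3)])
  next
    case False
    then obtain \<tau> where t: "asy (en e' \<sigma>) (en e (\<sigma> = \<tau>))" for \<sigma>
      using axis_blocks_ends[OF bl' bl x(2,1,4)] by auto
    have "asy (en e \<sigma>) (en e' (\<sigma> = \<tau>))" for \<sigma>
    proof -
      have "((\<sigma> = \<tau>) = \<tau>) = \<sigma>" by auto
      then show ?thesis using asy_sym[OF t[of "\<sigma> = \<tau>"]] by simp
    qed
    then show ?thesis by blast
  qed
  then obtain \<tau> where t: "asy (en e \<sigma>) (en e' (\<sigma> = \<tau>))" for \<sigma> by blast
  show ?thesis
  proof (cases "s \<le> s'")
    case True
    then show ?thesis by (rule axis_blocks_coset[OF bl bl' x(1,2) _ t])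
  next
    case False
    have t': "asy (en e' \<sigma>) (en e (\<sigma> = \<tau>))" for \<sigma>
    proof -
      have "((\<sigma> = \<tau>) = \<tau>) = \<sigma>" by auto
      then show ?thesis using asy_sym[OF t[of "\<sigma> = \<tau>"]] by simp
    qed
    have "b \<otimes> inv c \<in> stab e' True \<union> stab e' False"
      using False by (intro axis_blocks_coset[OF bl' bl x(2,1) _ t']) auto
    then obtain \<rho> where "b \<otimes> inv c \<in> stab e \<rho>"
      using stab_eq_of_ends[of e' e \<tau>] t' by blast
    then have "inv (b \<otimes> inv c) \<in> stab e \<rho>" by (rule stab_inv)
    then have "c \<otimes> inv b \<in> stab e \<rho>" using Bc[OF d(1)] Bc[OF d'(1)] by (simp add: inv_mult_group)
    then show ?thesis by (cases \<rho>) auto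
  qed
qed

end

end

subsection \<open>Growth or a common axis\<close>

context diffuse
begin

text \<open>If all letters of \<open>A\<close> are at most 10^9 N \<kappa> long, the count by
  acylindricity over their whole range is enough. Otherwise either some \<open>b\<close> has a large
  image or all do badly, and then every \<open>b\<close> has blocks to compare with those of
  \<open>b0\<close>.\<close>

lemma diffuse_step:
  assumes W: "admissible W" "W \<noteq> {}" and b0: "b0 \<in> B" and M: "M = 30000000 * real N ^ 3 * \<kappa> / \<Delta>"
  shows "(\<exists>b\<in>B. real (card A) * real (card W) \<le> M * real (card ((\<lambda>(a, w). a \<otimes> (b \<otimes> w)) ` (A \<times> W)))) \<or>
    (\<exists>e. lox (101 * \<Delta>) e \<and> 10000 * \<kappa> \<le> ell e \<and> (\<exists>a1\<in>A. \<exists>a2\<in>A. e = inv a1 \<otimes> a2) \<and>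
      (\<forall>b\<in>B. b \<otimes> inv b0 \<in> stab e True \<union> stab e False))"
proof -
  have fW: "finite W" using W by (simp add: admissible_def)
  have N0: "1 \<le> real N" using N1 by simp
  define \<rho> where "\<rho> = Max (ell ` A)"
  have \<rho>: "ell a \<le> \<rho>" if "a \<in> A" for a using that fin by (simp add: \<rho>_def)
  have "\<rho> \<in> ell ` A" unfolding \<rho>_def using fin ne by (intro Max_in) auto
  then obtain am where am: "am \<in> A" "\<rho> = ell am" by blast
  have \<rho>B: "\<rho> \<le> ell b" if "b \<in> B" for b using shorter[OF am(1) that] am by simp
  have k0: "0 \<le> \<kappa> / \<Delta>" "1 \<le> \<kappa> / \<Delta>" using kappa Delta_pos by simp_all
  show ?thesis
  proof (cases "1000000000 * real N * \<kappa> \<le> \<rho>")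
    case True
    define M' where "M' = 5000000 * real N ^ 3 * \<kappa> / \<Delta>"
    define Q where "Q = real N ^ 3 * (\<kappa> / \<Delta>)"
    have "0 \<le> Q" unfolding Q_def using k0 by (intro mult_nonneg_nonneg) auto
    moreover have "M = 30000000 * Q" "M' = 5000000 * Q" by (simp_all add: M M'_def Q_def)
    ultimately have "M' \<le> M" by linarith
    then have MM: "M' * real c \<le> M * real c" for c by (intro mult_right_mono) auto
    have alt: "\<exists>e. lox (101 * \<Delta>) e \<and> 10000 * \<kappa> \<le> ell e \<and> (\<exists>a1\<in>A. \<exists>a2\<in>A. e = inv a1 \<otimes> a2) \<and>
        (\<forall>b\<in>B. b \<otimes> inv b0 \<in> stab e True \<union> stab e False)"
      if bad: "\<forall>b\<in>B. M' * real (card ((\<lambda>(a, w). a \<otimes> (b \<otimes> w)) ` (A \<times> W))) < real (card (A \<times> W))"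
    proof -
      define H where "H = \<rho> / (100 * real N)"
      define m where "m = nat \<lfloor>254 * real N * \<kappa> / \<Delta>\<rfloor> + 1"
      have ex: "\<exists>Z y e s. axis_blocks W m H b Z y e s \<and> 10 * real (card (A \<times> W - Z)) < real (card (A \<times> W))" if "b \<in> B" for b
        by (rule axis_blocks_exist[OF W(1) that \<rho> True \<rho>B[OF that] H_def m_def bspec[OF bad[unfolded M'_def] that]])
      have wide: "100 * real N * H \<le> ell b" if "b \<in> B" for b
        using \<rho>B[OF that] N0 by (simp add: H_def)
      obtain Z0 y0 e s0 where 0: "axis_blocks W m H b0 Z0 y0 e s0" "10 * real (card (A \<times> W - Z0)) < real (card (A \<times> W))"
        using ex[OF b0] by blast
      have "b \<otimes> inv b0 \<in> stab e True \<union> stab e False" if b: "b \<in> B" for b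
      proof -
        obtain Z y e' s where 1: "axis_blocks W m H b Z y e' s" "10 * real (card (A \<times> W - Z)) < real (card (A \<times> W))"
          using ex[OF b] by blast
        show ?thesis by (rule axis_blocks_common[OF wide 0(1) 1(1) fW 0(2) 1(2)])
      qed
      moreover have "10000 * \<kappa> \<le> ell e" using axis_blocksD(3,4)[OF 0(1)] by linarith
      ultimately show ?thesis using axis_blocksD(2,9)[OF 0(1)] by blast
    qed
    show ?thesis
    proof (cases "\<forall>b\<in>B. M' * real (card ((\<lambda>(a, w). a \<otimes> (b \<otimes> w)) ` (A \<times> W))) < real (card (A \<times> W))")
      case False
      then obtain b where b: "b \<in> B" "real (card (A \<times> W)) \<le> M' * real (card ((\<lambda>(a, w). a \<otimes> (b \<otimes> w)) ` (A \<times> W)))"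
        by (auto simp: not_less)
      have "real (card A) * real (card W) \<le> M * real (card ((\<lambda>(a, w). a \<otimes> (b \<otimes> w)) ` (A \<times> W)))"
        using order_trans[OF b(2) MM] by (simp add: card_cartesian_product)
      then show ?thesis using b(1) by blast
    qed (use alt in blast)
  next
    case False
    define f where "f = (\<lambda>(a, w). a \<otimes> (b0 \<otimes> w))"
    have "real (card A) * real (card W) \<le> real N * ((\<rho> + 92 * \<Delta>) / (40 * \<Delta>) + 1) *
        real (card ((\<lambda>(a, w). a \<otimes> (b0 \<otimes> w)) ` (A \<times> W)))"
    proof (rule card_product_ge[OF fin(1) fW AB(1) _ Bc[OF b0]])
      show "W \<subseteq> carrier G" using W by (simp add: admissible_def)
      fix a0 w0 assume "a0 \<in> A" "w0 \<in> W"
      show "real (card {a \<in> A. \<exists>w\<in>W. a \<otimes> (b0 \<otimes> w) = a0 \<otimes> (b0 \<otimes> w0)}) \<le> real N * ((\<rho> + 92 * \<Delta>) / (40 * \<Delta>) + 1)"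
      proof (rule occ_count[of _ W b0 "a0 \<otimes> (b0 \<otimes> w0)" 0])
        show "occ W b0 (a0 \<otimes> (b0 \<otimes> w0)) a" if "a \<in> {a \<in> A. \<exists>w\<in>W. a \<otimes> (b0 \<otimes> w) = a0 \<otimes> (b0 \<otimes> w0)}" for a
          using that W(1) b0 unfolding occ_def by (auto intro: sym)
        show "0 \<le> \<rho>" using am by simp
        show "0 \<le> ell a \<and> ell a \<le> 0 + \<rho>" if "a \<in> {a \<in> A. \<exists>w\<in>W. a \<otimes> (b0 \<otimes> w) = a0 \<otimes> (b0 \<otimes> w0)}" for a
          using that \<rho> by simp
      qed (rule b0)
    qed
    also have "\<dots> \<le> M * real (card ((\<lambda>(a, w). a \<otimes> (b0 \<otimes> w)) ` (A \<times> W)))"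
    proof (rule mult_right_mono)
      have "(\<rho> + 92 * \<Delta>) / (40 * \<Delta>) + 1 = \<rho> / (40 * \<Delta>) + 33 / 10" using Delta_pos by (simp add: field_simps)
      also have "\<rho> / (40 * \<Delta>) \<le> 1000000000 * real N * \<kappa> / (40 * \<Delta>)"
        using False Delta_pos by (intro divide_right_mono) auto
      also have "\<dots> = 25000000 * (real N * (\<kappa> / \<Delta>))" by simp
      also have "33 / 10 \<le> 5000000 * (real N * (\<kappa> / \<Delta>))"
        using mult_mono[OF N0 k0(2)] by simp
      finally have "(\<rho> + 92 * \<Delta>) / (40 * \<Delta>) + 1 \<le> 30000000 * (real N * (\<kappa> / \<Delta>))"
        by (simp add: mult.commute)
      then have "real N * ((\<rho> + 92 * \<Delta>) / (40 * \<Delta>) + 1) \<le> real N * (30000000 * (real N * (\<kappa> / \<Delta>)))"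
        by (intro mult_left_mono) auto
      also have "\<dots> = 30000000 * (real N ^ 2 * (\<kappa> / \<Delta>))" by (simp add: power2_eq_square)
      also have "\<dots> \<le> 30000000 * (real N ^ 3 * (\<kappa> / \<Delta>))"
        using N0 k0 by (intro mult_left_mono mult_right_mono power_increasing) auto
      finally show "real N * ((\<rho> + 92 * \<Delta>) / (40 * \<Delta>) + 1) \<le> M" unfolding M by simp
    qed simp
    finally show ?thesis using b0 by blast
  qed
qed

text \<open>The good letter \<open>b\<close> may change from one step to the next, because
  admissibility refers to all of \<open>B\<close> at once.\<close>

lemma diffuse_growth:
  assumes U: "A \<subseteq> U" "B \<subseteq> U" and b0: "b0 \<in> B" and M: "M = 30000000 * real N ^ 3 * \<kappa> / \<Delta>"
    and no: "\<not> (\<exists>e. lox (101 * \<Delta>) e \<and> 10000 * \<kappa> \<le> ell e \<and> (\<exists>a1\<in>A. \<exists>a2\<in>A. e = inv a1 \<otimes> a2) \<and>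
      (\<forall>b\<in>B. b \<otimes> inv b0 \<in> stab e True \<union> stab e False))"
  shows "\<exists>W \<subseteq> set_pow G U (2 * k + 1). admissible W \<and> W \<noteq> {} \<and> (real (card A) / M) ^ (k + 1) \<le> real (card W)"
proof -
  have "1 * 1 \<le> real N ^ 3 * (\<kappa> / \<Delta>)" using N1 kappa Delta_pos by (intro mult_mono) auto
  then have M1: "1 \<le> M" unfolding M by simp
  show ?thesis
  proof (induction k)
    case 0
    have "A \<subseteq> set_pow G U 1"
    proof
      fix a assume "a \<in> A"
      then have "a = foldr (\<otimes>) [a] \<one>" "length [a] = 1 \<and> set [a] \<subseteq> U" using U Ac by auto
      then show "a \<in> set_pow G U 1" unfolding set_pow_def by blast
    qed
    moreover have "real (card A) / M \<le> real (card A)" using M1 by (simp add: divide_le_eq mult_left_le_one_le mult_le_cancel_left1)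
    ultimately show ?case using admissible_A ne by (intro exI[of _ A]) simp
  next
    case (Suc k)
    then obtain W where W: "W \<subseteq> set_pow G U (2 * k + 1)" "admissible W" "W \<noteq> {}" "(real (card A) / M) ^ (k + 1) \<le> real (card W)"
      by blast
    obtain b where b: "b \<in> B" "real (card A) * real (card W) \<le> M * real (card ((\<lambda>(a, w). a \<otimes> (b \<otimes> w)) ` (A \<times> W)))"
      using diffuse_step[OF W(2,3) b0 M] no by blast
    let ?W = "(\<lambda>(a, w). a \<otimes> (b \<otimes> w)) ` (A \<times> W)"
    have "?W \<subseteq> set_pow G U (2 * Suc k + 1)"
    proof
      fix g assume "g \<in> ?W"
      then obtain a w where "a \<in> A" "w \<in> W" "g = a \<otimes> (b \<otimes> w)" by auto
      then have "a \<in> U" "w \<in> set_pow G U (2 * k + 1)" "g = a \<otimes> (b \<otimes> w)" using U W(1) by blast+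
      then show "g \<in> set_pow G U (2 * Suc k + 1)" using set_pow_mult2[of a U b w "2 * k + 1"] b(1) U by auto
    qed
    moreover have "admissible ?W" by (rule admissible_mult[OF W(2) b(1)])
    moreover have "?W \<noteq> {}" using ne W(3) by simp
    moreover have "(real (card A) / M) ^ (Suc k + 1) \<le> real (card ?W)"
    proof -
      have "(real (card A) / M) ^ (Suc k + 1) = real (card A) / M * (real (card A) / M) ^ (k + 1)" by simp
      also have "\<dots> \<le> real (card A) / M * real (card W)" using W(4) M1 by (intro mult_left_mono) auto
      also have "\<dots> \<le> real (card ?W)" using b(2) M1 by (simp add: divide_le_eq mult.commute)
      finally show ?thesis .
    qed
    ultimately show ?case by blast
  qed
qed

end

section \<open>A coset of the stabiliser, and the choice between the branches\<close>

context hyp_action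
begin

lemma stab_even_pow:
  assumes e: "lox c e" and z: "z \<in> stab e \<rho>"
  shows "z [^] int (2 * n) \<in> stab e True"
proof (induction n)
  case 0
  then show ?case using stab_pow[OF e, of 0] by simp
next
  case (Suc n)
  have zc: "z \<in> carrier G" using z by (rule stab_carrier)
  have "z [^] int (2 * Suc n) = z [^] int (2 * n) \<otimes> (z \<otimes> z)"
    using int_pow_mult[OF zc, of "int (2 * n)" 2] int_pow_mult[OF zc, of 1 1] zc by (simp add: add.commute)
  moreover have "z \<otimes> z \<in> stab e True" using stab_mult[OF z z] by simp
  ultimately show ?case using stab_mult[OF Suc] by fastforce
qed

text \<open>A large power of \<open>b f b\<^sup>-\<^sup>1\<close> is a loxodromic element whose ends are both those of \<open>e\<close> and their images under \<open>b\<close>.\<close>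
lemma conjugate_stab:
  assumes e: "lox c e" "c \<le> 300 * \<Delta>" and f: "f \<in> stab e True" "10000 * \<Delta> \<le> ell f" and b: "b \<in> carrier G"
    and z: "b \<otimes> f \<otimes> inv b \<in> stab e \<rho>"
  shows "\<exists>\<tau>. b \<in> stab e \<tau>"
proof -
  have fc [simp]: "f \<in> carrier G" using f(1) by (rule stab_carrier)
  define z where "z = b \<otimes> f \<otimes> inv b"
  have zc [simp]: "z \<in> carrier G" using b by (simp add: z_def)
  have conj: "b \<otimes> f [^] (k::int) = z [^] k \<otimes> b" for k
    by (rule conj_int_pow) (use b in \<open>simp_all add: z_def m_assoc\<close>)
  have cc: "c \<le> 400 * \<Delta>" "c \<le> 500 * \<Delta>" "c + 18 * \<Delta> \<le> 500 * \<Delta>" using e Delta_pos by linarith+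
  have flox: "lox (c + 18 * \<Delta>) f" by (rule stab_lox[OF e(1) cc(1) f])
  obtain \<tau>1 where t1: "asy (en f \<sigma>) (en e (\<sigma> = \<tau>1))" for \<sigma>
    using same_ends[OF e(1) cc(2) flox cc(3) f(2,1)] by blast
  \<comment> \<open>Conjugation by \<open>b\<close> shortens a displacement by at most 2
    \<open>ell b\<close>, so this power stays long; the even exponent 2 n makes it fix each
    end.\<close>
  obtain n :: nat where n: "10000 * \<Delta> + 2 * ell b < real n * (28 * \<Delta>)" using reals_Archimedean3[of "28 * \<Delta>"] Delta_pos by auto
  have n1: "1 \<le> 2 * n"
  proof (rule ccontr)
    assume "\<not> 1 \<le> 2 * n"
    then have "n = 0" by simp
    then have "10000 * \<Delta> + 2 * ell b < 0" using n by simp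
    then show False using Delta_pos zero_le_dist[of x0 "pt b"] by linarith
  qed
  define y where "y = z [^] int (2 * n)"
  have ys: "y \<in> stab e True" unfolding y_def by (rule stab_even_pow[OF e(1)]) (use z in \<open>simp add: z_def\<close>)
  have yc [simp]: "y \<in> carrier G" by (simp add: y_def)
  have ly: "10000 * \<Delta> \<le> ell y"
  proof -
    have "14 * \<Delta> * real (2 * n) \<le> ell (f [^] int (2 * n))" by (rule ell_pow_ge[OF flox])
    moreover have "\<phi> b (pt (f [^] int (2 * n))) = \<phi> y (pt b)"
      using conj[of "int (2 * n)"] b by (simp add: act_mult[symmetric] y_def)
    then have "ell (f [^] int (2 * n)) = dist (pt b) (\<phi> y (pt b))"
      using act_dist[OF b, of x0 "pt (f [^] int (2 * n))"] by simp
    moreover have "dist (pt b) (\<phi> y (pt b)) \<le> ell b + (ell y + ell b)"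
      using dist_triangle[of "pt b" "\<phi> y (pt b)" x0] dist_triangle[of x0 "\<phi> y (pt b)" "pt y"] dist_commute[of x0 "pt b"] by simp
    moreover have "14 * \<Delta> * real (2 * n) = real n * (28 * \<Delta>)" by simp
    ultimately show ?thesis using n by linarith
  qed
  have ylox: "lox (c + 18 * \<Delta>) y" by (rule stab_lox[OF e(1) cc(1) ys ly])
  obtain \<tau>2 where t2: "asy (en y \<sigma>) (en e (\<sigma> = \<tau>2))" for \<sigma>
    using same_ends[OF e(1) cc(2) ylox cc(3) ly ys] by blast
  have by_end: "asy (en y \<sigma>) (\<lambda>k. \<phi> b (en e (\<sigma> = \<tau>1) k))" for \<sigma>
  proof (rule asy_near)
    show "asy (\<lambda>k. \<phi> b (en f \<sigma> (2 * n * k))) (\<lambda>k. \<phi> b (en e (\<sigma> = \<tau>1) k))"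
      by (rule asy_trans[OF asy_act[OF asy_en_mult[OF flox n1] b] asy_act[OF t1 b]])
    fix k
    define j where "j = (if \<sigma> then int (2 * n * k) else - int (2 * n * k))"
    have "en y \<sigma> k = pt (z [^] j)"
      by (simp add: en_def y_def j_def int_pow_pow)
    moreover have "\<phi> b (en f \<sigma> (2 * n * k)) = \<phi> (z [^] j) (pt b)"
      using conj[of j] b by (simp add: en_def j_def act_mult[symmetric])
    ultimately show "dist (\<phi> b (en f \<sigma> (2 * n * k))) (en y \<sigma> k) \<le> ell b" by (simp add: dist_commute)
  qed
  have "asy (\<lambda>k. \<phi> b (en e \<sigma> k)) (en e (\<sigma> = (\<tau>1 = \<tau>2)))" for \<sigma>
  proof -
    have "((\<sigma> = \<tau>1) = \<tau>1) = \<sigma>" "((\<sigma> = \<tau>1) = \<tau>2) = (\<sigma> = (\<tau>1 = \<tau>2))" by auto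
    then show ?thesis using asy_trans[OF asy_sym[OF by_end[of "\<sigma> = \<tau>1"]] t2[of "\<sigma> = \<tau>1"]] by simp
  qed
  then show ?thesis using b unfolding stab_def by blast
qed

text \<open>Ping-pong works as soon as b1 \<open>U\<close> leaves the stabiliser. If it does not,
  \<open>b1\<close> itself is shown to stabilise the ends, and then so does all of
  \<open>U\<close>.\<close>

lemma coset_growth:
  assumes U: "finite U" "U \<subseteq> carrier G" and e: "lox (101 * \<Delta>) e" "10000 * \<kappa> \<le> ell e" "a1 \<in> U" "a2 \<in> U" "e = inv a1 \<otimes> a2"
    and B: "B \<subseteq> U" "b0 \<in> carrier G" "\<forall>b\<in>B. b \<otimes> inv b0 \<in> stab e True \<union> stab e False"
    and M: "M = real N * (502 * \<kappa> / \<Delta>) * (100 * real N)" and card: "8 * M \<le> real (card B)"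
  shows "virtually_Z G (generate G U) \<or>
    (\<exists>W \<subseteq> set_pow G U (2 * k + 1). (real (card B) / (4 * M)) ^ (k + 1) \<le> real (card W))"
proof -
  have k1: "1 \<le> \<kappa> / \<Delta>" and N0: "1 \<le> real N" using kappa Delta_pos N1 by simp_all
  have "1 * 1 * 1 \<le> real N * real N * (\<kappa> / \<Delta>)" using k1 N0 by (intro mult_mono) auto
  moreover have "M = 50200 * (real N * real N * (\<kappa> / \<Delta>))" unfolding M by simp
  ultimately have M1: "1 \<le> M" by linarith
  have fB: "finite B" using U B finite_subset by blast
  \<comment> \<open>Fixing the type \<rho> makes the quotient of any two letters fix each end; half
    of \<open>B\<close> is kept.\<close>
  let ?B = "\<lambda>\<rho>. {b \<in> B. b \<otimes> inv b0 \<in> stab e \<rho>}"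
  have "B = ?B True \<union> ?B False" using B by blast
  then have "card B \<le> card (?B True) + card (?B False)" using card_Un_le[of "?B True" "?B False"] by simp
  then have "\<exists>\<rho>. card B \<le> 2 * card (?B \<rho>)" by (cases "card (?B False) \<le> card (?B True)") (auto intro: exI[of _ True] exI[of _ False])
  then obtain \<rho> where \<rho>: "card B \<le> 2 * card (?B \<rho>)" by blast
  then have c4: "4 * M \<le> real (card (?B \<rho>))" using card by linarith
  then have "?B \<rho> \<noteq> {}" using M1 by (auto simp del: Collect_empty_eq)
  then obtain b1 where b1: "b1 \<in> ?B \<rho>" by blast
  have [simp]: "b1 \<in> carrier G" "b0 \<in> carrier G" using b1 B U by auto
  have F: "\<beta> \<otimes> inv b1 \<in> stab e True" if "\<beta> \<in> ?B \<rho>" for \<beta>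
  proof -
    have [simp]: "\<beta> \<in> carrier G" using that B U by auto
    have "(\<beta> \<otimes> inv b0) \<otimes> inv (b1 \<otimes> inv b0) \<in> stab e (\<rho> = \<rho>)"
      using that b1 by (intro stab_mult stab_inv) auto
    moreover have "(\<beta> \<otimes> inv b0) \<otimes> inv (b1 \<otimes> inv b0) = \<beta> \<otimes> inv b1"
      by (simp add: inv_mult_group m_assoc inv_cancel)
    ultimately show ?thesis by simp
  qed
  have c3: "101 * \<Delta> \<le> 300 * \<Delta>" "101 * \<Delta> \<le> 500 * \<Delta>" using Delta_pos by simp_all
  show ?thesis
  proof (cases "\<exists>v0\<in>U. b1 \<otimes> v0 \<notin> stab e True \<union> stab e False")
    case True
    then obtain v0 where v0: "v0 \<in> U" "b1 \<otimes> v0 \<notin> stab e True \<union> stab e False" by blast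
    obtain h where h: "minimal_axis G \<phi> \<Delta> \<kappa> N x0 (101 * \<Delta> + 18 * \<Delta>) h" "\<And>\<rho>. stab h \<rho> = stab e \<rho>"
      using minimal_axis_exists[OF e(1) c3(1) e(2)] by blast
    obtain W where W: "W \<subseteq> set_pow G U (2 * k + 1)" "(real (card (?B \<rho>)) / (2 * M)) ^ (k + 1) \<le> real (card W)"
      using periodic_growth[OF h(1) U _ _ _ v0(1) _ M c4, of b1 k] F v0(2) B(1) unfolding h(2) by auto
    have "(real (card B) / (4 * M)) ^ (k + 1) \<le> (real (card (?B \<rho>)) / (2 * M)) ^ (k + 1)"
    proof (rule power_mono)
      have "real (card B) \<le> 2 * real (card (?B \<rho>))" using \<rho> by linarith
      then have "real (card B) / (4 * M) \<le> 2 * real (card (?B \<rho>)) / (4 * M)" using M1 by (intro divide_right_mono) auto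
      then show "real (card B) / (4 * M) \<le> real (card (?B \<rho>)) / (2 * M)" by simp
    qed (use M1 in simp)
    then show ?thesis using W by (meson order_trans)
  next
    case False
    then have st: "b1 \<otimes> u \<in> stab e True \<union> stab e False" if "u \<in> U" for u using that by blast
    \<comment> \<open>Being the quotient of b1 \<beta> and b1 b1, the conjugate of \<beta> b1^-1 by
      \<open>b1\<close> stabilises the ends. \<open>conjugate_stab\<close> needs a long such
      element, and there are too many letters for all to be short.\<close>
    have "\<exists>\<beta>\<in>?B \<rho>. 10000 * \<kappa> < ell (\<beta> \<otimes> inv b1)"
    proof (rule ccontr)
      assume "\<not> ?thesis"
      then have "(\<lambda>\<beta>. \<beta> \<otimes> inv b1) ` ?B \<rho> \<subseteq> {g \<in> stab e True. ell g \<le> 10000 * \<kappa>}" using F by force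
      moreover have "inj_on (\<lambda>\<beta>. \<beta> \<otimes> inv b1) (?B \<rho>)"
        using B(1) U(2) by (intro inj_onI) (auto simp: subset_iff)
      ultimately have "card (?B \<rho>) \<le> card {g \<in> stab e True. ell g \<le> 10000 * \<kappa>}"
        using stab_small_card(1)[OF e(1) c3(2)] by (intro card_inj_on_le)
      then have "real (card (?B \<rho>)) \<le> real N * (502 * \<kappa> / \<Delta>)"
        using stab_small_card(2)[OF e(1) c3(2)] by linarith
      also have "\<dots> * 1 \<le> M" unfolding M using N0 kappa Delta_pos by (intro mult_left_mono) auto
      finally show False using c4 M1 by simp
    qed
    then obtain \<beta> where \<beta>: "\<beta> \<in> ?B \<rho>" "10000 * \<kappa> < ell (\<beta> \<otimes> inv b1)" by blast
    have [simp]: "\<beta> \<in> carrier G" using \<beta> B U by auto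
    have "\<beta> \<in> U" "b1 \<in> U" using \<beta> b1 B by auto
    then obtain \<rho>1 \<rho>2 where r: "b1 \<otimes> \<beta> \<in> stab e \<rho>1" "b1 \<otimes> b1 \<in> stab e \<rho>2" using st by (metis UnE)
    have "(b1 \<otimes> \<beta>) \<otimes> inv (b1 \<otimes> b1) \<in> stab e (\<rho>1 = \<rho>2)" using r by (intro stab_mult stab_inv)
    moreover have "(b1 \<otimes> \<beta>) \<otimes> inv (b1 \<otimes> b1) = b1 \<otimes> (\<beta> \<otimes> inv b1) \<otimes> inv b1"
      by (simp add: inv_mult_group m_assoc)
    ultimately have z: "b1 \<otimes> (\<beta> \<otimes> inv b1) \<otimes> inv b1 \<in> stab e (\<rho>1 = \<rho>2)" by simp
    have "10000 * \<Delta> \<le> ell (\<beta> \<otimes> inv b1)" using \<beta>(2) kappa by linarith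
    from conjugate_stab[OF e(1) c3(1) F[OF \<beta>(1)] this _ z] obtain \<tau> where \<tau>: "b1 \<in> stab e \<tau>" by auto
    have "u \<in> stab e True \<union> stab e False" if u: "u \<in> U" for u
    proof -
      obtain \<rho>3 where "b1 \<otimes> u \<in> stab e \<rho>3" using st[OF u] by blast
      then have "inv b1 \<otimes> (b1 \<otimes> u) \<in> stab e (\<tau> = \<rho>3)" using \<tau> by (intro stab_mult stab_inv)
      then have "u \<in> stab e (\<tau> = \<rho>3)" using u U by (auto simp: inv_cancel)
      then show ?thesis by (cases "\<tau> = \<rho>3") auto
    qed
    moreover have "e \<in> generate G U"
      unfolding e(5) using e(3,4) by (intro generate.eng generate.inv generate.incl)
    ultimately show ?thesis using virtually_Z_of_stab[OF e(1) c3(2)] by blast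
  qed
qed

lemma growth_alternative:
  fixes cls :: "'x \<Rightarrow> 'c"
  assumes U: "finite U" "U \<subseteq> carrier G" and en: "avg_displacement \<phi> U x0 \<le> energy \<phi> U + \<Delta>"
    and cls: "\<And>z w. 40 * \<Delta> < dist x0 z \<Longrightarrow> 40 * \<Delta> < dist x0 w \<Longrightarrow> cls z = cls w \<Longrightarrow> 37 * \<Delta> \<le> gp z w x0"
      "\<And>z w. 40 * \<Delta> < dist x0 z \<Longrightarrow> 40 * \<Delta> < dist x0 w \<Longrightarrow> cls z \<noteq> cls w \<Longrightarrow> gp z w x0 \<le> 40 * \<Delta>"
    and v: "v \<in> U" "10 ^ 14 * \<kappa> \<le> ell v" and large: "10 ^ 52 * real N ^ 6 * (\<kappa> / \<Delta>) ^ 2 \<le> real (card U)"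
  shows "virtually_Z G (generate G U) \<or>
    (\<exists>W \<subseteq> set_pow G U (2 * k + 1). (real (card U) / (10 ^ 52 * real N ^ 6 * (\<kappa> / \<Delta>) ^ 2)) ^ (k + 1) \<le> real (card W))"
proof -
  define r where "r = \<kappa> / \<Delta>"
  define Q where "Q = real N ^ 6 * r ^ 2"
  have r1: "1 \<le> r" and N0: "1 \<le> real N" using kappa Delta_pos N1 by (simp_all add: r_def)
  have "real N ^ i * r ^ 1 \<le> Q" if "i \<le> 6" for i
    unfolding Q_def using r1 N0 that by (intro mult_mono power_increasing) auto
  from this[of 1] this[of 2] this[of 3] have Q: "real N * r \<le> Q" "real N ^ 2 * r \<le> Q" "real N ^ 3 * r \<le> Q" by simp_all
  have "1 * 1 \<le> real N * r" "1 * 1 \<le> real N ^ 2 * r" "1 * 1 \<le> real N ^ 3 * r" using r1 N0 by (intro mult_mono; simp)+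
  then have p: "1 \<le> real N * r" "1 \<le> real N ^ 2 * r" "1 \<le> real N ^ 3 * r" by simp_all
  have large': "10 ^ 52 * Q \<le> real (card U)" using large by (simp add: Q_def r_def mult.assoc)
  \<comment> \<open>Each branch starts from a set of at least a hundredth of \<open>U\<close> and
    has its own loss \<open>D\<close>; the one constant of the theorem majorises 100 D.\<close>
  have shrink: "\<exists>W \<subseteq> set_pow G U (2 * k + 1). (real (card U) / (10 ^ 52 * real N ^ 6 * (\<kappa> / \<Delta>) ^ 2)) ^ (k + 1) \<le> real (card W)"
    if F: "real (card U) \<le> 100 * real n" and D: "0 < D" "100 * D \<le> 10 ^ 52 * Q"
      and ex: "\<exists>W \<subseteq> set_pow G U (2 * k + 1). (real n / D) ^ (k + 1) \<le> real (card W)" for n D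
  proof -
    have "real (card U) / (10 ^ 52 * Q) \<le> real (card U) / (100 * D)" using D by (intro divide_left_mono) auto
    also have "\<dots> \<le> 100 * real n / (100 * D)" using F D by (intro divide_right_mono) auto
    finally have "real (card U) / (10 ^ 52 * Q) \<le> real n / D" by simp
    moreover have "0 \<le> real (card U) / (10 ^ 52 * Q)" using Q p by simp
    ultimately have "(real (card U) / (10 ^ 52 * Q)) ^ (k + 1) \<le> (real n / D) ^ (k + 1)" by (intro power_mono)
    moreover have "10 ^ 52 * real N ^ 6 * (\<kappa> / \<Delta>) ^ 2 = 10 ^ 52 * Q" by (simp add: Q_def r_def)
    ultimately show ?thesis using ex by (metis (no_types, lifting) order_trans)
  qed
  have "100000000000000000000 * Q \<le> 10 ^ 52 * Q" using Q p by (intro mult_right_mono) auto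
  then have large'': "100000000000000000000 * Q \<le> real (card U)" using large' by linarith
  then have cU: "0 < real (card U)" using Q p by linarith
  \<comment> \<open>The threshold between short and long letters; 10^14 \<kappa> = 10^4 T is more
    than the 1000 T that \<open>concentrated_growth\<close> asks of \<open>v\<close>.\<close>
  define T where "T = 10000000000 * \<kappa>"
  have T: "10000 * \<kappa> \<le> T" "100 * \<Delta> \<le> T" "1000 * T \<le> ell v" using v kappa Delta_pos by (simp_all add: T_def)
  show ?thesis
  proof (cases "real (card {u \<in> U. ell u \<le> T}) \<le> real (card U) / 100")
    case False
    define M where "M = real N * (2 * T / (40 * \<Delta>) + 1)"
    have "2 * T / (40 * \<Delta>) = 500000000 * r" by (simp add: T_def r_def)
    then have "M = 500000000 * (real N * r) + real N" by (simp add: M_def algebra_simps)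
    moreover have "real N * 1 \<le> real N * r" using r1 by (intro mult_left_mono) auto
    ultimately have M: "M \<le> 1000000000 * (real N * r)" "0 < M" using p N0 by linarith+
    have MQ: "M \<le> 1000000000 * Q" using M Q by linarith
    have c2: "2 * M \<le> real (card {u \<in> U. ell u \<le> T})" using False MQ large'' Q p by linarith
    have "\<exists>W \<subseteq> set_pow G U (2 * k + 1). (real (card {u \<in> U. ell u \<le> T}) / (2 * M)) ^ (k + 1) \<le> real (card W)"
      by (rule concentrated_growth[OF U v(1) _ T(1) _ T(3) M_def c2]) auto
    then show ?thesis using False M MQ Q p by (intro disjI2 shrink[of "card {u \<in> U. ell u \<le> T}" "2 * M"]) auto
  next
    case True
    have Une: "U \<noteq> {}" using v by auto
    have "\<exists>A B. A \<subseteq> U \<and> B \<subseteq> U \<and> real (card U) \<le> 100 * real (card A) \<and>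
      real (card U) \<le> 100 * real (card B) \<and> (\<forall>a\<in>A. T < ell a) \<and> (\<forall>b\<in>B. T < ell b) \<and>
      (\<forall>a\<in>A. \<forall>b\<in>B. gp (pt (inv a)) (pt b) x0 \<le> 40 * \<Delta> \<and> gp (pt (inv b)) (pt a) x0 \<le> 40 * \<Delta> \<and> ell a \<le> ell b)"
      by (rule diffuse_split[where cls = cls, OF U Une en _ _ T(2) True]) (assumption | rule cls)+
    then obtain A B where "A \<subseteq> U \<and> B \<subseteq> U \<and> real (card U) \<le> 100 * real (card A) \<and>
      real (card U) \<le> 100 * real (card B) \<and> (\<forall>a\<in>A. T < ell a) \<and> (\<forall>b\<in>B. T < ell b) \<and>
      (\<forall>a\<in>A. \<forall>b\<in>B. gp (pt (inv a)) (pt b) x0 \<le> 40 * \<Delta> \<and> gp (pt (inv b)) (pt a) x0 \<le> 40 * \<Delta> \<and> ell a \<le> ell b)"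
      by (elim exE) (rule that)
    then have AB: "A \<subseteq> U" "B \<subseteq> U" "real (card U) \<le> 100 * real (card A)" "real (card U) \<le> 100 * real (card B)" "\<forall>a\<in>A. T < ell a"
      "\<forall>a\<in>A. \<forall>b\<in>B. gp (pt (inv a)) (pt b) x0 \<le> 40 * \<Delta> \<and> gp (pt (inv b)) (pt a) x0 \<le> 40 * \<Delta> \<and> ell a \<le> ell b"
      by blast+
    have ne: "A \<noteq> {}" "B \<noteq> {}" using AB(3,4) cU by auto
    interpret D: diffuse G \<phi> \<Delta> \<kappa> N x0 A B
    proof
      show "finite A" "finite B" using AB U finite_subset by blast+
      show "A \<subseteq> carrier G" "B \<subseteq> carrier G" using AB U by auto
      show "10000000000 * \<kappa> < ell a" if "a \<in> A" for a using AB(5) that by (simp add: T_def)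
    qed (use AB(6) ne in auto)
    obtain b0 where b0: "b0 \<in> B" using ne by blast
    show ?thesis
    proof (cases "\<exists>e. lox (101 * \<Delta>) e \<and> 10000 * \<kappa> \<le> ell e \<and> (\<exists>a1\<in>A. \<exists>a2\<in>A. e = inv a1 \<otimes> a2) \<and>
      (\<forall>b\<in>B. b \<otimes> inv b0 \<in> stab e True \<union> stab e False)")
      case True
      then obtain e a1 a2 where e: "lox (101 * \<Delta>) e" "10000 * \<kappa> \<le> ell e" "a1 \<in> A" "a2 \<in> A" "e = inv a1 \<otimes> a2"
        "\<forall>b\<in>B. b \<otimes> inv b0 \<in> stab e True \<union> stab e False" by blast
      define M where "M = real N * (502 * \<kappa> / \<Delta>) * (100 * real N)"
      have M: "M = 50200 * (real N ^ 2 * r)" by (simp add: M_def r_def power2_eq_square)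
      have MQ: "M \<le> 50200 * Q" "0 < M" using M Q p by linarith+
      have c8: "8 * M \<le> real (card B)" using MQ large'' AB(4) Q p by linarith
      have au: "a1 \<in> U" "a2 \<in> U" using e AB by auto
      have b0c: "b0 \<in> carrier G" using b0 AB U by auto
      show ?thesis
        using coset_growth[OF U e(1,2) au e(5) AB(2) b0c e(6) M_def c8, of k] MQ
          shrink[OF AB(4), of "4 * M"] Q p by auto
    next
      case False
      define M where "M = 30000000 * real N ^ 3 * \<kappa> / \<Delta>"
      have M: "M = 30000000 * (real N ^ 3 * r)" by (simp add: M_def r_def)
      have MQ: "M \<le> 30000000 * Q" "0 < M" using M Q p by linarith+
      show ?thesis
        using D.diffuse_growth[OF AB(1,2) b0 M_def False, of k] MQ Q p
        by (intro disjI2 shrink[OF AB(3), of M]) auto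
    qed
  qed
qed

end

section \<open>Passing from odd to all exponents, and the theorem\<close>

context group
begin

lemma set_pow_nonempty: "u \<in> U \<Longrightarrow> set_pow G U n \<noteq> {}"
proof (induction n)
  case 0
  then show ?case by (simp add: set_pow_def)
next
  case (Suc n)
  then obtain w where "w \<in> set_pow G U n" by blast
  then show ?case using set_pow_mult[OF Suc.prems] by blast
qed

lemma card_set_pow_mono:
  assumes "u \<in> U" "finite U" "U \<subseteq> carrier G"
  shows "card (set_pow G U n) \<le> card (set_pow G U (Suc n))"
proof (rule card_inj_on_le[of "\<lambda>w. u \<otimes> w"])
  show "inj_on (\<lambda>w. u \<otimes> w) (set_pow G U n)"
    using set_pow_carrier[OF assms(3)] assms(1,3) by (intro inj_onI) (auto simp: subset_iff)
qed (use assms set_pow_mult set_pow_finite in auto)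

end

theorem theorem3p34:
  fixes G :: "('g, 'm) monoid_scheme"
    and \<phi> :: "'g \<Rightarrow> 'x::metric_space \<Rightarrow> 'x"
    and \<Delta> \<kappa>\<^sub>0 :: real and N\<^sub>0 :: nat
    and U :: "'g set" and x\<^sub>0 :: 'x
  assumes "quasi_tree TYPE('x) \<Delta>" and "\<Delta> > 0"
    and "isometric_action G \<phi>"
    and "\<kappa>\<^sub>0 \<ge> \<Delta>" and "N\<^sub>0 \<ge> 1"
    and "acylindrical G \<phi> \<Delta> \<kappa>\<^sub>0 N\<^sub>0"
    and "finite U" and "U \<subseteq> carrier G"
    and "avg_displacement \<phi> U x\<^sub>0 \<le> energy \<phi> U + \<Delta>"
  shows "virtually_Z G (generate G U)
      \<or> displacement \<phi> U x\<^sub>0 < 10^14 * \<kappa>\<^sub>0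
      \<or> (\<forall>n::nat. real (card (set_pow G U n)) \<ge>
            (\<Delta>^2 / (10^52 * real N\<^sub>0 ^ 6 * \<kappa>\<^sub>0^2) * real (card U)) ^ ((n + 1) div 2))"
proof -
  interpret quasi_tree_space "TYPE('x)" \<Delta> by standard (rule assms(1))
  interpret group G using assms(3) by (simp add: isometric_action_def)
  interpret group_action G UNIV \<phi> using assms(3) by (simp add: isometric_action_def)
  interpret hyp_action G \<phi> \<Delta> \<kappa>\<^sub>0 N\<^sub>0 x\<^sub>0
  proof
    fix g h and x y :: 'x
    show "\<phi> (g \<otimes>\<^bsub>G\<^esub> h) x = \<phi> g (\<phi> h x)" if "g \<in> carrier G" "h \<in> carrier G"
      using composition_rule[of x g h] that by simp
    show "\<phi> \<one>\<^bsub>G\<^esub> x = x" using fun_cong[OF id_eq_one, of x] by simp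
    show "dist (\<phi> g x) (\<phi> g y) = dist x y" if "g \<in> carrier G"
      using assms(3) that by (simp add: isometric_action_def)
    show "finite {g \<in> carrier G. dist x (\<phi> g x) \<le> 100 * \<Delta> \<and> dist y (\<phi> g y) \<le> 100 * \<Delta>} \<and>
      card {g \<in> carrier G. dist x (\<phi> g x) \<le> 100 * \<Delta> \<and> dist y (\<phi> g y) \<le> 100 * \<Delta>} \<le> N\<^sub>0" if "\<kappa>\<^sub>0 \<le> dist x y"
      using assms(6) that unfolding acylindrical_def Let_def by blast
  qed (use assms gromov_hyperbolic geodesic_point in auto)
  define \<alpha> where "\<alpha> = \<Delta>^2 / (10^52 * real N\<^sub>0 ^ 6 * \<kappa>\<^sub>0^2)"
  have \<alpha>: "\<alpha> * real (card U) = real (card U) / (10 ^ 52 * real N\<^sub>0 ^ 6 * (\<kappa>\<^sub>0 / \<Delta>) ^ 2)"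
    by (simp add: \<alpha>_def power_divide)
  have \<alpha>0: "0 \<le> \<alpha> * real (card U)" by (simp add: \<alpha>_def)
  have "real (card (set_pow G U n)) \<ge> (\<alpha> * real (card U)) ^ ((n + 1) div 2)"
    if nv: "\<not> virtually_Z G (generate G U)" and disp: "\<not> displacement \<phi> U x\<^sub>0 < 10^14 * \<kappa>\<^sub>0" for n
  \<comment> \<open>If \<alpha> |U| <= 1 the bound is at most 1 and U^n is nonempty. Empty
    \<open>U\<close> is separate: both sides are 1 at n = 0, where 0^0 = 1 matters, and the bound is
    0 afterwards.\<close>
  proof (cases "U = {} \<or> \<alpha> * real (card U) \<le> 1")
    case True
    consider "U = {}" "n = 0" | "U = {}" "n \<noteq> 0" | u where "u \<in> U" "\<alpha> * real (card U) \<le> 1" using True by blast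
    then show ?thesis
    proof cases
      case 1
      then show ?thesis by (simp add: set_pow_def)
    next
      case 2
      then have "(n + 1) div 2 \<noteq> 0" by simp
      then show ?thesis using 2(1) by (simp add: power_0_left)
    next
      case 3
      have "(\<alpha> * real (card U)) ^ ((n + 1) div 2) \<le> 1" using \<alpha>0 3(2) by (rule power_le_one)
      also have "1 \<le> real (card (set_pow G U n))"
        using set_pow_nonempty[OF 3(1), of n] set_pow_finite[OF assms(7), of n] by (simp add: Suc_le_eq card_gt_0_iff)
      finally show ?thesis .
    qed
  next
    case False
    then obtain u where u: "u \<in> U" and big: "1 < \<alpha> * real (card U)" by auto
    have "0 < 10 ^ 52 * real N\<^sub>0 ^ 6 * (\<kappa>\<^sub>0 / \<Delta>) ^ 2" using assms(2,4,5) by simp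
    then have large: "10 ^ 52 * real N\<^sub>0 ^ 6 * (\<kappa>\<^sub>0 / \<Delta>) ^ 2 \<le> real (card U)"
      using big unfolding \<alpha> by (simp add: less_divide_eq)
    have "displacement \<phi> U x\<^sub>0 \<in> (\<lambda>u. dist x\<^sub>0 (\<phi> u x\<^sub>0)) ` U"
      unfolding displacement_def using u assms(7) by (intro Max_in) auto
    then obtain v where v: "v \<in> U" "10 ^ 14 * \<kappa>\<^sub>0 \<le> dist x\<^sub>0 (\<phi> v x\<^sub>0)" using disp by auto
    \<comment> \<open>A direction is labelled by the component of its points outside the ball of
      radius 40 \<Delta>, represented by the predicate \<open>path_component\<close> itself. The two
      lemmas on components give the thresholds 37 \<Delta> and 40 \<Delta>.\<close>
    define cls where "cls = path_component (- cball x\<^sub>0 (40 * \<Delta>))"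
    have cls: "cls z = cls w \<longleftrightarrow> path_component (- cball x\<^sub>0 (40 * \<Delta>)) z w"
      if "40 * \<Delta> < dist x\<^sub>0 z" "40 * \<Delta> < dist x\<^sub>0 w" for z w
      using that unfolding cls_def path_component_eq_eq by auto
    have grow: "\<exists>W \<subseteq> set_pow G U (2 * k + 1). (\<alpha> * real (card U)) ^ (k + 1) \<le> real (card W)" for k
    proof -
      have "virtually_Z G (generate G U) \<or>
        (\<exists>W \<subseteq> set_pow G U (2 * k + 1).
          (real (card U) / (10 ^ 52 * real N\<^sub>0 ^ 6 * (\<kappa>\<^sub>0 / \<Delta>) ^ 2)) ^ (k + 1) \<le> real (card W))"
      proof (rule growth_alternative[OF assms(7-9) _ _ v large, of cls])
        fix z w :: 'x assume zw: "40 * \<Delta> < dist x\<^sub>0 z" "40 * \<Delta> < dist x\<^sub>0 w"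
        show "37 * \<Delta> \<le> gp z w x\<^sub>0" if "cls z = cls w"
          using gp_same_component[of x\<^sub>0 "40 * \<Delta>" z w] that cls[OF zw] by simp
        show "gp z w x\<^sub>0 \<le> 40 * \<Delta>" if "cls z \<noteq> cls w"
          using gp_different_component[of x\<^sub>0 "40 * \<Delta>" z w] that cls[OF zw] by simp
      qed
      then show ?thesis using nv unfolding \<alpha> by blast
    qed
    have odd: "(\<alpha> * real (card U)) ^ (k + 1) \<le> real (card (set_pow G U (2 * k + 1)))" for k
    proof -
      obtain W where W: "W \<subseteq> set_pow G U (2 * k + 1)" "(\<alpha> * real (card U)) ^ (k + 1) \<le> real (card W)"
        using grow by blast
      have "card W \<le> card (set_pow G U (2 * k + 1))" by (rule card_mono[OF set_pow_finite[OF assms(7)] W(1)])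
      then show ?thesis using W(2) by linarith
    qed
    show ?thesis
    proof (cases "even n")
      case False
      then obtain k where "n = 2 * k + 1" by (rule oddE)
      then show ?thesis using odd[of k] by simp
    next
      \<comment> \<open>For even n > 0 the exponent is that of n - 1, and left multiplication by a
        letter embeds U^(n-1) in U^n.\<close>
      case even: True
      show ?thesis
      proof (cases n)
        case 0
        then show ?thesis by (simp add: set_pow_def)
      next
        case (Suc m)
        then obtain k where k: "m = 2 * k + 1" using even by (metis even_Suc oddE)
        have "(n + 1) div 2 = k + 1" using Suc k by simp
        moreover have "card (set_pow G U m) \<le> card (set_pow G U n)"
          unfolding Suc by (rule card_set_pow_mono[OF u assms(7,8)])
        ultimately show ?thesis using odd[of k] k by simp
      qed
    qed
  qed
  then show ?thesis unfolding \<alpha>_def by blast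
qed

end
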